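(* Let $\mathcal{H}$ be a hypergraph with $\mu\ge1$ vertices. (i) If $\mathcal{H}$ is a string, then $I(\mathcal{H})$ is Cohen-Macaulay if and only if either $\mu=1$, or $\mu=3$ and $\mathcal{H}$ is not saturated. (ii) If $\mathcal{H}$ is a cycle, then $I(\mathcal{H})$ is Cohen-Macaulay if and only if either $\mu=3$ and $\mathcal{H}$ is not saturated, or $\mu=5$ and $\mathcal{H}$ does not contain two adjacent closed vertices.
   Context: Fix a field $k$. A hypergraph on $V=[\mu]=\{1,\dots,\mu\}$ is a set $\mathcal{H}$ of nonempty subsets of $V$ (called faces) whose union is $V$. It is separated if for all $1\le j_1<j_2\le\mu$ there are faces $F_1,F_2\in\mathcal{H}$ with $j_1\in F_1\setminus F_2$ and $j_2\in F_2\setminus F_1$. All hypergraphs are assumed separated. Let $R=k[x_F : F\in\mathcal{H}]$ and let $I(\mathcal{H})=(m_1,\dots,m_\mu)\subseteq R$ with $m_i=\prod_{F\in\mathcal{H},\,i\in F}x_F$; by separatedness these are minimal generators. The ideal $I=I(\mathcal{H})$ is called Cohen-Macaulay if $R/I$ is a Cohen-Macaulay ring, equivalently $\operatorname{grade}(I)=\operatorname{pd}_R(R/I)$. A vertex $v$ is closed if $\{v\}\in\mathcal{H}$, and open otherwise. $\mathcal{H}$ is saturated if all its vertices are closed. Two vertices are adjacent if they are distinct and lie in a common face. A string on $[\mu]$ is a (separated) hypergraph whose faces are exactly $\{i,i+1\}$ for $i=1,\dots,\mu-1$, together with some singletons; separatedness forces $\{1\},\{\mu\}\in\mathcal{H}$.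 For $\mu\ge3$, a cycle on $[\mu]$ is a hypergraph whose faces are exactly $\{1,2\},\dots,\{\mu-1,\mu\},\{\mu,1\}$ together with some (possibly none, possibly all) of the singletons $\{i\}$. *)

theory Defs
  imports
    "HOL-Algebra.QuotRing"
    "HOL-Algebra.Ring_Divisibility"
    "HOL-Library.Poly_Mapping"
    "HOL-Library.Extended_Nat"
begin

section \<open>Cohen-Macaulay rings\<close>

definition (in ring) regular_sequence :: "'a list \<Rightarrow> bool" where
  \<comment> \<open>\<open>as ! i\<close> is a nonzerodivisor modulo the ideal generated by its predecessors, and the
     quotient by the whole sequence is not the zero ring. The empty sequence is regular
     if and only if the ring is nonzero.\<close>
  "regular_sequence as \<longleftrightarrow>
     set as \<subseteq> carrier R \<and>
     (\<forall>i < length as. \<forall>b \<in> carrier R.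
        as ! i \<otimes> b \<in> Idl (set (take i as)) \<longrightarrow> b \<in> Idl (set (take i as))) \<and>
     Idl (set as) \<noteq> carrier R"

definition (in ring) ideal_grade :: "'a set \<Rightarrow> enat" where
  "ideal_grade I = (SUP as \<in> {as. regular_sequence as \<and> set as \<subseteq> I}. enat (length as))"

definition (in ring) prime_height :: "'a set \<Rightarrow> enat" where
  \<comment> \<open>supremum of the lengths \<open>n\<close> of the chains of primes
     \<open>Q 0 \<subset> Q 1 \<subset> \<dots> \<subset> Q n = P\<close>\<close>
  "prime_height P =
     (SUP n \<in> {n. \<exists>Q :: nat \<Rightarrow> 'a set.
                 (\<forall>i \<le> n. primeideal (Q i) R) \<and> (\<forall>i < n. Q i \<subset> Q (Suc i)) \<and> Q n = P}. enat n)"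

text \<open>
  The definition of a Cohen-Macaulay ring in Eisenbud, \<^emph>\<open>Commutative Algebra\<close>, Section 18.2: a
  commutative Noetherian ring in which every maximal ideal has grade (the depth of the ideal on
  the ring) equal to its height (codimension).
\<close>

definition cohen_macaulay_ring :: "('a, 'b) ring_scheme \<Rightarrow> bool" where
  "cohen_macaulay_ring A \<longleftrightarrow>
     cring A \<and> noetherian_ring A \<and>
     (\<forall>M. maximalideal M A \<longrightarrow> ring.ideal_grade A M = ring.prime_height A M)"

definition cohen_macaulay_ideal :: "('a, 'b) ring_scheme \<Rightarrow> 'a set \<Rightarrow> bool" where
  "cohen_macaulay_ideal R I \<longleftrightarrow> cohen_macaulay_ring (R Quot I)"


section \<open>Polynomial rings\<close>

text \<open>
  The type \<open>('x \<Rightarrow>\<^sub>0 nat) \<Rightarrow>\<^sub>0 'k\<close> is the polynomial ring with all elements of \<open>'x\<close> as variables;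
  \<open>poly_ring X\<close> is its subring of polynomials in the variables from \<open>X\<close>.
\<close>

definition poly_ring :: "'x set \<Rightarrow> (('x \<Rightarrow>\<^sub>0 nat) \<Rightarrow>\<^sub>0 'k::field) ring" where
  "poly_ring X =
     \<lparr>carrier = {p. \<forall>m \<in> Poly_Mapping.keys p. Poly_Mapping.keys m \<subseteq> X},
      mult = (*), one = 1, zero = 0, add = (+)\<rparr>"

definition poly_var :: "'x \<Rightarrow> ('x \<Rightarrow>\<^sub>0 nat) \<Rightarrow>\<^sub>0 'k::field" where
  "poly_var x = Poly_Mapping.single (Poly_Mapping.single x 1) 1"

lemma poly_ring_simps [simp]:
  "p \<in> carrier (poly_ring X) \<longleftrightarrow> (\<forall>m \<in> Poly_Mapping.keys p. Poly_Mapping.keys m \<subseteq> X)"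
  "mult (poly_ring X) = (*)" "one (poly_ring X) = 1"
  "zero (poly_ring X) = 0" "add (poly_ring X) = (+)"
  by (simp_all add: poly_ring_def)

lemma cring_poly_ring: "cring (poly_ring X :: (('x \<Rightarrow>\<^sub>0 nat) \<Rightarrow>\<^sub>0 'k::field) ring)"
proof (rule cringI)
  show "abelian_group (poly_ring X :: (('x \<Rightarrow>\<^sub>0 nat) \<Rightarrow>\<^sub>0 'k) ring)"
  proof (rule abelian_groupI)
    fix p q :: "('x \<Rightarrow>\<^sub>0 nat) \<Rightarrow>\<^sub>0 'k"
    assume "p \<in> carrier (poly_ring X)" "q \<in> carrier (poly_ring X)"
    then show "p \<oplus>\<^bsub>poly_ring X\<^esub> q \<in> carrier (poly_ring X)"
      using Poly_Mapping.keys_add[of p q] by (simp, blast)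
  next
    fix p :: "('x \<Rightarrow>\<^sub>0 nat) \<Rightarrow>\<^sub>0 'k"
    assume "p \<in> carrier (poly_ring X)"
    then show "\<exists>q \<in> carrier (poly_ring X). q \<oplus>\<^bsub>poly_ring X\<^esub> p = \<zero>\<^bsub>poly_ring X\<^esub>"
      by (intro bexI[of _ "- p"]) simp_all
  qed (simp_all add: algebra_simps)
  show "Group.comm_monoid (poly_ring X :: (('x \<Rightarrow>\<^sub>0 nat) \<Rightarrow>\<^sub>0 'k) ring)"
  proof (rule comm_monoidI)
    fix p q :: "('x \<Rightarrow>\<^sub>0 nat) \<Rightarrow>\<^sub>0 'k"
    assume pq: "p \<in> carrier (poly_ring X)" "q \<in> carrier (poly_ring X)"
    have "Poly_Mapping.keys m \<subseteq> X" if m: "m \<in> Poly_Mapping.keys (p * q)" for m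
    proof -
      obtain a b where "m = a + b" "a \<in> Poly_Mapping.keys p" "b \<in> Poly_Mapping.keys q"
        using m Poly_Mapping.keys_mult[of p q] by blast
      then show ?thesis
        using pq Poly_Mapping.keys_add[of a b] by (simp, blast)
    qed
    then show "p \<otimes>\<^bsub>poly_ring X\<^esub> q \<in> carrier (poly_ring X)"
      by simp
  qed (simp_all add: algebra_simps)
qed (simp_all add: algebra_simps)


section \<open>Hypergraphs and their ideals\<close>

definition hypergraph :: "nat \<Rightarrow> nat set set \<Rightarrow> bool" where
  "hypergraph \<mu> H \<longleftrightarrow> (\<forall>F \<in> H. F \<noteq> {} \<and> F \<subseteq> {1..\<mu>}) \<and> \<Union>H = {1..\<mu>}"

definition separated :: "nat \<Rightarrow> nat set set \<Rightarrow> bool" where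
  "separated \<mu> H \<longleftrightarrow>
     (\<forall>i j. 1 \<le> i \<and> i < j \<and> j \<le> \<mu> \<longrightarrow> (\<exists>F \<in> H. \<exists>G \<in> H. i \<in> F - G \<and> j \<in> G - F))"

definition hypergraph_gen :: "nat set set \<Rightarrow> nat \<Rightarrow> (nat set \<Rightarrow>\<^sub>0 nat) \<Rightarrow>\<^sub>0 'k::field" where
  "hypergraph_gen H i = (\<Prod>F \<in> {F \<in> H. i \<in> F}. poly_var F)"

definition hypergraph_ideal :: "nat \<Rightarrow> nat set set \<Rightarrow> ((nat set \<Rightarrow>\<^sub>0 nat) \<Rightarrow>\<^sub>0 'k::field) set" where
  "hypergraph_ideal \<mu> H = Idl\<^bsub>poly_ring H\<^esub> (hypergraph_gen H ` {1..\<mu>})"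

definition closed_vertex :: "nat set set \<Rightarrow> nat \<Rightarrow> bool" where
  "closed_vertex H v \<longleftrightarrow> {v} \<in> H"

definition saturated :: "nat \<Rightarrow> nat set set \<Rightarrow> bool" where
  "saturated \<mu> H \<longleftrightarrow> (\<forall>v \<in> {1..\<mu>}. closed_vertex H v)"

definition adjacent :: "nat set set \<Rightarrow> nat \<Rightarrow> nat \<Rightarrow> bool" where
  "adjacent H v w \<longleftrightarrow> v \<noteq> w \<and> (\<exists>F \<in> H. v \<in> F \<and> w \<in> F)"

definition string_hypergraph :: "nat \<Rightarrow> nat set set \<Rightarrow> bool" where
  "string_hypergraph \<mu> H \<longleftrightarrow>
     hypergraph \<mu> H \<and> separated \<mu> H \<and>
     (\<exists>S \<subseteq> {1..\<mu>}. H = {{i, i + 1} | i. 1 \<le> i \<and> i < \<mu>} \<union> {{i} | i. i \<in> S})"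

definition cycle_hypergraph :: "nat \<Rightarrow> nat set set \<Rightarrow> bool" where
  "cycle_hypergraph \<mu> H \<longleftrightarrow>
     3 \<le> \<mu> \<and> hypergraph \<mu> H \<and> separated \<mu> H \<and>
     (\<exists>S \<subseteq> {1..\<mu>}. H = {{i, i + 1} | i. 1 \<le> i \<and> i < \<mu>} \<union> {{\<mu>, 1}} \<union> {{i} | i. i \<in> S})"

end

theory Submission
  imports Defs
begin

text \<open>Failure. A Cohen-Macaulay ideal is unmixed: a facet \<open>F\<close> bounds the depth at the origin by
  \<open>card F\<close>, while the height is at least the size of any face. Strings and cycles have a cover of
  the vertices by \<open>\<lceil>\<mu>/2\<rceil>\<close> faces, and all but the listed ones also have a strictly larger minimal
  cover, made of disjoint stars; the exceptions are the open cycles with 4 and 7 vertices, which are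
  unmixed. Their independence complexes have nonzero reduced cohomology in degrees 0 and 1, whose
  classes give nontrivial Koszul cocycles and so exclude regular sequences of length 2 and 3.

  Success. The complexes that remain are vertex decomposable of dimension \<open>d - 1\<close>. Every maximal ideal
  \<open>N\<close> contains a nonzero polynomial \<open>Q\<^sub>v\<close> in each variable \<open>v\<close> (Nullstellensatz), which may be taken
  divisible by \<open>v\<close>. The complete homogeneous polynomials of degrees \<open>1, \<dots>, d\<close> in the \<open>Q\<^sub>v\<close> lie in
  \<open>N\<close> and restrict to a regular sequence on every facet, and vertex decomposition carries
  regularity over to the quotient ring. Heights are bounded by \<open>d\<close> by the Coquand-Lombardi
  characterisation of Krull dimension and algebraic dependence of \<open>d + 1\<close> polynomials in \<open>d\<close>
  variables.\<close>

section \<open>Regular sequences\<close>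

text \<open>The support of the generator m_i is \<open>star H i\<close>, so a set of hypergraph
  faces contains no such support exactly when its complement covers the vertices: faces of the
  simplicial complex are complements of covers, and facets are complements of minimal covers. This
  is why covers decide unmixedness. Failure can be tested at the origin alone, but success concerns
  every maximal ideal N over an arbitrary field. N need not belong to a point with coordinates in k,
  and a finite field may have too few linear forms for a linear system of parameters. A nonzero
  univariate polynomial of N in each variable overcomes both obstacles. Symmetric expressions in
  these are used because one sequence must be regular on all facets at once: setting some arguments
  to zero leaves the same expression in the others. Divisibility of \<open>Q v\<close> by v makes it
  vanish on the facets without v. All algebra takes place in the polynomial ring over the whole
  variable type, modulo ideals that kill the variables outside H; carrier-based quotients enter only
  through \<open>ring_presentation\<close>.\<close>

definition ring_ideal :: "'a::comm_ring_1 set \<Rightarrow> bool" where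
  "ring_ideal J \<longleftrightarrow> 0 \<in> J \<and> (\<forall>a\<in>J. \<forall>b\<in>J. a + b \<in> J) \<and> (\<forall>a\<in>J. \<forall>r. r * a \<in> J)"

lemma ring_idealI:
  assumes "0 \<in> J" "\<And>a b. a \<in> J \<Longrightarrow> b \<in> J \<Longrightarrow> a + b \<in> J" "\<And>a r. a \<in> J \<Longrightarrow> r * a \<in> J"
  shows "ring_ideal J"
  using assms by (auto simp: ring_ideal_def)

context
  fixes J :: "'a::comm_ring_1 set"
  assumes J: "ring_ideal J"
begin

lemma ring_ideal_zero: "0 \<in> J"
  using J by (auto simp: ring_ideal_def)

lemma ring_ideal_add: "a \<in> J \<Longrightarrow> b \<in> J \<Longrightarrow> a + b \<in> J"
  using J by (auto simp: ring_ideal_def)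

lemma ring_ideal_mult_left: "a \<in> J \<Longrightarrow> r * a \<in> J"
  using J by (auto simp: ring_ideal_def)

lemma ring_ideal_mult_right: "a \<in> J \<Longrightarrow> a * r \<in> J"
  using ring_ideal_mult_left[of a r] by (simp add: mult.commute)

lemma ring_ideal_uminus: "a \<in> J \<Longrightarrow> - a \<in> J"
  using ring_ideal_mult_left[of a "- 1"] by simp

lemma ring_ideal_diff: "a \<in> J \<Longrightarrow> b \<in> J \<Longrightarrow> a - b \<in> J"
  using ring_ideal_add[of a "- b"] ring_ideal_uminus by simp

lemma ring_ideal_sum: "(\<And>i. i \<in> A \<Longrightarrow> f i \<in> J) \<Longrightarrow> sum f A \<in> J"
  by (induction A rule: infinite_finite_induct) (auto intro: ring_ideal_zero ring_ideal_add)

lemma ring_ideal_diff_cancel: "a - b \<in> J \<Longrightarrow> a \<in> J \<longleftrightarrow> b \<in> J"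
  using ring_ideal_add[of "a - b" b] ring_ideal_diff[of a "a - b"] by auto

lemma ring_ideal_UNIV_iff: "J = UNIV \<longleftrightarrow> 1 \<in> J"
  using ring_ideal_mult_left[of 1] by auto

end

definition prime_set :: "'a::comm_ring_1 set \<Rightarrow> bool" where
  "prime_set P \<longleftrightarrow> ring_ideal P \<and> 1 \<notin> P \<and> (\<forall>a b. a * b \<in> P \<longrightarrow> a \<in> P \<or> b \<in> P)"

section \<open>Weak regularity modulo an ideal\<close>

definition nonzerodivisor_mod :: "'a::comm_ring_1 set \<Rightarrow> 'a \<Rightarrow> bool" where
  "nonzerodivisor_mod J f \<longleftrightarrow> (\<forall>b. f * b \<in> J \<longrightarrow> b \<in> J)"

lemma nonzerodivisor_modD: "nonzerodivisor_mod J f \<Longrightarrow> f * b \<in> J \<Longrightarrow> b \<in> J"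
  by (auto simp: nonzerodivisor_mod_def)

definition ideal_adjoin :: "'a::comm_ring_1 set \<Rightarrow> 'a \<Rightarrow> 'a set" where
  "ideal_adjoin J f = {a + f * b | a b. a \<in> J}"

primrec ideal_adjoins :: "'a::comm_ring_1 set \<Rightarrow> 'a list \<Rightarrow> 'a set" where
  "ideal_adjoins J [] = J"
| "ideal_adjoins J (f # fs) = ideal_adjoins (ideal_adjoin J f) fs"

text \<open>Properness of the final ideal is left out, so that regularity also makes sense in the
  zero quotient and exact sequences need no side conditions. It is recovered whenever the sequence
  and J lie in a proper ideal.\<close>

primrec weakly_regular :: "'a::comm_ring_1 set \<Rightarrow> 'a list \<Rightarrow> bool" where
  "weakly_regular J [] \<longleftrightarrow> True"
| "weakly_regular J (f # fs) \<longleftrightarrow>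
     nonzerodivisor_mod J f \<and> weakly_regular (ideal_adjoin J f) fs"

lemma ideal_adjoinI: "a \<in> J \<Longrightarrow> x = a + f * b \<Longrightarrow> x \<in> ideal_adjoin J f"
  by (auto simp: ideal_adjoin_def)

lemma ideal_adjoinE:
  assumes "x \<in> ideal_adjoin J f" obtains a b where "a \<in> J" "x = a + f * b"
  using assms by (auto simp: ideal_adjoin_def)

lemma ring_ideal_adjoin:
  assumes "ring_ideal J" shows "ring_ideal (ideal_adjoin J f)"
proof (rule ring_idealI)
  show "0 \<in> ideal_adjoin J f"
    by (rule ideal_adjoinI[where a = 0 and b = 0]) (use ring_ideal_zero[OF assms] in auto)
next
  fix x y assume "x \<in> ideal_adjoin J f" "y \<in> ideal_adjoin J f"
  then obtain a b c d where "a \<in> J" "x = a + f * b" "c \<in> J" "y = c + f * d"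
    by (auto elim!: ideal_adjoinE)
  then show "x + y \<in> ideal_adjoin J f"
    by (intro ideal_adjoinI[where a = "a + c" and b = "b + d"])
      (auto simp: algebra_simps intro: ring_ideal_add[OF assms])
next
  fix x r assume "x \<in> ideal_adjoin J f"
  then obtain a b where "a \<in> J" "x = a + f * b"
    by (auto elim!: ideal_adjoinE)
  then show "r * x \<in> ideal_adjoin J f"
    using ring_ideal_mult_left[OF assms, of a r]
    by (intro ideal_adjoinI[where a = "r * a" and b = "r * b"]) (auto simp: algebra_simps)
qed

lemma ring_ideal_adjoins: "ring_ideal J \<Longrightarrow> ring_ideal (ideal_adjoins J fs)"
  by (induction fs arbitrary: J) (auto intro: ring_ideal_adjoin)

lemma subset_ideal_adjoin: "J \<subseteq> ideal_adjoin J f"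
  by (auto intro: ideal_adjoinI[where b = 0])

lemma in_ideal_adjoin: "ring_ideal J \<Longrightarrow> f \<in> ideal_adjoin J f"
  by (rule ideal_adjoinI[where a = 0 and b = 1]) (auto intro: ring_ideal_zero)

lemma subset_ideal_adjoins: "J \<subseteq> ideal_adjoins J fs"
  by (induction fs arbitrary: J) (use subset_ideal_adjoin in fastforce)+

lemma set_subset_ideal_adjoins: "ring_ideal J \<Longrightarrow> set fs \<subseteq> ideal_adjoins J fs"
proof (induction fs arbitrary: J)
  case (Cons f fs)
  then show ?case
    using subset_ideal_adjoins[of "ideal_adjoin J f" fs] in_ideal_adjoin[of J f]
    by (auto simp: ring_ideal_adjoin)
qed auto

lemma ideal_adjoin_subset:
  assumes "ring_ideal K" "J \<subseteq> K" "f \<in> K" shows "ideal_adjoin J f \<subseteq> K"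
  using assms by (auto simp: ideal_adjoin_def intro!: ring_ideal_add ring_ideal_mult_right)

lemma ideal_adjoins_subset:
  assumes "ring_ideal K" "J \<subseteq> K" "set fs \<subseteq> K" shows "ideal_adjoins J fs \<subseteq> K"
  using assms(2,3)
proof (induction fs arbitrary: J)
  case (Cons f fs)
  then show ?case
    using Cons.IH[of "ideal_adjoin J f"] ideal_adjoin_subset[OF assms(1), of J f] by simp
qed auto

lemma ideal_adjoin_commute:
  "ideal_adjoin (ideal_adjoin J f) g = ideal_adjoin (ideal_adjoin J g) f"
proof -
  have "ideal_adjoin (ideal_adjoin J f) g \<subseteq> ideal_adjoin (ideal_adjoin J g) f" for f g
  proof
    fix x assume "x \<in> ideal_adjoin (ideal_adjoin J f) g"
    then obtain a b c where "a \<in> J" "x = a + f * b + g * c"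
      by (auto elim!: ideal_adjoinE)
    then show "x \<in> ideal_adjoin (ideal_adjoin J g) f"
      by (intro ideal_adjoinI[of "a + g * c" _ _ _ b] ideal_adjoinI[of a _ _ _ c])
        (auto simp: algebra_simps)
  qed
  then show ?thesis by blast
qed

lemma weakly_regular_append:
  "weakly_regular J (fs @ gs) \<longleftrightarrow> weakly_regular J fs \<and> weakly_regular (ideal_adjoins J fs) gs"
  by (induction fs arbitrary: J) auto

lemma weakly_regular_iff_nth:
  "weakly_regular J fs \<longleftrightarrow>
     (\<forall>i < length fs. nonzerodivisor_mod (ideal_adjoins J (take i fs)) (fs ! i))"
proof (induction fs arbitrary: J)
  case (Cons f fs)
  show ?case
    unfolding weakly_regular.simps Cons.IH
    by (auto simp: All_less_Suc2)
qed auto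

lemma weakly_regular_UNIV: "weakly_regular UNIV fs"
proof -
  have "ideal_adjoin UNIV f = UNIV" for f :: 'a
    using subset_ideal_adjoin by blast
  then show ?thesis
    by (induction fs) (auto simp: nonzerodivisor_mod_def)
qed

lemma weakly_regular_take: "weakly_regular J fs \<Longrightarrow> weakly_regular J (take n fs)"
  using weakly_regular_append[of J "take n fs" "drop n fs"] by simp

text \<open>The sequence \<open>0 \<rightarrow> R/(J : y) \<rightarrow> R/J \<rightarrow> R/(J, y) \<rightarrow> 0\<close> is exact; regularity passes from its
  ends to its middle.\<close>

lemma weakly_regular_colon_adjoin:
  assumes "ring_ideal J" "weakly_regular (ideal_adjoin J y) fs" "weakly_regular {b. y * b \<in> J} fs"
  shows "weakly_regular J fs"
  using assms
proof (induction fs arbitrary: J)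
  case (Cons f fs)
  note J = Cons.prems(1)
  let ?K = "{b. y * b \<in> J}"
  have nz1: "nonzerodivisor_mod (ideal_adjoin J y) f" and nz2: "nonzerodivisor_mod ?K f"
    and w1: "weakly_regular (ideal_adjoin (ideal_adjoin J y) f) fs"
    and w2: "weakly_regular (ideal_adjoin ?K f) fs"
    using Cons.prems by auto
  have nz: "nonzerodivisor_mod J f"
    unfolding nonzerodivisor_mod_def
  proof (intro allI impI)
    fix g assume fg: "f * g \<in> J"
    then have "g \<in> ideal_adjoin J y"
      using nonzerodivisor_modD[OF nz1] subset_ideal_adjoin[of J y] by blast
    then obtain a g' where g: "a \<in> J" "g = a + y * g'"
      by (auto elim: ideal_adjoinE)
    have "f * g - f * a \<in> J"
      by (intro ring_ideal_diff[OF J] ring_ideal_mult_left[OF J] fg g)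
    then have "f * g' \<in> ?K"
      using g by (simp add: algebra_simps)
    then have "g' \<in> ?K"
      using nz2 by (auto simp: nonzerodivisor_mod_def)
    then show "g \<in> J"
      using g ring_ideal_add[OF J, of a "y * g'"] by simp
  qed
  \<comment> \<open>Since f is a nonzerodivisor modulo (J, y), adjoining f commutes with the colon
    by y. The exact sequence therefore persists modulo f and the induction can continue.\<close>
  have colon: "{b. y * b \<in> ideal_adjoin J f} = ideal_adjoin ?K f"
  proof (intro equalityI subsetI)
    fix b assume "b \<in> {b. y * b \<in> ideal_adjoin J f}"
    then obtain a c where ac: "a \<in> J" "y * b = a + f * c"
      by (auto elim: ideal_adjoinE)
    have "f * c \<in> ideal_adjoin J y"
      by (rule ideal_adjoinI[where a = "- a" and b = b])
        (use ac ring_ideal_uminus[OF J] in \<open>auto simp: algebra_simps\<close>)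
    then have "c \<in> ideal_adjoin J y"
      by (rule nonzerodivisor_modD[OF nz1])
    then obtain a' c' where c: "a' \<in> J" "c = a' + y * c'"
      by (rule ideal_adjoinE)
    have "y * (b - f * c') = a + f * a'"
      using ac c by (simp add: algebra_simps)
    then have "b - f * c' \<in> ?K"
      using ac c J by (auto intro: ring_ideal_add ring_ideal_mult_left)
    then show "b \<in> ideal_adjoin ?K f"
      by (rule ideal_adjoinI[where b = c']) simp
  next
    fix b assume "b \<in> ideal_adjoin ?K f"
    then obtain a c where "y * a \<in> J" "b = a + f * c"
      by (auto elim: ideal_adjoinE)
    then show "b \<in> {b. y * b \<in> ideal_adjoin J f}"
      by (auto simp: algebra_simps intro: ideal_adjoinI[where b = "y * c"])
  qed
  have "weakly_regular (ideal_adjoin J f) fs"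
    by (rule Cons.IH)
      (use w1 w2 in \<open>auto simp: ring_ideal_adjoin[OF J] colon ideal_adjoin_commute[of J f]\<close>)
  then show ?case
    using nz by simp
qed auto

lemma nonzerodivisor_mod_power:
  assumes "nonzerodivisor_mod J f" shows "nonzerodivisor_mod J (f ^ k)"
proof (induction k)
  case (Suc k)
  show ?case
    unfolding nonzerodivisor_mod_def
  proof (intro allI impI)
    fix b assume "f ^ Suc k * b \<in> J"
    then have "f * (f ^ k * b) \<in> J" by (simp add: mult.assoc)
    then show "b \<in> J"
      using nonzerodivisor_modD[OF assms] nonzerodivisor_modD[OF Suc] by blast
  qed
qed (simp add: nonzerodivisor_mod_def)

text \<open>Induction on k through the exact sequence with y = f: starting from (J, f^(k+1)),
  adjoining f gives (J, f) and the colon by f gives (J, f^k), and \<open>fs\<close> is regular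
  modulo both.\<close>

lemma weakly_regular_power_head:
  assumes "ring_ideal J" "weakly_regular J (f # fs)"
  shows "weakly_regular J (f ^ k # fs)"
proof -
  have nz: "nonzerodivisor_mod J f" using assms by auto
  then have "nonzerodivisor_mod J (f ^ k)"
    by (rule nonzerodivisor_mod_power)
  moreover have "weakly_regular (ideal_adjoin J (f ^ k)) fs"
  proof (induction k)
    case 0
    have "ideal_adjoin J (f ^ 0) = UNIV"
      using in_ideal_adjoin[OF assms(1), of 1] ring_ideal_UNIV_iff[OF ring_ideal_adjoin[OF assms(1)]]
      by simp
    then show ?case by (simp add: weakly_regular_UNIV)
  next
    case (Suc k)
    let ?J = "ideal_adjoin J (f ^ Suc k)"
    have "ideal_adjoin ?J f = ideal_adjoin J f"
    proof (intro equalityI ideal_adjoin_subset ring_ideal_adjoin assms)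
      show "J \<subseteq> ideal_adjoin J f" by (rule subset_ideal_adjoin)
      show "f \<in> ideal_adjoin J f" by (rule in_ideal_adjoin[OF assms(1)])
      then show "f ^ Suc k \<in> ideal_adjoin J f"
        using ring_ideal_mult_right[OF ring_ideal_adjoin[OF assms(1)]] by simp
      show "J \<subseteq> ideal_adjoin ?J f" using subset_ideal_adjoin by blast
      show "f \<in> ideal_adjoin ?J f" by (intro in_ideal_adjoin ring_ideal_adjoin assms)
    qed
    moreover have "{b. f * b \<in> ?J} = ideal_adjoin J (f ^ k)"
    proof (intro equalityI subsetI)
      fix b assume "b \<in> {b. f * b \<in> ?J}"
      then obtain a c where ac: "a \<in> J" "f * b = a + f ^ Suc k * c"
        by (auto elim: ideal_adjoinE)
      then have "f * (b - f ^ k * c) \<in> J"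
        by (simp add: algebra_simps)
      then have "b - f ^ k * c \<in> J"
        using nz by (auto simp: nonzerodivisor_mod_def)
      then show "b \<in> ideal_adjoin J (f ^ k)"
        by (rule ideal_adjoinI[where b = c]) simp
    next
      fix b assume "b \<in> ideal_adjoin J (f ^ k)"
      then obtain a c where "a \<in> J" "b = a + f ^ k * c"
        by (auto elim: ideal_adjoinE)
      then show "b \<in> {b. f * b \<in> ?J}"
        by (auto simp: algebra_simps intro!: ideal_adjoinI[where a = "f * a" and b = c]
            ring_ideal_mult_left assms)
    qed
    ultimately show ?case
      using weakly_regular_colon_adjoin[of ?J f fs] Suc.IH assms
      by (auto simp: ring_ideal_adjoin)
  qed
  ultimately show ?thesis by simp
qed

lemma weakly_regular_powers:
  assumes "ring_ideal J" "weakly_regular J fs"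
  shows "weakly_regular J (map (\<lambda>f. f ^ k) fs)"
  using assms
proof (induction fs arbitrary: J)
  case (Cons f fs)
  then show ?case
    using weakly_regular_power_head[OF Cons.prems, of k] ring_ideal_adjoin by auto
qed auto

text \<open>If f p = a + b q, then b, a nonzerodivisor modulo (J, f), allows f to be split off q and
  cancelled. This lets an element that is a nonzerodivisor at every stage be placed in front of a
  regular sequence.\<close>

lemma weakly_regular_adjoin:
  assumes "ring_ideal J" "weakly_regular J fs"
    and "\<And>i. i \<le> length fs \<Longrightarrow> nonzerodivisor_mod (ideal_adjoins J (take i fs)) b"
  shows "weakly_regular (ideal_adjoin J b) fs"
  using assms
proof (induction fs arbitrary: J)
  case (Cons f fs)
  note J = Cons.prems(1)
  have nzf: "nonzerodivisor_mod J f" using Cons.prems by auto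
  have nzb: "nonzerodivisor_mod (ideal_adjoin J f) b"
    using Cons.prems(3)[of 1] by simp
  have "nonzerodivisor_mod (ideal_adjoin J b) f"
    unfolding nonzerodivisor_mod_def
  proof (intro allI impI)
    fix p assume "f * p \<in> ideal_adjoin J b"
    then obtain a q where aq: "a \<in> J" "f * p = a + b * q"
      by (auto elim: ideal_adjoinE)
    have "b * q \<in> ideal_adjoin J f"
      by (rule ideal_adjoinI[where a = "- a" and b = p])
        (use aq ring_ideal_uminus[OF J] in \<open>auto simp: algebra_simps\<close>)
    then have "q \<in> ideal_adjoin J f"
      using nzb by (auto simp: nonzerodivisor_mod_def)
    then obtain a' q' where q: "a' \<in> J" "q = a' + f * q'"
      by (rule ideal_adjoinE)
    have "f * (p - b * q') = a + b * a'"
      using aq q by (simp add: algebra_simps)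
    then have "p - b * q' \<in> J"
      using nzf aq q J
      by (metis nonzerodivisor_mod_def ring_ideal_add ring_ideal_mult_left)
    then show "p \<in> ideal_adjoin J b"
      by (rule ideal_adjoinI[where b = q']) simp
  qed
  moreover have "weakly_regular (ideal_adjoin (ideal_adjoin J f) b) fs"
  proof (rule Cons.IH)
    show "nonzerodivisor_mod (ideal_adjoins (ideal_adjoin J f) (take i fs)) b"
      if "i \<le> length fs" for i
      using Cons.prems(3)[of "Suc i"] that by simp
  qed (use Cons.prems ring_ideal_adjoin in auto)
  ultimately show ?case
    by (simp add: ideal_adjoin_commute)
qed auto

text \<open>The elements whose vanishing expresses the Coquand--Lombardi characterisation of Krull
  dimension at most \<open>length xs - 1\<close>.\<close>

primrec boundary_set :: "'a::comm_ring_1 list \<Rightarrow> 'a set" where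
  "boundary_set [] = {1}"
| "boundary_set (x # xs) = {x ^ n * (s + a * x) | n s a. s \<in> boundary_set xs}"

text \<open>Peels off one x at a time: the nonzerodivisor x^n cancels, and modulo x only the
  boundary element of the tail is left. An element z killed by a boundary element is thus forced
  into the ideal of the sequence, which is how depth gets bounded.\<close>

lemma boundary_weakly_regular:
  assumes "ring_ideal J" "weakly_regular J xs" "s \<in> boundary_set xs" "z * s \<in> J"
  shows "z \<in> ideal_adjoins J xs"
  using assms
proof (induction xs arbitrary: J s)
  case (Cons x xs)
  note J = Cons.prems(1)
  obtain n t a where s: "s = x ^ n * (t + a * x)" "t \<in> boundary_set xs"
    using Cons.prems by auto
  have "nonzerodivisor_mod J (x ^ n)"
    using Cons.prems nonzerodivisor_mod_power by auto
  then have pow: "x ^ n * b \<in> J \<Longrightarrow> b \<in> J" for b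
    by (simp add: nonzerodivisor_mod_def)
  have "x ^ n * (z * (t + a * x)) \<in> J"
    using Cons.prems(4) s by (simp add: mult_ac)
  then have "z * (t + a * x) \<in> J"
    using pow by blast
  then have "z * t \<in> ideal_adjoin J x"
    by (rule ideal_adjoinI[where b = "- (z * a)"]) (simp add: algebra_simps)
  then have "z \<in> ideal_adjoins (ideal_adjoin J x) xs"
    using Cons.IH[OF ring_ideal_adjoin[OF J] _ s(2)] Cons.prems(2) by auto
  then show ?case by simp
qed auto

text \<open>The elementary half of the Coquand-Lombardi criterion: x lies in \<open>Q 1\<close> but
  not in \<open>Q 0\<close>, so primality strips x^n, then a x is subtracted in \<open>Q 1\<close>.
  Membership climbs the chain until 1 lies in the last prime.\<close>

lemma boundary_prime_chain:
  assumes "\<And>i. i \<le> length xs \<Longrightarrow> prime_set (Q i)"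
    and "\<And>i. i < length xs \<Longrightarrow> Q i \<subseteq> Q (Suc i) \<and> xs ! i \<in> Q (Suc i) - Q i"
    and "s \<in> boundary_set xs" "s \<in> Q 0"
  shows False
  using assms
proof (induction xs arbitrary: Q s)
  case Nil
  then show ?case by (auto simp: prime_set_def)
next
  case (Cons x xs)
  have Q0: "prime_set (Q 0)" and Q1: "ring_ideal (Q 1)"
    using Cons.prems(1)[of 0] Cons.prems(1)[of 1] by (auto simp: prime_set_def)
  have x: "x \<in> Q 1" "x \<notin> Q 0" "Q 0 \<subseteq> Q 1"
    using Cons.prems(2)[of 0] by auto
  obtain n t a where s: "s = x ^ n * (t + a * x)" "t \<in> boundary_set xs"
    using Cons.prems by auto
  have "x ^ n \<notin> Q 0"
    by (induction n) (use Q0 x in \<open>auto simp: prime_set_def\<close>)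
  then have "t + a * x \<in> Q 1"
    using Cons.prems(4) s Q0 x by (auto simp: prime_set_def)
  then have "t \<in> Q 1"
    using ring_ideal_diff[OF Q1 _ ring_ideal_mult_left[OF Q1 x(1)]] by (metis add_diff_cancel)
  then show ?case
    using Cons.IH[of "\<lambda>i. Q (Suc i)" t] Cons.prems(1,2) s by fastforce
qed

text \<open>Stands in for the fact that minimal primes over J consist of zero divisors modulo J.
  When a lies in P, the prime obtained is strictly smaller than P.\<close>

lemma exists_prime_avoiding_nonzerodivisor:
  assumes J: "ring_ideal J" and P: "prime_set P" and "J \<subseteq> P" and "nonzerodivisor_mod J a"
  shows "\<exists>Q. prime_set Q \<and> J \<subseteq> Q \<and> Q \<subseteq> P \<and> a \<notin> Q"
proof -
  \<comment> \<open>The multiplicative set generated by a and the complement of P: an ideal that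
    misses it lies in P and does not contain a. A maximal such ideal over J is prime.\<close>
  define S where "S = {s * a ^ n | s n. s \<notin> P}"
  have S1: "1 \<in> S"
    using P by (auto simp: S_def prime_set_def intro!: exI[of _ "1"] exI[of _ "0::nat"])
  have Sa: "a \<in> S"
    using P by (auto simp: S_def prime_set_def intro!: exI[of _ "1"] exI[of _ "1::nat"])
  have SP: "s \<in> S" if "s \<notin> P" for s
    using that by (auto simp: S_def intro!: exI[of _ s] exI[of _ "0::nat"])
  have Smult: "s * t \<in> S" if "s \<in> S" "t \<in> S" for s t
  proof -
    from that obtain u m v n where "s = u * a ^ m" "t = v * a ^ n" "u \<notin> P" "v \<notin> P"
      unfolding S_def by blast
    then show ?thesis
      using P by (auto simp: S_def prime_set_def power_add mult_ac
          intro!: exI[of _ "u * v"] exI[of _ "m + n"])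
  qed
  have "s * a ^ n \<notin> J" if "s \<notin> P" for s n
    using that assms(3) nonzerodivisor_mod_power[OF assms(4), of n]
    by (auto simp: nonzerodivisor_mod_def mult.commute)
  then have JS: "J \<inter> S = {}"
    by (auto simp: S_def)
  define \<A> where "\<A> = {K. ring_ideal K \<and> J \<subseteq> K \<and> K \<inter> S = {}}"
  have "\<exists>M\<in>\<A>. \<forall>X\<in>\<A>. M \<subseteq> X \<longrightarrow> X = M"
  proof (rule subset_Zorn_nonempty)
    show "\<A> \<noteq> {}" using J JS by (auto simp: \<A>_def)
    fix C assume C: "C \<noteq> {}" "subset.chain \<A> C"
    have mem: "ring_ideal K" "J \<subseteq> K" "K \<inter> S = {}" if "K \<in> C" for K
      using C that by (auto simp: \<A>_def subset.chain_def)
    have "ring_ideal (\<Union>C)"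
    proof (rule ring_idealI)
      show "0 \<in> \<Union>C" using C mem ring_ideal_zero by blast
      show "x + y \<in> \<Union>C" if "x \<in> \<Union>C" "y \<in> \<Union>C" for x y
      proof -
        obtain K L where "K \<in> C" "L \<in> C" "x \<in> K" "y \<in> L" using \<open>x \<in> \<Union>C\<close> \<open>y \<in> \<Union>C\<close> by blast
        moreover have "K \<subseteq> L \<or> L \<subseteq> K"
          using C calculation by (auto simp: subset.chain_def)
        ultimately show ?thesis
          using mem(1) ring_ideal_add[of K x y] ring_ideal_add[of L x y] by blast
      qed
      show "r * x \<in> \<Union>C" if "x \<in> \<Union>C" for x r
        using that mem ring_ideal_mult_left by blast
    qed
    then show "\<Union>C \<in> \<A>" using C mem by (fastforce simp: \<A>_def)
  qed
  then obtain Q where Q: "Q \<in> \<A>" and max: "\<And>X. X \<in> \<A> \<Longrightarrow> Q \<subseteq> X \<Longrightarrow> X = Q"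
    by blast
  have idQ: "ring_ideal Q" and JQ: "J \<subseteq> Q" and QS: "Q \<inter> S = {}"
    using Q by (auto simp: \<A>_def)
  have meet: "\<exists>q r. q \<in> Q \<and> q + x * r \<in> S" if "x \<notin> Q" for x
  proof (rule ccontr)
    assume contr: "\<not> ?thesis"
    have "ideal_adjoin Q x \<in> \<A>"
      unfolding \<A>_def using contr JQ subset_ideal_adjoin[of Q x]
      by (auto simp: ring_ideal_adjoin[OF idQ] elim!: ideal_adjoinE)
    then have "ideal_adjoin Q x = Q"
      using max subset_ideal_adjoin by blast
    then show False using in_ideal_adjoin[OF idQ, of x] that by simp
  qed
  have "x \<in> Q \<or> y \<in> Q" if "x * y \<in> Q" for x y
  proof (rule ccontr)
    assume "\<not> (x \<in> Q \<or> y \<in> Q)"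
    then obtain q r q' r' where *: "q \<in> Q" "q + x * r \<in> S" "q' \<in> Q" "q' + y * r' \<in> S"
      using meet by metis
    have "(q + x * r) * (q' + y * r') = (q' + y * r') * q + (x * r) * q' + (r * r') * (x * y)"
      by (simp add: algebra_simps)
    moreover have "\<dots> \<in> Q"
      by (intro ring_ideal_add[OF idQ] ring_ideal_mult_left[OF idQ] * that)
    ultimately show False
      using Smult[OF *(2,4)] QS by auto
  qed
  then have "prime_set Q"
    using idQ QS S1 by (auto simp: prime_set_def)
  then show ?thesis
    using JQ QS SP Sa by blast
qed

text \<open>Gives height at least the length of a regular sequence. The chain is built downwards
  from P: each element is a nonzerodivisor modulo its predecessors, hence some smaller prime over
  these avoids it.\<close>

lemma weakly_regular_prime_chain:
  assumes "ring_ideal J" "weakly_regular J fs" "prime_set P" "J \<subseteq> P" "set fs \<subseteq> P"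
  shows "\<exists>Q. (\<forall>i\<le>length fs. prime_set (Q i) \<and> J \<subseteq> Q i) \<and> (\<forall>i<length fs. Q i \<subset> Q (Suc i)) \<and>
           Q (length fs) = P"
  using assms
proof (induction fs arbitrary: P rule: rev_induct)
  case Nil
  then show ?case by (auto intro: exI[of _ "\<lambda>_. P"])
next
  case (snoc a fs)
  let ?K = "ideal_adjoins J fs"
  have K: "ring_ideal ?K" using snoc.prems(1) by (rule ring_ideal_adjoins)
  have "?K \<subseteq> P"
    using snoc.prems by (intro ideal_adjoins_subset) (auto simp: prime_set_def)
  moreover have "weakly_regular J fs" "nonzerodivisor_mod ?K a"
    using snoc.prems by (auto simp: weakly_regular_append)
  ultimately obtain P' where P': "prime_set P'" "?K \<subseteq> P'" "P' \<subseteq> P" "a \<notin> P'"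
    using exists_prime_avoiding_nonzerodivisor[OF K snoc.prems(3)] by blast
  obtain Q where Q: "\<forall>i\<le>length fs. prime_set (Q i) \<and> J \<subseteq> Q i" "\<forall>i<length fs. Q i \<subset> Q (Suc i)"
      "Q (length fs) = P'"
    using snoc.IH[OF snoc.prems(1) \<open>weakly_regular J fs\<close> P'(1)] P'(2)
      subset_ideal_adjoins[of J fs] set_subset_ideal_adjoins[OF snoc.prems(1), of fs] by blast
  show ?case
    by (rule exI[of _ "\<lambda>i. if i \<le> length fs then Q i else P"])
      (use Q P' snoc.prems in \<open>auto simp: le_Suc_eq less_Suc_eq\<close>)
qed

text \<open>Vanishing of Koszul cohomology on \<open>y\<close> in degrees 0, 1, 2 for an ideal \<open>(y)\<close> containing a
  weakly regular sequence of length 1, 2, 3.\<close>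

lemma koszul_cocycle_0:
  assumes "ring_ideal J" "nonzerodivisor_mod J f" "f = (\<Sum>i\<in>I. a i * y i)"
    and "\<And>i. i \<in> I \<Longrightarrow> y i * u \<in> J"
  shows "u \<in> J"
proof (rule nonzerodivisor_modD[OF assms(2)])
  have "f * u = (\<Sum>i\<in>I. a i * (y i * u))"
    by (simp add: assms(3) sum_distrib_right mult.assoc)
  also have "\<dots> \<in> J"
    by (intro ring_ideal_sum ring_ideal_mult_left assms)
  finally show "f * u \<in> J" .
qed

lemma koszul_cocycle_1:
  assumes J: "ring_ideal J" and reg: "weakly_regular J [f, g]"
    and f: "f = (\<Sum>i\<in>I. a i * y i)" and g: "g = (\<Sum>i\<in>I. a' i * y i)"
    and cocycle: "\<And>i j. i \<in> I \<Longrightarrow> j \<in> I \<Longrightarrow> y i * b j - y j * b i \<in> J"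
  shows "\<exists>u. \<forall>j\<in>I. b j - y j * u \<in> J"
proof -
  have nzf: "nonzerodivisor_mod J f" and nzg: "nonzerodivisor_mod (ideal_adjoin J f) g"
    using reg by auto
  \<comment> \<open>Contraction of the cocycle with the coefficients of f. It exhibits f b as the
    coboundary of w modulo J, which makes w a cocycle one degree lower modulo (J, f); the lower case
    then divides w by f.\<close>
  define w where "w = (\<Sum>i\<in>I. a i * b i)"
  have fb: "f * b j - y j * w \<in> J" if "j \<in> I" for j
  proof -
    have "f * b j - y j * w = (\<Sum>i\<in>I. a i * (y i * b j - y j * b i))"
      by (simp add: f w_def sum_distrib_left sum_distrib_right sum_subtractf[symmetric] algebra_simps)
    also have "\<dots> \<in> J"
      using cocycle that by (intro ring_ideal_sum ring_ideal_mult_left J) auto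
    finally show ?thesis .
  qed
  have "w \<in> ideal_adjoin J f"
  proof (rule koszul_cocycle_0[OF ring_ideal_adjoin[OF J] nzg g])
    fix i assume "i \<in> I"
    then show "y i * w \<in> ideal_adjoin J f"
      by (intro ideal_adjoinI[OF ring_ideal_uminus[OF J fb[of i]]]) auto
  qed
  then obtain c u where u: "c \<in> J" "w = c + f * u"
    by (rule ideal_adjoinE)
  have "b j - y j * u \<in> J" if "j \<in> I" for j
  proof (rule nonzerodivisor_modD[OF nzf])
    have "f * (b j - y j * u) = (f * b j - y j * w) + y j * c"
      using u by (simp add: algebra_simps)
    then show "f * (b j - y j * u) \<in> J"
      using fb[OF that] u by (auto intro: ring_ideal_add[OF J] ring_ideal_mult_left[OF J])
  qed
  then show ?thesis by blast
qed

lemma koszul_cocycle_2: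
  assumes J: "ring_ideal J" and reg: "weakly_regular J [f, g, h]"
    and f: "f = (\<Sum>i\<in>I. a i * y i)" and g: "g = (\<Sum>i\<in>I. a' i * y i)"
    and h: "h = (\<Sum>i\<in>I. a'' i * y i)"
    and cocycle: "\<And>i j l. i \<in> I \<Longrightarrow> j \<in> I \<Longrightarrow> l \<in> I \<Longrightarrow>
      y i * c j l - y j * c i l + y l * c i j \<in> J"
  shows "\<exists>b. \<forall>j\<in>I. \<forall>l\<in>I. c j l - (y j * b l - y l * b j) \<in> J"
proof -
  have nzf: "nonzerodivisor_mod J f" and reg': "weakly_regular (ideal_adjoin J f) [g, h]"
    using reg by auto
  \<comment> \<open>The same contraction one degree higher; w is a 1-cocycle modulo (J, f), where
    [g, h] is still regular.\<close>
  define w where "w j = (\<Sum>i\<in>I. a i * c i j)" for j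
  have fc: "f * c j l - (y j * w l - y l * w j) \<in> J" if "j \<in> I" "l \<in> I" for j l
  proof -
    have "f * c j l - (y j * w l - y l * w j) =
        (\<Sum>i\<in>I. a i * (y i * c j l - y j * c i l + y l * c i j))"
      by (simp add: f w_def sum_distrib_left sum_distrib_right sum_subtractf[symmetric]
          sum.distrib[symmetric] algebra_simps)
    also have "\<dots> \<in> J"
      using cocycle that by (intro ring_ideal_sum ring_ideal_mult_left J) auto
    finally show ?thesis .
  qed
  have "\<exists>u. \<forall>j\<in>I. w j - y j * u \<in> ideal_adjoin J f"
  proof (rule koszul_cocycle_1[OF ring_ideal_adjoin[OF J] reg' g h])
    fix i j assume "i \<in> I" "j \<in> I"
    then show "y i * w j - y j * w i \<in> ideal_adjoin J f"
      by (intro ideal_adjoinI[OF ring_ideal_uminus[OF J fc[of i j]]]) auto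
  qed
  then obtain u where u: "\<And>j. j \<in> I \<Longrightarrow> w j - y j * u \<in> ideal_adjoin J f"
    by blast
  have "\<exists>b e. e \<in> J \<and> w j - y j * u = e + f * b" if "j \<in> I" for j
    using u[OF that] by (auto elim!: ideal_adjoinE)
  then obtain b e where b: "\<And>j. j \<in> I \<Longrightarrow> e j \<in> J \<and> w j - y j * u = e j + f * b j"
    by metis
  have "c j l - (y j * b l - y l * b j) \<in> J" if "j \<in> I" "l \<in> I" for j l
  proof (rule nonzerodivisor_modD[OF nzf])
    have w: "w j = y j * u + e j + f * b j" "w l = y l * u + e l + f * b l"
      using b[OF that(1)] b[OF that(2)] by (auto simp: algebra_simps)
    have "f * (c j l - (y j * b l - y l * b j)) =
        (f * c j l - (y j * w l - y l * w j)) + y j * e l - y l * e j"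
      unfolding w by (simp add: algebra_simps)
    then show "f * (c j l - (y j * b l - y l * b j)) \<in> J"
      using fc[OF that] b that
      by (auto intro!: ring_ideal_add[OF J] ring_ideal_diff[OF J] ring_ideal_mult_left[OF J])
  qed
  then show ?thesis by blast
qed

section \<open>Presentations of rings\<close>

definition maximal_set :: "'a::comm_ring_1 set \<Rightarrow> bool" where
  "maximal_set N \<longleftrightarrow> ring_ideal N \<and> 1 \<notin> N \<and> (\<forall>t. t \<notin> N \<longrightarrow> (\<exists>s. s * t - 1 \<in> N))"

lemma maximal_set_imp_prime_set:
  assumes "maximal_set N" shows "prime_set N"
  unfolding prime_set_def
proof (intro conjI allI impI)
  fix a b assume ab: "a * b \<in> N"
  show "a \<in> N \<or> b \<in> N"
  proof (rule disjCI)
    assume "b \<notin> N"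
    then obtain s where s: "s * b - 1 \<in> N"
      using assms by (auto simp: maximal_set_def)
    have id: "ring_ideal N" using assms by (simp add: maximal_set_def)
    have "s * (a * b) - a * (s * b - 1) \<in> N"
      by (intro ring_ideal_diff[OF id] ring_ideal_mult_left[OF id] s ab)
    then show "a \<in> N" by (simp add: algebra_simps)
  qed
qed (use assms in \<open>auto simp: maximal_set_def\<close>)

text \<open>Ideals of A correspond to the ideals of the source that contain \<open>kern\<close>.
  This reduces grade, height and the Noetherian property of A to such ideals.\<close>

locale ring_presentation = cring A for A :: "('b, 'd) ring_scheme" (structure) +
  fixes \<phi> :: "'a::comm_ring_1 \<Rightarrow> 'b"
  assumes phi_add: "\<phi> (x + y) = \<phi> x \<oplus> \<phi> y"
    and phi_mult: "\<phi> (x * y) = \<phi> x \<otimes> \<phi> y"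
    and phi_one: "\<phi> 1 = \<one>"
    and range_phi: "range \<phi> = carrier A"
begin

definition kern :: "'a set" where
  "kern = {x. \<phi> x = \<zero>}"

lemma phi_closed [simp]: "\<phi> x \<in> carrier A"
  using range_phi by blast

lemma phi_zero [simp]: "\<phi> 0 = \<zero>"
  using phi_add[of 0 0] by (simp add: add.l_cancel_one)

lemma phi_diff: "\<phi> (x - y) = \<phi> x \<ominus> \<phi> y"
proof -
  have "\<phi> x = \<phi> (x - y) \<oplus> \<phi> y"
    using phi_add[of "x - y" y] by simp
  moreover have "(\<phi> (x - y) \<oplus> \<phi> y) \<ominus> \<phi> y = \<phi> (x - y)"
    by (simp add: minus_eq a_assoc r_neg)
  ultimately show ?thesis by simp
qed

lemma phi_eq_iff: "\<phi> x = \<phi> y \<longleftrightarrow> x - y \<in> kern"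
  by (simp add: kern_def phi_diff)

lemma phi_preimage: assumes "u \<in> carrier A" obtains x where "\<phi> x = u"
  using assms unfolding range_phi[symmetric] by blast

lemma ring_ideal_vimage:
  assumes "ideal L A" shows "ring_ideal (\<phi> -` L)" "kern \<subseteq> \<phi> -` L"
proof -
  interpret L: ideal L A by fact
  show "ring_ideal (\<phi> -` L)"
    by (rule ring_idealI) (auto simp: phi_add phi_mult L.I_l_closed)
  show "kern \<subseteq> \<phi> -` L"
    by (auto simp: kern_def)
qed

lemma ring_ideal_kern: "ring_ideal kern"
  using ring_ideal_vimage(1)[OF zeroideal] by (simp add: kern_def vimage_def)

lemma ideal_image:
  assumes "ring_ideal K" shows "ideal (\<phi> ` K) A"
proof (rule idealI[OF ring_axioms])
  show "subgroup (\<phi> ` K) (add_monoid A)"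
  proof (rule add.subgroupI)
    show "\<phi> ` K \<noteq> {}" using ring_ideal_zero[OF assms] by blast
    fix a assume "a \<in> \<phi> ` K"
    then obtain x where x: "x \<in> K" "a = \<phi> x" by blast
    then have "\<ominus> a = \<phi> (0 - x)"
      unfolding phi_diff by (simp add: minus_eq)
    then show "\<ominus> a \<in> \<phi> ` K" using ring_ideal_uminus[OF assms x(1)] by simp
    fix b assume "b \<in> \<phi> ` K"
    then obtain y where y: "y \<in> K" "b = \<phi> y" by blast
    show "a \<oplus> b \<in> \<phi> ` K"
      using ring_ideal_add[OF assms x(1) y(1)] x y by (auto simp: phi_add[symmetric])
  qed auto
next
  fix a u assume "a \<in> \<phi> ` K" "u \<in> carrier A"
  then obtain x r where x: "x \<in> K" "a = \<phi> x" "u = \<phi> r"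
    using phi_preimage by (metis imageE)
  then show "u \<otimes> a \<in> \<phi> ` K" "a \<otimes> u \<in> \<phi> ` K"
    using ring_ideal_mult_left[OF assms x(1), of r] ring_ideal_mult_right[OF assms x(1), of r]
    by (auto simp: phi_mult[symmetric])
qed

lemma phi_in_image_iff:
  assumes "ring_ideal K" "kern \<subseteq> K" shows "\<phi> x \<in> \<phi> ` K \<longleftrightarrow> x \<in> K"
proof
  assume "\<phi> x \<in> \<phi> ` K"
  then obtain y where "y \<in> K" "x - y \<in> kern" by (auto simp: phi_eq_iff)
  then show "x \<in> K" using assms ring_ideal_diff_cancel by blast
qed blast

lemma vimage_image: "ring_ideal K \<Longrightarrow> kern \<subseteq> K \<Longrightarrow> \<phi> -` (\<phi> ` K) = K"
  using phi_in_image_iff by blast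

lemma image_vimage: "L \<subseteq> carrier A \<Longrightarrow> \<phi> ` (\<phi> -` L) = L"
  using range_phi by auto

lemma primeideal_image:
  assumes K: "prime_set K" "kern \<subseteq> K" shows "primeideal (\<phi> ` K) A"
proof -
  have id: "ring_ideal K" using K by (simp add: prime_set_def)
  show ?thesis
  proof (rule primeidealI[OF ideal_image[OF id] is_cring])
    have "\<one> \<notin> \<phi> ` K"
      using phi_in_image_iff[OF id K(2), of 1] K(1) by (simp add: phi_one prime_set_def)
    then show "carrier A \<noteq> \<phi> ` K" by auto
    fix a b assume ab: "a \<in> carrier A" "b \<in> carrier A" "a \<otimes> b \<in> \<phi> ` K"
    then obtain x y where xy: "a = \<phi> x" "b = \<phi> y"
      using phi_preimage by metis
    then have "x * y \<in> K"
      using ab phi_in_image_iff[OF id K(2)] by (simp add: phi_mult[symmetric])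
    then show "a \<in> \<phi> ` K \<or> b \<in> \<phi> ` K"
      using K(1) xy by (auto simp: prime_set_def)
  qed
qed

lemma prime_set_vimage:
  assumes "primeideal L A" shows "prime_set (\<phi> -` L)"
proof -
  interpret L: primeideal L A by fact
  have "ring_ideal (\<phi> -` L)" by (rule ring_ideal_vimage) (rule L.is_ideal)
  moreover have "\<one> \<notin> L" using L.I_notcarr L.one_imp_carrier by blast
  ultimately show ?thesis
    using L.I_prime by (auto simp: prime_set_def phi_one phi_mult)
qed

lemma maximal_set_vimage:
  assumes "maximalideal L A" shows "maximal_set (\<phi> -` L)"
proof -
  interpret L: maximalideal L A by fact
  have id: "ring_ideal (\<phi> -` L)" by (rule ring_ideal_vimage) (rule L.is_ideal)
  moreover have "\<one> \<notin> L" using L.I_notcarr L.one_imp_carrier by blast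
  moreover have "\<exists>s. s * t - 1 \<in> \<phi> -` L" if t: "t \<notin> \<phi> -` L" for t
  proof -
    let ?K = "ideal_adjoin (\<phi> -` L) t"
    have K: "ring_ideal ?K" by (rule ring_ideal_adjoin[OF id])
    have "L \<subseteq> \<phi> ` ?K"
      using image_vimage[OF L.a_subset] subset_ideal_adjoin[of "\<phi> -` L" t] by blast
    moreover have "\<phi> t \<in> \<phi> ` ?K" using in_ideal_adjoin[OF id] by blast
    moreover have "\<phi> ` ?K \<subseteq> carrier A" by auto
    ultimately have "\<phi> ` ?K = carrier A"
      using L.I_maximal[OF ideal_image[OF K]] t by blast
    then have "\<phi> 1 \<in> \<phi> ` ?K" by (simp add: phi_one)
    moreover have "kern \<subseteq> ?K"
      using ring_ideal_vimage(2)[OF L.is_ideal] subset_ideal_adjoin by blast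
    ultimately have "1 \<in> ?K"
      using phi_in_image_iff[OF K] by blast
    then obtain a b where "a \<in> \<phi> -` L" "1 = a + t * b" by (auto elim: ideal_adjoinE)
    moreover from this have "b * t - 1 = - a" by (simp add: algebra_simps)
    ultimately show ?thesis using ring_ideal_uminus[OF id] by metis
  qed
  ultimately show ?thesis by (auto simp: maximal_set_def phi_one)
qed

lemma maximalideal_image:
  assumes N: "maximal_set N" "kern \<subseteq> N" shows "maximalideal (\<phi> ` N) A"
proof -
  have id: "ring_ideal N" using N by (simp add: maximal_set_def)
  show ?thesis
  proof (rule maximalidealI[OF ideal_image[OF id]])
    have "\<one> \<notin> \<phi> ` N"
      using phi_in_image_iff[OF id N(2), of 1] N(1) by (simp add: phi_one maximal_set_def)
    then show "carrier A \<noteq> \<phi> ` N" by auto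
    fix L assume L: "ideal L A" "\<phi> ` N \<subseteq> L" "L \<subseteq> carrier A"
    interpret L: ideal L A by fact
    show "L = \<phi> ` N \<or> L = carrier A"
    proof (cases "\<phi> -` L \<subseteq> N")
      case True
      then show ?thesis using L image_vimage[OF L(3)] by blast
    next
      case False
      then obtain t where t: "\<phi> t \<in> L" "t \<notin> N" by blast
      then obtain s where s: "s * t - 1 \<in> N"
        using N(1) unfolding maximal_set_def by blast
      have "\<phi> (s * t) \<in> L" using t by (simp add: phi_mult L.I_l_closed)
      moreover have "\<phi> (s * t - 1) \<in> L" using L s by blast
      ultimately have "s * t - (s * t - 1) \<in> \<phi> -` L"
        by (intro ring_ideal_diff ring_ideal_vimage[OF L(1)] vimageI2)
      then have "\<one> \<in> L" by (simp add: phi_one)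
      then show ?thesis using L.one_imp_carrier by blast
    qed
  qed
qed

lemma genideal_image: "Idl (\<phi> ` set fs) = \<phi> ` ideal_adjoins kern fs"
proof
  have "ring_ideal (ideal_adjoins kern fs)" by (rule ring_ideal_adjoins[OF ring_ideal_kern])
  then show "Idl (\<phi> ` set fs) \<subseteq> \<phi> ` ideal_adjoins kern fs"
    using set_subset_ideal_adjoins[OF ring_ideal_kern, of fs]
    by (intro genideal_minimal ideal_image) auto
  have "ideal (Idl (\<phi> ` set fs)) A" by (rule genideal_ideal) auto
  then have "ideal_adjoins kern fs \<subseteq> \<phi> -` (Idl (\<phi> ` set fs))"
    using genideal_self[of "\<phi> ` set fs"] phi_closed
    by (intro ideal_adjoins_subset ring_ideal_vimage) blast+
  then show "\<phi> ` ideal_adjoins kern fs \<subseteq> Idl (\<phi> ` set fs)" by blast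
qed

lemma regular_sequence_map_iff:
  "regular_sequence (map \<phi> fs) \<longleftrightarrow> weakly_regular kern fs \<and> 1 \<notin> ideal_adjoins kern fs"
proof -
  have id: "ring_ideal (ideal_adjoins kern gs)" for gs
    by (rule ring_ideal_adjoins[OF ring_ideal_kern])
  have mem: "\<phi> x \<in> Idl (\<phi> ` set gs) \<longleftrightarrow> x \<in> ideal_adjoins kern gs" for x gs
    unfolding genideal_image by (rule phi_in_image_iff[OF id subset_ideal_adjoins])
  have "(\<forall>b\<in>carrier A. map \<phi> fs ! i \<otimes> b \<in> Idl (set (take i (map \<phi> fs))) \<longrightarrow>
          b \<in> Idl (set (take i (map \<phi> fs)))) \<longleftrightarrow>
        nonzerodivisor_mod (ideal_adjoins kern (take i fs)) (fs ! i)" if "i < length fs" for i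
    using that
    by (simp add: take_map range_phi[symmetric] phi_mult[symmetric] mem nonzerodivisor_mod_def)
  moreover have "Idl (set (map \<phi> fs)) \<noteq> carrier A \<longleftrightarrow> 1 \<notin> ideal_adjoins kern fs"
  proof -
    have "ideal (Idl (set (map \<phi> fs))) A" by (rule genideal_ideal) auto
    then have "Idl (set (map \<phi> fs)) = carrier A \<longleftrightarrow> \<phi> 1 \<in> Idl (set (map \<phi> fs))"
      unfolding phi_one using ideal.one_imp_carrier by force
    then show ?thesis using mem[of 1 fs] by simp
  qed
  ultimately show ?thesis
    by (auto simp: regular_sequence_def weakly_regular_iff_nth)
qed

lemma ideal_grade_le:
  assumes L: "ideal L A"
    and "\<And>fs. set fs \<subseteq> \<phi> -` L \<Longrightarrow> weakly_regular kern fs \<Longrightarrow> 1 \<notin> ideal_adjoins kern fs \<Longrightarrow>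
      length fs \<le> d"
  shows "ideal_grade L \<le> enat d"
  unfolding ideal_grade_def
proof (rule SUP_least)
  fix as assume as: "as \<in> {as. regular_sequence as \<and> set as \<subseteq> L}"
  then have "set as \<subseteq> range \<phi>" by (auto simp: regular_sequence_def range_phi)
  then obtain fs where fs: "as = map \<phi> fs"
    using ex_map_conv[of as \<phi>] by blast
  then show "enat (length as) \<le> enat d"
    using as assms(2)[of fs] by (auto simp: regular_sequence_map_iff)
qed

lemma ideal_grade_ge:
  assumes "ideal L A" "L \<noteq> carrier A" "set fs \<subseteq> \<phi> -` L" "weakly_regular kern fs"
  shows "enat (length fs) \<le> ideal_grade L"
proof -
  have "ideal_adjoins kern fs \<subseteq> \<phi> -` L"
    using assms ring_ideal_vimage by (intro ideal_adjoins_subset) auto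
  moreover have "\<phi> 1 \<notin> L" using assms ideal.one_imp_carrier by (auto simp: phi_one)
  ultimately have "regular_sequence (map \<phi> fs)"
    using assms by (auto simp: regular_sequence_map_iff)
  then show ?thesis
    unfolding ideal_grade_def
    using assms by (intro SUP_upper2[of "map \<phi> fs"]) auto
qed

lemma prime_height_ge:
  assumes "\<And>i. i \<le> n \<Longrightarrow> prime_set (Q i) \<and> kern \<subseteq> Q i"
    and "\<And>i. i < n \<Longrightarrow> Q i \<subset> Q (Suc i)" and "\<phi> ` Q n = P"
  shows "enat n \<le> prime_height P"
  unfolding prime_height_def
proof (intro SUP_upper2[of n] CollectI exI[of _ "\<lambda>i. \<phi> ` Q i"] conjI allI impI)
  fix i assume "i < n"
  then have "ring_ideal (Q i)" "kern \<subseteq> Q i" "Q i \<subset> Q (Suc i)"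
    using assms(1)[of i] assms(2)[of i] by (auto simp: prime_set_def)
  then show "\<phi> ` Q i \<subset> \<phi> ` Q (Suc i)"
    using phi_in_image_iff[of "Q i"] by blast
qed (use assms in \<open>auto intro: primeideal_image\<close>)

text \<open>In a chain with more than d steps, choose an element of \<open>Q (Suc i)\<close> outside
  \<open>Q i\<close> for each of the lowest d + 1 steps. A boundary element of these in the smallest
  prime contradicts \<open>boundary_prime_chain\<close>.\<close>

lemma prime_height_le:
  assumes "\<And>xs Q. length xs = Suc d \<Longrightarrow> prime_set Q \<Longrightarrow> kern \<subseteq> Q \<Longrightarrow>
    boundary_set xs \<inter> Q \<noteq> {}"
  shows "prime_height P \<le> enat d"
  unfolding prime_height_def
proof (rule SUP_least)
  fix n assume "n \<in> {n. \<exists>Q. (\<forall>i\<le>n. primeideal (Q i) A) \<and> (\<forall>i<n. Q i \<subset> Q (Suc i)) \<and> Q n = P}"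
  then obtain Q where Q: "\<And>i. i \<le> n \<Longrightarrow> primeideal (Q i) A" "\<And>i. i < n \<Longrightarrow> Q i \<subset> Q (Suc i)"
    by blast
  show "enat n \<le> enat d"
  proof (rule ccontr)
    assume "\<not> enat n \<le> enat d"
    then have n: "Suc d \<le> n" by simp
    have "\<exists>x. x \<in> \<phi> -` Q (Suc i) - \<phi> -` Q i" if i: "i < n" for i
    proof -
      obtain u where u: "u \<in> Q (Suc i)" "u \<notin> Q i" using Q(2)[OF i] by blast
      have "u \<in> carrier A"
        using Q(1)[of "Suc i"] i u additive_subgroup.a_Hcarr[OF ideal.axioms(1)] 
          primeideal.axioms(1) by fastforce
      then show ?thesis using u phi_preimage by (metis DiffI vimage_eq)
    qed
    then obtain x where x: "\<And>i. i < n \<Longrightarrow> x i \<in> \<phi> -` Q (Suc i) - \<phi> -` Q i" by metis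
    let ?xs = "map x [0..<Suc d]"
    have "kern \<subseteq> \<phi> -` Q 0"
      using Q(1)[of 0] ring_ideal_vimage(2) primeideal.axioms(1) by blast
    then obtain s where "s \<in> boundary_set ?xs" "s \<in> \<phi> -` Q 0"
      using assms[of ?xs "\<phi> -` Q 0"] prime_set_vimage Q(1)[of 0] by auto
    moreover have "\<phi> -` Q i \<subseteq> \<phi> -` Q (Suc i)" if "i < n" for i
      using Q(2)[OF that] by blast
    ultimately show False
      using Q(1) x n prime_set_vimage
      by (intro boundary_prime_chain[of ?xs "\<lambda>i. \<phi> -` Q i" s])
        (auto simp del: upt_Suc simp: nth_append)
  qed
qed

lemma noetherian_ring_presentation:
  assumes "\<And>K. ring_ideal K \<Longrightarrow> kern \<subseteq> K \<Longrightarrow> \<exists>fs. K = ideal_adjoins kern fs"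
  shows "noetherian_ring A"
proof (rule noetherian_ringI)
  fix L assume L: "ideal L A"
  obtain fs where fs: "\<phi> -` L = ideal_adjoins kern fs"
    using assms ring_ideal_vimage[OF L] by blast
  have "L \<subseteq> carrier A" using additive_subgroup.a_subset[OF ideal.axioms(1)[OF L]] .
  then have "L = Idl (\<phi> ` set fs)"
    unfolding genideal_image fs[symmetric] by (rule image_vimage[symmetric])
  then show "\<exists>S\<subseteq>carrier A. finite S \<and> L = Idl S"
    by (intro exI[of _ "\<phi> ` set fs"]) auto
qed

text \<open>Every maximal ideal gets grade and height equal to the same d: a regular sequence of
  length d bounds both from below, boundary sets bound the height from above, and prime chains bound
  the grade by the height.\<close>

theorem cohen_macaulay_ringI:
  assumes "\<And>K. ring_ideal K \<Longrightarrow> kern \<subseteq> K \<Longrightarrow> \<exists>fs. K = ideal_adjoins kern fs"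
    and dim: "\<And>xs Q. length xs = Suc d \<Longrightarrow> prime_set Q \<Longrightarrow> kern \<subseteq> Q \<Longrightarrow>
      boundary_set xs \<inter> Q \<noteq> {}"
    and reg: "\<And>N. maximal_set N \<Longrightarrow> kern \<subseteq> N \<Longrightarrow>
      \<exists>fs. set fs \<subseteq> N \<and> length fs = d \<and> weakly_regular kern fs"
  shows "cohen_macaulay_ring A"
  unfolding cohen_macaulay_ring_def
proof (intro conjI allI impI)
  show "cring A" by (rule is_cring)
  show "noetherian_ring A" by (rule noetherian_ring_presentation) (rule assms(1))
  fix M assume M: "maximalideal M A"
  interpret M: maximalideal M A by fact
  have N: "maximal_set (\<phi> -` M)" "kern \<subseteq> \<phi> -` M"
    using maximal_set_vimage[OF M] ring_ideal_vimage(2)[OF M.is_ideal] by auto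
  obtain fs where fs: "set fs \<subseteq> \<phi> -` M" "length fs = d" "weakly_regular kern fs"
    using reg[OF N] by blast
  have "enat d \<le> ideal_grade M"
    using ideal_grade_ge[OF M.is_ideal _ fs(1,3)] M.I_notcarr fs(2) by auto
  obtain Q where "\<forall>i\<le>d. prime_set (Q i) \<and> kern \<subseteq> Q i" "\<forall>i<d. Q i \<subset> Q (Suc i)"
      "Q d = \<phi> -` M"
    using weakly_regular_prime_chain[OF ring_ideal_kern fs(3)
        maximal_set_imp_prime_set[OF N(1)] N(2) fs(1)] fs(2) by auto
  then have "enat d \<le> prime_height M"
    using image_vimage[OF M.a_subset] by (intro prime_height_ge[of d Q]) auto
  moreover have "prime_height M \<le> enat d"
    by (rule prime_height_le) (rule dim)
  moreover have "ideal_grade M \<le> enat d"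
  proof (rule ideal_grade_le[OF M.is_ideal])
    fix gs assume gs: "set gs \<subseteq> \<phi> -` M" "weakly_regular kern gs"
    obtain Q where Q: "\<forall>i\<le>length gs. prime_set (Q i) \<and> kern \<subseteq> Q i"
      "\<forall>i<length gs. Q i \<subset> Q (Suc i)" "Q (length gs) = \<phi> -` M"
      using weakly_regular_prime_chain[OF ring_ideal_kern gs(2)
          maximal_set_imp_prime_set[OF N(1)] N(2) gs(1)] by auto
    then have "enat (length gs) \<le> prime_height M"
      using image_vimage[OF M.a_subset] by (intro prime_height_ge[of "length gs" Q]) auto
    also have "\<dots> \<le> enat d" by fact
    finally show "length gs \<le> d" by simp
  qed
  ultimately show "ideal_grade M = prime_height M"
    using \<open>enat d \<le> ideal_grade M\<close> by (metis antisym)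
qed

text \<open>The chain gives height at least d. A regular sequence in N of length d or more could be
  truncated to length d, so the grade is at most d - 1.\<close>

theorem not_cohen_macaulay_ringI:
  assumes N: "maximal_set N" "kern \<subseteq> N"
    and chain: "\<And>i. i \<le> d \<Longrightarrow> prime_set (Q i) \<and> kern \<subseteq> Q i"
      "\<And>i. i < d \<Longrightarrow> Q i \<subset> Q (Suc i)" "Q d = N"
    and irreg: "\<And>fs. set fs \<subseteq> N \<Longrightarrow> length fs = d \<Longrightarrow> \<not> weakly_regular kern fs"
  shows "\<not> cohen_macaulay_ring A"
proof
  assume "cohen_macaulay_ring A"
  moreover have M: "maximalideal (\<phi> ` N) A" by (rule maximalideal_image[OF N])
  ultimately have eq: "ideal_grade (\<phi> ` N) = prime_height (\<phi> ` N)"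
    by (simp add: cohen_macaulay_ring_def)
  have "enat d \<le> prime_height (\<phi> ` N)"
    using chain by (intro prime_height_ge[of d Q]) auto
  \<comment> \<open>The empty sequence is weakly regular, so d is positive and d - 1 is a true
    predecessor.\<close>
  moreover have "d \<noteq> 0" using irreg[of "[]"] by auto
  moreover have "ideal_grade (\<phi> ` N) \<le> enat (d - 1)"
  proof (rule ideal_grade_le)
    show "ideal (\<phi> ` N) A" using M by (rule maximalideal.axioms(1))
    fix fs assume fs: "set fs \<subseteq> \<phi> -` (\<phi> ` N)" "weakly_regular kern fs"
    show "length fs \<le> d - 1"
    proof (rule ccontr)
      assume "\<not> ?thesis"
      then have len: "length (take d fs) = d" by auto
      have "\<phi> -` (\<phi> ` N) = N"
        using vimage_image[OF _ N(2)] N(1) by (auto simp: maximal_set_def)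
      then have "set (take d fs) \<subseteq> N" using fs(1) set_take_subset[of d fs] by auto
      then show False using irreg[OF _ len] weakly_regular_take[OF fs(2)] by auto
    qed
  qed
  ultimately show False using eq by (cases d) (auto dest: order_trans)
qed

end

section \<open>Monomials and squarefree monomial ideals\<close>

type_synonym ('x, 'k) mpoly = "('x \<Rightarrow>\<^sub>0 nat) \<Rightarrow>\<^sub>0 'k"

lemma poly_mapping_sum_single:
  "(\<Sum>m\<in>Poly_Mapping.keys p. Poly_Mapping.single m (Poly_Mapping.lookup p m)) = p"
proof (rule poly_mapping_eqI)
  fix k
  have "Poly_Mapping.lookup (\<Sum>m\<in>Poly_Mapping.keys p. Poly_Mapping.single m (Poly_Mapping.lookup p m)) k =
      (\<Sum>m\<in>Poly_Mapping.keys p. if m = k then Poly_Mapping.lookup p k else 0)"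
    unfolding lookup_sum by (intro sum.cong) (auto simp: lookup_single when_def)
  also have "\<dots> = Poly_Mapping.lookup p k"
    by (simp add: in_keys_iff)
  finally show "Poly_Mapping.lookup (\<Sum>m\<in>Poly_Mapping.keys p. Poly_Mapping.single m (Poly_Mapping.lookup p m)) k = Poly_Mapping.lookup p k" .
qed

lemma poly_mapping_mult_sum:
  fixes p q :: "'m::comm_monoid_add \<Rightarrow>\<^sub>0 'k::comm_ring_1"
  shows "p * q = (\<Sum>m\<in>Poly_Mapping.keys p. \<Sum>n\<in>Poly_Mapping.keys q.
           Poly_Mapping.single (m + n) (Poly_Mapping.lookup p m * Poly_Mapping.lookup q n))"
proof -
  have "p * q = (\<Sum>m\<in>Poly_Mapping.keys p. Poly_Mapping.single m (Poly_Mapping.lookup p m)) *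
      (\<Sum>n\<in>Poly_Mapping.keys q. Poly_Mapping.single n (Poly_Mapping.lookup q n))"
    by (simp add: poly_mapping_sum_single)
  then show ?thesis
    by (simp add: sum_product mult_single)
qed

lemma keys_add_nat: "Poly_Mapping.keys (m + n :: 'x \<Rightarrow>\<^sub>0 nat) = Poly_Mapping.keys m \<union> Poly_Mapping.keys n"
  by (auto simp: in_keys_iff lookup_add)

lemma multiplicative_if_on_single:
  fixes \<psi> :: "('m::comm_monoid_add \<Rightarrow>\<^sub>0 'k::comm_ring_1) \<Rightarrow> 'a::comm_ring_1"
  assumes add: "\<And>p q. \<psi> (p + q) = \<psi> p + \<psi> q"
    and single: "\<And>m n c d. \<psi> (Poly_Mapping.single (m + n) (c * d)) =
      \<psi> (Poly_Mapping.single m c) * \<psi> (Poly_Mapping.single n d)"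
  shows "\<psi> (p * q) = \<psi> p * \<psi> q"
proof -
  have "\<psi> 0 = 0" using add[of 0 0] by simp
  then have sum: "\<psi> (sum f A) = (\<Sum>i\<in>A. \<psi> (f i))" for f and A :: "'i set"
    by (induction A rule: infinite_finite_induct) (auto simp: add)
  have "\<psi> p * \<psi> q = (\<Sum>m\<in>Poly_Mapping.keys p. \<psi> (Poly_Mapping.single m (Poly_Mapping.lookup p m))) *
      (\<Sum>n\<in>Poly_Mapping.keys q. \<psi> (Poly_Mapping.single n (Poly_Mapping.lookup q n)))"
    unfolding sum[symmetric] by (simp add: poly_mapping_sum_single)
  also have "\<dots> = \<psi> (p * q)"
    unfolding poly_mapping_mult_sum[of p q] sum sum_product single ..
  finally show ?thesis by simp
qed

lemma ring_ideal_in_if_single: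
  assumes "ring_ideal J"
    and "\<And>m. m \<in> Poly_Mapping.keys p \<Longrightarrow> Poly_Mapping.single m (Poly_Mapping.lookup p m) \<in> J"
  shows "p \<in> J"
  using ring_ideal_sum[OF assms(1), of "Poly_Mapping.keys p" "\<lambda>m. Poly_Mapping.single m (Poly_Mapping.lookup p m)"] assms(2)
  by (simp add: poly_mapping_sum_single)

lemma lookup_single_mult:
  fixes p :: "('x, 'k::comm_ring_1) mpoly"
  shows "Poly_Mapping.lookup (Poly_Mapping.single m c * p) (m + n) = c * Poly_Mapping.lookup p n"
proof -
  have "Poly_Mapping.single m c * p =
      (\<Sum>k\<in>Poly_Mapping.keys p. Poly_Mapping.single m c * Poly_Mapping.single k (Poly_Mapping.lookup p k))"
    unfolding sum_distrib_left[symmetric] by (simp add: poly_mapping_sum_single)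
  then have "Poly_Mapping.lookup (Poly_Mapping.single m c * p) (m + n) =
      (\<Sum>k\<in>Poly_Mapping.keys p. if k = n then c * Poly_Mapping.lookup p n else 0)"
    by (auto simp: mult_single lookup_sum lookup_single when_def intro!: sum.cong)
  then show ?thesis by (simp add: in_keys_iff)
qed

section \<open>Selecting monomials, and polynomials in a set of variables\<close>

definition select :: "('m \<Rightarrow> bool) \<Rightarrow> ('m \<Rightarrow>\<^sub>0 'k::zero) \<Rightarrow> ('m \<Rightarrow>\<^sub>0 'k)" where
  "select P p = Poly_Mapping.mapp (\<lambda>m c. if P m then c else 0) p"

lemma lookup_select: "Poly_Mapping.lookup (select P p) m = (if P m then Poly_Mapping.lookup p m else 0)"
  by (auto simp: select_def lookup_mapp when_def in_keys_iff)

lemma keys_select: "Poly_Mapping.keys (select P p) = {m \<in> Poly_Mapping.keys p. P m}"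
  by (auto simp: in_keys_iff lookup_select split: if_splits)

lemma select_add: "select P (p + q) = select P p + select P q"
  by (rule poly_mapping_eqI) (simp add: lookup_select lookup_add)

lemma select_single: "select P (Poly_Mapping.single m c) = (if P m then Poly_Mapping.single m c else 0)"
  by (rule poly_mapping_eqI) (auto simp: lookup_select lookup_single when_def)

lemma select_mult:
  fixes p q :: "'m::comm_monoid_add \<Rightarrow>\<^sub>0 'k::comm_ring_1"
  assumes "\<And>m n. P (m + n) \<longleftrightarrow> P m \<and> P n"
  shows "select P (p * q) = select P p * select P q"
  by (rule multiplicative_if_on_single) (auto simp: select_add select_single mult_single assms)

lemma select_id: "(\<And>m. m \<in> Poly_Mapping.keys p \<Longrightarrow> P m) \<Longrightarrow> select P p = p"
  by (rule poly_mapping_eqI) (auto simp: lookup_select in_keys_iff)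

definition polys_in :: "'x set \<Rightarrow> ('x, 'k::zero) mpoly set" where
  "polys_in V = {p. \<forall>m\<in>Poly_Mapping.keys p. Poly_Mapping.keys m \<subseteq> V}"

lemma polys_in_add: "p \<in> polys_in V \<Longrightarrow> q \<in> polys_in V \<Longrightarrow> p + q \<in> polys_in V"
  using Poly_Mapping.keys_add[of p q] by (auto simp: polys_in_def)

lemma polys_in_zero [simp]: "0 \<in> polys_in V"
  by (simp add: polys_in_def)

lemma polys_in_single: "Poly_Mapping.keys m \<subseteq> V \<Longrightarrow> Poly_Mapping.single m c \<in> polys_in V"
  by (simp add: polys_in_def)

lemma polys_in_one [simp]: "1 \<in> polys_in V"
  by (simp add: polys_in_def)

lemma polys_in_mult:
  fixes p q :: "('x, 'k::comm_ring_1) mpoly"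
  shows "p \<in> polys_in V \<Longrightarrow> q \<in> polys_in V \<Longrightarrow> p * q \<in> polys_in V"
  using keys_mult[of p q] by (fastforce simp: polys_in_def keys_add_nat)

lemma polys_in_uminus:
  fixes p :: "('x, 'k::comm_ring_1) mpoly"
  shows "p \<in> polys_in V \<Longrightarrow> - p \<in> polys_in V"
  by (auto simp: polys_in_def in_keys_iff)

lemma polys_in_diff:
  fixes p q :: "('x, 'k::comm_ring_1) mpoly"
  shows "p \<in> polys_in V \<Longrightarrow> q \<in> polys_in V \<Longrightarrow> p - q \<in> polys_in V"
  using polys_in_add[of p V "- q"] polys_in_uminus[of q V] by simp

lemma polys_in_power:
  fixes p :: "('x, 'k::comm_ring_1) mpoly"
  shows "p \<in> polys_in V \<Longrightarrow> p ^ n \<in> polys_in V"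
  by (induction n) (auto intro: polys_in_mult)

lemma polys_in_prod:
  fixes f :: "'i \<Rightarrow> ('x, 'k::comm_ring_1) mpoly"
  shows "(\<And>i. i \<in> A \<Longrightarrow> f i \<in> polys_in V) \<Longrightarrow> prod f A \<in> polys_in V"
  by (induction A rule: infinite_finite_induct) (auto intro: polys_in_mult)

lemma polys_in_mono: "V \<subseteq> W \<Longrightarrow> polys_in V \<subseteq> polys_in W"
  by (auto simp: polys_in_def)

lemma polys_in_poly_var: "v \<in> V \<Longrightarrow> poly_var v \<in> polys_in V"
  by (simp add: polys_in_def poly_var_def)

text \<open>The retraction onto k[V] that sends the variables outside V to zero.\<close>

definition restrict_vars :: "'x set \<Rightarrow> ('x, 'k::zero) mpoly \<Rightarrow> ('x, 'k) mpoly" where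
  "restrict_vars V = select (\<lambda>m. Poly_Mapping.keys m \<subseteq> V)"

lemma restrict_add: "restrict_vars V (p + q) = restrict_vars V p + restrict_vars V q"
  by (simp add: restrict_vars_def select_add)

lemma restrict_mult:
  fixes p q :: "('x, 'k::comm_ring_1) mpoly"
  shows "restrict_vars V (p * q) = restrict_vars V p * restrict_vars V q"
  unfolding restrict_vars_def by (rule select_mult) (simp add: keys_add_nat)

lemma restrict_in: "restrict_vars V p \<in> polys_in V"
  by (auto simp: polys_in_def restrict_vars_def keys_select)

lemma restrict_id: "p \<in> polys_in V \<Longrightarrow> restrict_vars V p = p"
  unfolding restrict_vars_def by (rule select_id) (auto simp: polys_in_def)

lemma keys_restrict:
  "Poly_Mapping.keys (restrict_vars V p) = {m \<in> Poly_Mapping.keys p. Poly_Mapping.keys m \<subseteq> V}"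
  by (simp add: restrict_vars_def keys_select)

section \<open>Lexicographic order and leading monomials\<close>

primrec lex_less :: "'x list \<Rightarrow> ('x \<Rightarrow>\<^sub>0 nat) \<Rightarrow> ('x \<Rightarrow>\<^sub>0 nat) \<Rightarrow> bool" where
  "lex_less [] a b \<longleftrightarrow> False"
| "lex_less (v # vs) a b \<longleftrightarrow>
     Poly_Mapping.lookup a v < Poly_Mapping.lookup b v \<or> Poly_Mapping.lookup a v = Poly_Mapping.lookup b v \<and> lex_less vs a b"

lemma lex_less_irrefl: "\<not> lex_less vs a a"
  by (induction vs) auto

lemma lex_less_trans: "lex_less vs a b \<Longrightarrow> lex_less vs b c \<Longrightarrow> lex_less vs a c"
  by (induction vs) auto

lemma lex_less_add_right: "lex_less vs (a + c) (b + c) \<longleftrightarrow> lex_less vs a b"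
  by (induction vs) (auto simp: lookup_add)

lemma lex_less_add_left: "lex_less vs (c + a) (c + b) \<longleftrightarrow> lex_less vs a b"
  by (induction vs) (auto simp: lookup_add)

lemma lex_less_total:
  assumes "Poly_Mapping.keys a \<subseteq> set vs" "Poly_Mapping.keys b \<subseteq> set vs" "a \<noteq> b"
  shows "lex_less vs a b \<or> lex_less vs b a"
proof (rule ccontr)
  assume *: "\<not> ?thesis"
  have "\<forall>v\<in>set vs. Poly_Mapping.lookup a v = Poly_Mapping.lookup b v"
    using *
  proof (induction vs)
    case (Cons v vs)
    then have "Poly_Mapping.lookup a v = Poly_Mapping.lookup b v"
      by (metis lex_less.simps(2) linorder_neqE_nat)
    with Cons show ?case by simp
  qed auto
  moreover have "Poly_Mapping.lookup a v = Poly_Mapping.lookup b v" if "v \<notin> set vs" for v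
    using assms that by (metis in_keys_iff subsetD)
  ultimately show False using assms(3) by (metis poly_mapping_eqI)
qed

lemma wf_lex_less: "wf {(a, b). lex_less vs a b}"
proof (induction vs)
  case (Cons v vs)
  have "{(a, b). lex_less (v # vs) a b} =
      inv_image (less_than <*lex*> {(a, b). lex_less vs a b}) (\<lambda>a. (Poly_Mapping.lookup a v, a))"
    by (auto simp: inv_image_def)
  then show ?case
    using Cons by (simp only: wf_inv_image wf_lex_prod wf_less_than)
qed auto

definition leading :: "'x list \<Rightarrow> ('x, 'k::zero) mpoly \<Rightarrow> ('x \<Rightarrow>\<^sub>0 nat) \<Rightarrow> bool" where
  "leading vs p m \<longleftrightarrow> m \<in> Poly_Mapping.keys p \<and> (\<forall>n\<in>Poly_Mapping.keys p. n = m \<or> lex_less vs n m)"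

lemma exists_leading:
  assumes "p \<in> polys_in (set vs)" "p \<noteq> 0"
  shows "\<exists>m. leading vs p m"
proof -
  have *: "\<exists>m\<in>S. \<forall>n\<in>S. n = m \<or> lex_less vs n m"
    if "finite S" "S \<noteq> {}" "\<forall>m\<in>S. Poly_Mapping.keys m \<subseteq> set vs" for S
    using that
  proof (induction S rule: finite_ne_induct)
    case (insert a S)
    then obtain m where m: "m \<in> S" "\<forall>n\<in>S. n = m \<or> lex_less vs n m" by auto
    have "m \<noteq> a" using insert m by auto
    then consider "lex_less vs a m" | "lex_less vs m a"
      using lex_less_total[of m vs a] insert.prems m by auto
    then show ?case
    proof cases
      case 2
      then show ?thesis using m lex_less_trans[of vs _ m a] by (intro bexI[of _ a]) auto
    qed (use m in auto)
  qed auto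
  show ?thesis
    using *[of "Poly_Mapping.keys p"] assms by (auto simp: leading_def polys_in_def)
qed

lemma leading_mult:
  fixes p q :: "('x, 'k::idom) mpoly"
  assumes p: "leading vs p m" and q: "leading vs q n"
  shows "leading vs (p * q) (m + n)"
    and "Poly_Mapping.lookup (p * q) (m + n) = Poly_Mapping.lookup p m * Poly_Mapping.lookup q n"
proof -
  \<comment> \<open>Every pair other than the two leading monomials has a smaller sum, so nothing
    can cancel at m + n.\<close>
  have le: "(a = m \<and> b = n) \<or> lex_less vs (a + b) (m + n)"
    if "a \<in> Poly_Mapping.keys p" "b \<in> Poly_Mapping.keys q" for a b
  proof -
    have "a = m \<or> lex_less vs (a + b) (m + b)" "b = n \<or> lex_less vs (m + b) (m + n)"
      using p q that by (auto simp: leading_def lex_less_add_right lex_less_add_left)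
    then show ?thesis
      by (metis lex_less_trans)
  qed
  have "Poly_Mapping.lookup (p * q) (m + n) = (\<Sum>a\<in>Poly_Mapping.keys p. \<Sum>b\<in>Poly_Mapping.keys q.
      if a = m then if b = n then Poly_Mapping.lookup p m * Poly_Mapping.lookup q n else 0 else 0)"
    unfolding poly_mapping_mult_sum[of p q] lookup_sum
  proof (intro sum.cong refl)
    fix a b assume ab: "a \<in> Poly_Mapping.keys p" "b \<in> Poly_Mapping.keys q"
    show "Poly_Mapping.lookup (Poly_Mapping.single (a + b) (Poly_Mapping.lookup p a * Poly_Mapping.lookup q b)) (m + n) =
        (if a = m then if b = n then Poly_Mapping.lookup p m * Poly_Mapping.lookup q n else 0 else 0)"
      using le[OF ab] lex_less_irrefl[of vs "m + n"] by (auto simp: lookup_single when_def)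
  qed
  also have "\<dots> = (\<Sum>a\<in>Poly_Mapping.keys p. if a = m then Poly_Mapping.lookup p m * Poly_Mapping.lookup q n else 0)"
    by (intro sum.cong) (use q in \<open>auto simp: leading_def\<close>)
  also have "\<dots> = Poly_Mapping.lookup p m * Poly_Mapping.lookup q n"
    using p by (simp add: leading_def)
  finally show eq: "Poly_Mapping.lookup (p * q) (m + n) = Poly_Mapping.lookup p m * Poly_Mapping.lookup q n" .
  have "k = m + n \<or> lex_less vs k (m + n)" if "k \<in> Poly_Mapping.keys (p * q)" for k
    using keys_mult[of p q] that le by blast
  then show "leading vs (p * q) (m + n)"
    using p q eq by (auto simp: leading_def in_keys_iff)
qed

lemma polys_in_no_zero_divisors:
  fixes p q :: "('x, 'k::idom) mpoly"
  assumes "finite V" "p \<in> polys_in V" "q \<in> polys_in V" "p * q = 0"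
  shows "p = 0 \<or> q = 0"
proof (rule ccontr)
  assume *: "\<not> ?thesis"
  obtain vs where vs: "V = set vs" using finite_list[OF assms(1)] by blast
  obtain m n where "leading vs p m" "leading vs q n"
    using * exists_leading assms vs by metis
  from leading_mult(1)[OF this] show False using assms(4) by (simp add: leading_def)
qed

section \<open>Stanley-Reisner ideals and the primes of faces\<close>

definition monomial_ideal :: "'x set set \<Rightarrow> ('x, 'k::comm_ring_1) mpoly set" where
  "monomial_ideal \<G> = {p. \<forall>m\<in>Poly_Mapping.keys p. \<exists>G\<in>\<G>. G \<subseteq> Poly_Mapping.keys m}"

text \<open>The prime generated by the variables outside F, that is, the kernel of
  \<open>restrict_vars F\<close>. For empty F it is the maximal ideal of the origin.\<close>

definition face_prime :: "'x set \<Rightarrow> ('x, 'k::comm_ring_1) mpoly set" where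
  "face_prime F = {p. \<forall>m\<in>Poly_Mapping.keys p. \<not> Poly_Mapping.keys m \<subseteq> F}"

lemma ring_ideal_monomial_ideal:
  "ring_ideal (monomial_ideal \<G> :: ('x, 'k::comm_ring_1) mpoly set)"
proof (rule ring_idealI)
  fix a b :: "('x, 'k::comm_ring_1) mpoly"
  show "a \<in> monomial_ideal \<G> \<Longrightarrow> b \<in> monomial_ideal \<G> \<Longrightarrow> a + b \<in> monomial_ideal \<G>"
    using Poly_Mapping.keys_add[of a b] by (auto simp: monomial_ideal_def)
next
  fix a r :: "('x, 'k::comm_ring_1) mpoly" assume a: "a \<in> monomial_ideal \<G>"
  show "r * a \<in> monomial_ideal \<G>"
    unfolding monomial_ideal_def
  proof (intro CollectI ballI)
    fix m assume "m \<in> Poly_Mapping.keys (r * a)"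
    then obtain k n where m: "m = k + n" "n \<in> Poly_Mapping.keys a"
      using keys_mult[of r a] by blast
    then obtain G where "G \<in> \<G>" "G \<subseteq> Poly_Mapping.keys n"
      using a by (auto simp: monomial_ideal_def)
    then show "\<exists>G\<in>\<G>. G \<subseteq> Poly_Mapping.keys m"
      unfolding m keys_add_nat by blast
  qed
qed (simp add: monomial_ideal_def)

lemma face_prime_eq: "face_prime F = monomial_ideal ((\<lambda>v. {v}) ` (- F))"
  by (auto simp: face_prime_def monomial_ideal_def)

lemma face_prime_iff: "p \<in> face_prime F \<longleftrightarrow> restrict_vars F p = 0"
  unfolding keys_eq_empty[symmetric] keys_restrict by (auto simp: face_prime_def)

lemma prime_set_face_prime:
  assumes "finite F" shows "prime_set (face_prime F :: ('x, 'k::idom) mpoly set)"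
  unfolding prime_set_def
proof (intro conjI allI impI)
  show "ring_ideal (face_prime F :: ('x, 'k) mpoly set)"
    by (simp add: face_prime_eq ring_ideal_monomial_ideal)
  fix a b :: "('x, 'k) mpoly" assume "a * b \<in> face_prime F"
  then show "a \<in> face_prime F \<or> b \<in> face_prime F"
    using polys_in_no_zero_divisors[OF assms restrict_in restrict_in, of a b]
    by (simp add: face_prime_iff restrict_mult)
qed (simp add: face_prime_def)

lemma monomial_ideal_mono:
  assumes "\<And>G. G \<in> \<G> \<Longrightarrow> \<exists>G'\<in>\<G>'. G' \<subseteq> G"
  shows "(monomial_ideal \<G> :: ('x, 'k::comm_ring_1) mpoly set) \<subseteq> monomial_ideal \<G>'"
proof
  fix p :: "('x, 'k::comm_ring_1) mpoly" assume p: "p \<in> monomial_ideal \<G>"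
  have "\<exists>G'\<in>\<G>'. G' \<subseteq> Poly_Mapping.keys m" if "m \<in> Poly_Mapping.keys p" for m
  proof -
    obtain G where G: "G \<in> \<G>" "G \<subseteq> Poly_Mapping.keys m"
      using p \<open>m \<in> _\<close> by (auto simp: monomial_ideal_def)
    obtain G' where "G' \<in> \<G>'" "G' \<subseteq> G"
      using assms[OF G(1)] by blast
    with G show ?thesis by blast
  qed
  then show "p \<in> monomial_ideal \<G>'" by (simp add: monomial_ideal_def)
qed

lemma monomial_ideal_subset_face_prime_iff:
  "(monomial_ideal \<G> :: ('x, 'k::comm_ring_1) mpoly set) \<subseteq> face_prime F \<longleftrightarrow>
     (\<forall>G\<in>\<G>. finite G \<longrightarrow> \<not> G \<subseteq> F)"
proof (intro iffI ballI impI subsetI)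
  fix G assume sub: "(monomial_ideal \<G> :: ('x, 'k) mpoly set) \<subseteq> face_prime F" and G: "G \<in> \<G>" "finite G"
  obtain m :: "'x \<Rightarrow>\<^sub>0 nat" where m: "Poly_Mapping.keys m = G"
  proof
    show "Poly_Mapping.keys (\<Sum>v\<in>G. Poly_Mapping.single v (1::nat)) = G"
      using G(2) by (induction G rule: finite_induct) (auto simp: keys_add_nat)
  qed
  have "Poly_Mapping.single m (1::'k) \<in> monomial_ideal \<G>"
    using G m by (auto simp: monomial_ideal_def)
  then have "Poly_Mapping.single m (1::'k) \<in> face_prime F" using sub by blast
  then show "\<not> G \<subseteq> F" using m by (simp add: face_prime_def)
next
  fix p :: "('x, 'k) mpoly" assume "\<forall>G\<in>\<G>. finite G \<longrightarrow> \<not> G \<subseteq> F" "p \<in> monomial_ideal \<G>"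
  then show "p \<in> face_prime F"
    unfolding monomial_ideal_def face_prime_def
    by (blast dest: finite_subset intro: finite_keys)
qed

lemma minus_single_add:
  assumes "v \<in> Poly_Mapping.keys m"
  shows "Poly_Mapping.single v 1 + (m - Poly_Mapping.single v (1::nat)) = m"
  using assms by (intro poly_mapping_eqI)
    (auto simp: lookup_add lookup_minus lookup_single when_def in_keys_iff)

text \<open>Algebraic form of deleting the vertex v from the complex.\<close>

lemma monomial_ideal_adjoin_var:
  "ideal_adjoin (monomial_ideal \<G>) (poly_var v) =
     (monomial_ideal (insert {v} \<G>) :: ('x, 'k::field) mpoly set)"
proof
  have "(poly_var v :: ('x, 'k) mpoly) \<in> monomial_ideal (insert {v} \<G>)"
    by (simp add: monomial_ideal_def poly_var_def)
  then show "ideal_adjoin (monomial_ideal \<G>) (poly_var v) \<subseteq>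
      (monomial_ideal (insert {v} \<G>) :: ('x, 'k) mpoly set)"
    by (intro ideal_adjoin_subset ring_ideal_monomial_ideal monomial_ideal_mono) auto
  show "(monomial_ideal (insert {v} \<G>) :: ('x, 'k) mpoly set) \<subseteq>
      ideal_adjoin (monomial_ideal \<G>) (poly_var v)"
  proof
    fix p :: "('x, 'k) mpoly" assume p: "p \<in> monomial_ideal (insert {v} \<G>)"
    show "p \<in> ideal_adjoin (monomial_ideal \<G>) (poly_var v)"
    proof (rule ring_ideal_in_if_single)
      fix m assume m: "m \<in> Poly_Mapping.keys p"
      show "Poly_Mapping.single m (Poly_Mapping.lookup p m) \<in> ideal_adjoin (monomial_ideal \<G>) (poly_var v)"
      proof (cases "v \<in> Poly_Mapping.keys m")
        case True
        then show ?thesis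
          by (intro ideal_adjoinI[where a = 0 and
                b = "Poly_Mapping.single (m - Poly_Mapping.single v 1) (Poly_Mapping.lookup p m)"])
            (use minus_single_add[of v m] in
              \<open>auto simp: poly_var_def mult_single ring_ideal_zero[OF ring_ideal_monomial_ideal]\<close>)
      next
        case False
        then have "Poly_Mapping.single m (Poly_Mapping.lookup p m) \<in> monomial_ideal \<G>"
          using p m by (auto simp: monomial_ideal_def)
        then show ?thesis using subset_ideal_adjoin by blast
      qed
    qed (simp add: ring_ideal_adjoin ring_ideal_monomial_ideal)
  qed
qed

lemma keys_poly_var_mult:
  fixes p :: "('x, 'k::field) mpoly"
  shows "Poly_Mapping.keys (poly_var v * p) = (+) (Poly_Mapping.single v 1) ` Poly_Mapping.keys p"
proof
  show "Poly_Mapping.keys (poly_var v * p) \<subseteq> (+) (Poly_Mapping.single v 1) ` Poly_Mapping.keys p"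
    using keys_mult[of "poly_var v" p] by (auto simp: poly_var_def)
  show "(+) (Poly_Mapping.single v 1) ` Poly_Mapping.keys p \<subseteq> Poly_Mapping.keys (poly_var v * p)"
    by (auto simp: poly_var_def in_keys_iff lookup_single_mult)
qed

text \<open>Algebraic form of passing to the closed star of v, the cone over its link.\<close>

lemma monomial_ideal_colon_var:
  "{p. poly_var v * p \<in> monomial_ideal \<G>} =
     (monomial_ideal ((\<lambda>G. G - {v}) ` \<G>) :: ('x, 'k::field) mpoly set)"
  by (auto simp: monomial_ideal_def keys_poly_var_mult keys_add_nat Diff_subset_conv)

section \<open>Dimension of polynomial rings\<close>

text \<open>A homogeneous system with more unknowns than equations has a nontrivial solution.
  Gaussian elimination: \<open>e0\<close> is the pivot for the equation b, and its coefficient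
  \<open>c0\<close> is determined last so that b holds.\<close>

lemma exists_linear_dependence:
  fixes a :: "'e \<Rightarrow> 'b \<Rightarrow> 'k::field"
  assumes "finite B" "finite E" "card B < card E"
  shows "\<exists>c. (\<exists>e\<in>E. c e \<noteq> 0) \<and> (\<forall>b\<in>B. (\<Sum>e\<in>E. c e * a e b) = 0)"
  using assms
proof (induction B arbitrary: E a rule: finite_induct)
  case empty
  then have "E \<noteq> {}" by auto
  then show ?case by (intro exI[of _ "\<lambda>_. 1"]) auto
next
  case (insert b B)
  show ?case
  proof (cases "\<forall>e\<in>E. a e b = 0")
    case True
    have "card B < card E" using insert by simp
    then obtain c where "\<exists>e\<in>E. c e \<noteq> 0" "\<forall>b\<in>B. (\<Sum>e\<in>E. c e * a e b) = 0"
      using insert.IH[of E a] insert.prems(1) by blast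
    then show ?thesis using True by (intro exI[of _ c]) auto
  next
    case False
    then obtain e0 where e0: "e0 \<in> E" "a e0 b \<noteq> 0" by blast
    define E' where "E' = E - {e0}"
    define a' where "a' e x = a e x - a e b / a e0 b * a e0 x" for e x
    have "card B < card E'"
      using insert e0 by (simp add: E'_def)
    then obtain c where c: "\<exists>e\<in>E'. c e \<noteq> 0" "\<forall>x\<in>B. (\<Sum>e\<in>E'. c e * a' e x) = 0"
      using insert.IH[of E' a'] insert.prems by (auto simp: E'_def)
    define c0 where "c0 = - (\<Sum>e\<in>E'. c e * a e b) / a e0 b"
    define c' where "c' = c(e0 := c0)"
    have sum: "(\<Sum>e\<in>E. c' e * a e x) = c0 * a e0 x + (\<Sum>e\<in>E'. c e * a e x)" for x
      using sum.remove[OF insert.prems(1) e0(1), of "\<lambda>e. c' e * a e x"]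
      by (auto simp: c'_def E'_def intro!: sum.cong)
    have "(\<Sum>e\<in>E'. c e * a' e x) = (\<Sum>e\<in>E. c' e * a e x)" for x
      unfolding sum c0_def a'_def
      by (simp add: right_diff_distrib sum_subtractf sum_distrib_right sum_divide_distrib mult.assoc)
    moreover have "(\<Sum>e\<in>E. c' e * a e b) = 0"
      unfolding sum c0_def using e0 by simp
    moreover have "\<exists>e\<in>E. c' e \<noteq> 0"
      using c(1) by (auto simp: c'_def E'_def)
    ultimately show ?thesis using c(2) by (intro exI[of _ c']) auto
  qed
qed

abbreviation const :: "'k::zero \<Rightarrow> ('x, 'k) mpoly" where
  "const \<equiv> Poly_Mapping.single 0"

lemma lookup_const_mult:
  fixes p :: "('x, 'k::comm_ring_1) mpoly"
  shows "Poly_Mapping.lookup (const c * p) m = c * Poly_Mapping.lookup p m"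
  using lookup_single_mult[of 0 c p m] by simp

lemma const_mult: "const (c * d) = const c * (const d :: ('x, 'k::comm_ring_1) mpoly)"
  by (simp add: mult_single)

definition power_product :: "'a::comm_ring_1 list \<Rightarrow> nat list \<Rightarrow> 'a" where
  "power_product xs es = prod_list (map2 (^) xs es)"

lemma power_product_simps [simp]:
  "power_product [] es = 1"
  "power_product (x # xs) (e # es) = x ^ e * power_product xs es"
  by (simp_all add: power_product_def)

text \<open>A polynomial relation among the \<open>xs\<close> is, up to a nonzero scalar, an element of the boundary
  set: factor out the lexicographically least monomial.\<close>

lemma relation_in_boundary_set:
  fixes xs :: "('x, 'k::field) mpoly list"
  assumes "finite E" "E \<noteq> {}" "\<And>e. e \<in> E \<Longrightarrow> length e = length xs \<and> c e \<noteq> 0"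
  shows "\<exists>u s. u \<noteq> 0 \<and> s \<in> boundary_set xs \<and>
    (\<Sum>e\<in>E. const (c e) * power_product xs e) = const u * s"
  using assms
proof (induction xs arbitrary: E c)
  case Nil
  then have "E = {[]}" by auto
  then show ?case using Nil by auto
next
  case (Cons x xs)
  \<comment> \<open>The least exponent of x in the relation. Terms in \<open>E0\<close> attain it,
    while those in \<open>E1\<close> are divisible by at least one further x and go into the summand
    a x of the boundary element.\<close>
  define n where "n = Min (hd ` E)"
  have n_le: "n \<le> hd e" if "e \<in> E" for e
    using that Cons.prems(1) by (simp add: n_def)
  have "n \<in> hd ` E"
    unfolding n_def using Cons.prems by (intro Min_in) auto
  have E_shape: "e = hd e # tl e" "length (tl e) = length xs" if "e \<in> E" for e
    using Cons.prems(3)[OF that] by (auto simp: length_Suc_conv)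
  define E0 where "E0 = {es. n # es \<in> E}"
  define E1 where "E1 = {e \<in> E. hd e \<noteq> n}"
  have fin: "finite E0" "finite E1"
    using Cons.prems(1) finite_vimageI[of E "(#) n"] by (auto simp: E0_def E1_def vimage_def)
  have "E0 \<noteq> {}"
  proof -
    obtain e where "e \<in> E" "n = hd e" using \<open>n \<in> hd ` E\<close> by blast
    then have "tl e \<in> E0" using E_shape(1)[of e] by (simp add: E0_def)
    then show ?thesis by blast
  qed
  then obtain u s where us: "u \<noteq> 0" "s \<in> boundary_set xs"
      "(\<Sum>es\<in>E0. const (c (n # es)) * power_product xs es) = const u * s"
    using Cons.IH[of E0 "\<lambda>es. c (n # es)"] fin Cons.prems(3) by (force simp: E0_def)
  define r where
    "r = (\<Sum>e\<in>E1. const (c e) * x ^ (hd e - Suc n) * power_product xs (tl e))"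
  have split: "E = (#) n ` E0 \<union> E1"
    using E_shape by (force simp: E0_def E1_def)
  have "(\<Sum>e\<in>E. const (c e) * power_product (x # xs) e) =
      (\<Sum>e\<in>(#) n ` E0. const (c e) * power_product (x # xs) e) +
      (\<Sum>e\<in>E1. const (c e) * power_product (x # xs) e)"
    unfolding split using fin by (intro sum.union_disjoint) (auto simp: E1_def)
  also have "(\<Sum>e\<in>(#) n ` E0. const (c e) * power_product (x # xs) e) = x ^ n * (const u * s)"
    unfolding us(3)[symmetric]
    by (subst sum.reindex) (auto simp: sum_distrib_left mult_ac)
  also have "(\<Sum>e\<in>E1. const (c e) * power_product (x # xs) e) = x ^ n * (x * r)"
    unfolding r_def sum_distrib_left
  proof (intro sum.cong refl)
    fix e assume e: "e \<in> E1"
    then have "x ^ hd e = x ^ n * (x * x ^ (hd e - Suc n))"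
      using n_le[of e] by (auto simp: E1_def power_add[symmetric] power_Suc[symmetric] simp del: power_Suc)
    moreover have "power_product (x # xs) e = x ^ hd e * power_product xs (tl e)"
      using E_shape(1)[of e] e power_product_simps(2)[of x xs "hd e" "tl e"] by (auto simp: E1_def)
    ultimately show "const (c e) * power_product (x # xs) e =
        x ^ n * (x * (const (c e) * x ^ (hd e - Suc n) * power_product xs (tl e)))"
      by (simp add: mult_ac)
  qed
  also have "x ^ n * (const u * s) + x ^ n * (x * r) =
      const u * (x ^ n * (s + const (inverse u) * r * x))"
  proof -
    have "const u * const (inverse u) = (1 :: ('x, 'k) mpoly)"
      using us(1) by (simp add: const_mult[symmetric])
    then have "x ^ n * (x * r) = (const u * const (inverse u)) * (x ^ n * (x * r))"
      by simp
    then show ?thesis by (simp add: algebra_simps)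
  qed
  finally show ?case
    using us(1,2) by (intro exI conjI) auto
qed

text \<open>Bounds the degree in each variable separately rather than the total degree, so that the
  admissible monomials in d variables form a box of (k+1)^d points.\<close>

definition exponents_le :: "nat \<Rightarrow> ('x, 'k::zero) mpoly \<Rightarrow> bool" where
  "exponents_le k p \<longleftrightarrow> (\<forall>m\<in>Poly_Mapping.keys p. \<forall>v. Poly_Mapping.lookup m v \<le> k)"

lemma exponents_le_mult:
  fixes p q :: "('x, 'k::comm_ring_1) mpoly"
  assumes "exponents_le k p" "exponents_le l q" shows "exponents_le (k + l) (p * q)"
  unfolding exponents_le_def
proof (intro ballI allI)
  fix m v assume "m \<in> Poly_Mapping.keys (p * q)"
  then obtain a b where "m = a + b" "a \<in> Poly_Mapping.keys p" "b \<in> Poly_Mapping.keys q"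
    using keys_mult[of p q] by blast
  then show "Poly_Mapping.lookup m v \<le> k + l"
    using assms by (auto simp: exponents_le_def lookup_add add_mono)
qed

lemma exponents_le_one: "exponents_le 0 (1 :: ('x, 'k::comm_ring_1) mpoly)"
  by (simp add: exponents_le_def)

lemma exponents_le_power:
  fixes p :: "('x, 'k::comm_ring_1) mpoly"
  assumes "exponents_le k p" shows "exponents_le (n * k) (p ^ n)"
  by (induction n) (auto simp: exponents_le_one intro: exponents_le_mult[OF assms])

lemma exponents_le_mono: "exponents_le k p \<Longrightarrow> k \<le> l \<Longrightarrow> exponents_le l p"
  by (meson exponents_le_def order_trans)

lemma exists_exponents_le: "\<exists>k. exponents_le k p"
proof -
  have *: "\<exists>k. \<forall>m\<in>S. \<forall>v. Poly_Mapping.lookup m v \<le> k" if "finite S" for S :: "('x \<Rightarrow>\<^sub>0 nat) set"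
    using that
  proof (induction S rule: finite_induct)
    case (insert m S)
    then obtain k where k: "\<forall>m\<in>S. \<forall>v. Poly_Mapping.lookup m v \<le> k" by blast
    define l where "l = Max (insert 0 (Poly_Mapping.lookup m ` Poly_Mapping.keys m))"
    have "Poly_Mapping.lookup m v \<le> l" for v
      by (cases "v \<in> Poly_Mapping.keys m") (auto simp: l_def in_keys_iff)
    then show ?case
      using k by (intro exI[of _ "max k l"]) (auto simp: le_max_iff_disj)
  qed auto
  show ?thesis using *[of "Poly_Mapping.keys p"] by (simp add: exponents_le_def)
qed

lemma exponents_le_power_product:
  fixes xs :: "('x, 'k::comm_ring_1) mpoly list"
  assumes "\<And>x. x \<in> set xs \<Longrightarrow> exponents_le D x" "length es = length xs" "set es \<subseteq> {..N}"
  shows "exponents_le (length xs * (N * D)) (power_product xs es)"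
  using assms(2,1,3)
proof (induction es xs rule: list_induct2)
  case (Cons e es x xs)
  have "exponents_le (e * D) (x ^ e)" using Cons.prems by (auto intro: exponents_le_power)
  then have "exponents_le (N * D) (x ^ e)"
    by (rule exponents_le_mono) (use Cons.prems in auto)
  then show ?case
    using exponents_le_mult Cons by fastforce
qed (simp add: exponents_le_one)

lemma card_bounded_monomials:
  fixes F :: "'x set" and M :: nat
  assumes "finite F"
  defines "B \<equiv> {m. Poly_Mapping.keys m \<subseteq> F \<and> (\<forall>v. Poly_Mapping.lookup m v \<le> M)}"
  shows "finite B" "card B \<le> (M + 1) ^ card F"
proof -
  let ?f = "\<lambda>m. \<lambda>v\<in>F. Poly_Mapping.lookup m v"
  have inj: "inj_on ?f B"
  proof (rule inj_onI, rule poly_mapping_eqI)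
    fix m n v assume mn: "m \<in> B" "n \<in> B" "?f m = ?f n"
    show "Poly_Mapping.lookup m v = Poly_Mapping.lookup n v"
    proof (cases "v \<in> F")
      case True
      then show ?thesis using fun_cong[OF mn(3), of v] by simp
    next
      case False
      then have "v \<notin> Poly_Mapping.keys m" "v \<notin> Poly_Mapping.keys n" using mn by (auto simp: B_def)
      then show ?thesis by (simp add: in_keys_iff)
    qed
  qed
  have sub: "?f ` B \<subseteq> (\<Pi>\<^sub>E v\<in>F. {..M})"
    by (auto simp: B_def)
  have fin: "finite (\<Pi>\<^sub>E v\<in>F. {..M})" using assms by (intro finite_PiE) auto
  show "finite B" by (rule inj_on_finite[OF inj sub fin])
  show "card B \<le> (M + 1) ^ card F"
    using card_inj_on_le[OF inj sub fin] assms(1) by (simp add: card_PiE)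
qed

text \<open>Algebraic dependence of d + 1 polynomials modulo \<open>face_prime F\<close>, by
  counting: their power products with exponents up to N outnumber the monomials over F that can
  occur in them. A linear dependence of the restrictions to F is a relation lying in
  \<open>face_prime F\<close>, and up to a scalar it is a boundary element.\<close>

lemma boundary_set_meets_face_prime:
  fixes xs :: "('x, 'k::field) mpoly list"
  assumes F: "finite F" and len: "length xs = Suc (card F)"
  shows "boundary_set xs \<inter> face_prime F \<noteq> {}"
proof -
  let ?d = "card F"
  have "\<exists>D>0. \<forall>x\<in>set xs. exponents_le D x" for xs :: "('x, 'k) mpoly list"
  proof (induction xs)
    case (Cons x xs)
    then obtain D k where "D > 0" "\<forall>x\<in>set xs. exponents_le D x" "exponents_le k x"
      using exists_exponents_le by metis
    then show ?case
      by (intro exI[of _ "max D k"]) (auto intro: exponents_le_mono)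
  qed auto
  then obtain D where D: "D > 0" "\<And>x. x \<in> set xs \<Longrightarrow> exponents_le D x" by blast
  \<comment> \<open>D bounds the exponents in the given polynomials, so M = K N bounds those in the
    power products. From M + 1 <= K (N + 1) and N = K^d follows (M + 1)^d <= N (N + 1)^d < (N +
    1)^(d + 1), the number of exponent vectors.\<close>
  define K where "K = Suc ?d * D"
  define N where "N = K ^ ?d"
  define M where "M = Suc ?d * (N * D)"
  define E where "E = {es. set es \<subseteq> {..N} \<and> length es = Suc ?d}"
  define B where "B = {m :: 'x \<Rightarrow>\<^sub>0 nat. Poly_Mapping.keys m \<subseteq> F \<and> (\<forall>v. Poly_Mapping.lookup m v \<le> M)}"
  have finE: "finite E" and cardE: "card E = (N + 1) ^ Suc ?d"
    unfolding E_def using finite_lists_length_eq[of "{..N}" "Suc ?d"]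
      card_lists_length_eq[of "{..N}" "Suc ?d"] by auto
  have B: "finite B" "card B \<le> (M + 1) ^ ?d"
    unfolding B_def by (rule card_bounded_monomials[OF F])+
  have "M + 1 \<le> K * (N + 1)"
    using D(1) by (simp add: M_def K_def algebra_simps)
  then have "(M + 1) ^ ?d \<le> (K * (N + 1)) ^ ?d"
    by (rule power_mono) simp
  also have "\<dots> = N * (N + 1) ^ ?d"
    by (simp only: power_mult_distrib N_def)
  also have "\<dots> < (N + 1) * (N + 1) ^ ?d"
    by simp
  also have "\<dots> = card E"
    by (simp add: cardE)
  finally have "card B < card E" using B(2) by (rule le_less_trans[rotated])
  then obtain c where c: "\<exists>e\<in>E. c e \<noteq> 0"
      "\<forall>b\<in>B. (\<Sum>e\<in>E. c e * Poly_Mapping.lookup (power_product xs e) b) = 0"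
    using exists_linear_dependence[OF B(1) finE,
        of "\<lambda>e. Poly_Mapping.lookup (power_product xs e)"] by auto
  define E' where "E' = {e \<in> E. c e \<noteq> 0}"
  define p where "p = (\<Sum>e\<in>E'. const (c e) * power_product xs e)"
  have lookup_p: "Poly_Mapping.lookup p m =
      (\<Sum>e\<in>E. c e * Poly_Mapping.lookup (power_product xs e) m)" for m
    unfolding p_def lookup_sum lookup_const_mult
    using finE by (intro sum.mono_neutral_left) (auto simp: E'_def)
  have "p \<in> face_prime F"
    unfolding face_prime_def
  proof (intro CollectI ballI notI)
    fix m assume m: "m \<in> Poly_Mapping.keys p" "Poly_Mapping.keys m \<subseteq> F"
    have "\<exists>e\<in>E. m \<in> Poly_Mapping.keys (power_product xs e)"
    proof (rule ccontr)
      assume "\<not> ?thesis"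
      then have "Poly_Mapping.lookup p m = 0"
        unfolding lookup_p by (intro sum.neutral) (auto simp: in_keys_iff)
      then show False using m(1) by (simp add: in_keys_iff)
    qed
    then obtain e where e: "e \<in> E" "m \<in> Poly_Mapping.keys (power_product xs e)" by blast
    have "exponents_le M (power_product xs e)"
      unfolding M_def using exponents_le_power_product[OF D(2), of xs e N] e(1) len
      by (auto simp: E_def)
    then have "m \<in> B"
      using e(2) m(2) by (auto simp: B_def exponents_le_def)
    then show False
      using c(2) m(1) by (simp add: in_keys_iff lookup_p)
  qed
  moreover have "\<exists>u s. u \<noteq> 0 \<and> s \<in> boundary_set xs \<and> p = const u * s"
    unfolding p_def
  proof (rule relation_in_boundary_set)
    show "finite E'" using finE by (simp add: E'_def)
  qed (use c(1) len in \<open>auto simp: E'_def E_def\<close>)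
  then obtain u s where us: "u \<noteq> 0" "s \<in> boundary_set xs" "p = const u * s" by blast
  moreover have "s \<in> face_prime F \<longleftrightarrow> p \<in> face_prime F"
    using us(1,3) by (auto simp: face_prime_def in_keys_iff lookup_const_mult)
  ultimately show ?thesis by blast
qed

section \<open>Bounds on the depth\<close>

definition total_degree :: "('x \<Rightarrow>\<^sub>0 nat) \<Rightarrow> nat" where
  "total_degree m = (\<Sum>v\<in>Poly_Mapping.keys m. Poly_Mapping.lookup m v)"

lemma total_degree_add: "total_degree (m + n) = total_degree m + total_degree n"
proof -
  have eq: "total_degree k = (\<Sum>v\<in>Poly_Mapping.keys m \<union> Poly_Mapping.keys n. Poly_Mapping.lookup k v)"
    if "Poly_Mapping.keys k \<subseteq> Poly_Mapping.keys m \<union> Poly_Mapping.keys n" for k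
    unfolding total_degree_def using that by (intro sum.mono_neutral_left) (auto simp: in_keys_iff)
  show ?thesis
    by (subst (1 2 3) eq) (auto simp: lookup_add sum.distrib keys_add_nat)
qed

lemma total_degree_pos: "m \<noteq> 0 \<Longrightarrow> 0 < total_degree m"
  unfolding total_degree_def by (rule sum_pos) (auto simp: in_keys_iff)

lemma min_degree_power:
  fixes f :: "('x, 'k::comm_ring_1) mpoly"
  assumes "f \<in> face_prime {}" "m \<in> Poly_Mapping.keys (f ^ k)"
  shows "k \<le> total_degree m"
  using assms(2)
proof (induction k arbitrary: m)
  case (Suc k)
  then obtain a b where m: "m = a + b" "a \<in> Poly_Mapping.keys f" "b \<in> Poly_Mapping.keys (f ^ k)"
    using keys_mult[of f "f ^ k"] by auto
  have "a \<noteq> 0" using assms(1) m(2) by (auto simp: face_prime_def)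
  then show ?case
    using Suc.IH[OF m(3)] total_degree_pos[of a] m(1) by (simp add: total_degree_add)
qed simp

lemma exists_squarefree_monomial:
  assumes "finite F"
  obtains m where "Poly_Mapping.keys m = F" "total_degree m = card F"
proof
  let ?m = "\<Sum>v\<in>F. Poly_Mapping.single v (1::nat)"
  have td: "total_degree (0 :: 'a \<Rightarrow>\<^sub>0 nat) = 0" "total_degree (Poly_Mapping.single v (Suc 0)) = 1" for v :: 'a
    by (simp_all add: total_degree_def)
  show "Poly_Mapping.keys ?m = F" "total_degree ?m = card F"
    using assms by (induction F rule: finite_induct) (auto simp: keys_add_nat total_degree_add td)
qed

lemma maximal_set_origin: "maximal_set (face_prime {} :: ('x, 'k::field) mpoly set)"
  unfolding maximal_set_def
proof (intro conjI allI impI)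
  show "ring_ideal (face_prime {} :: ('x, 'k) mpoly set)"
    by (simp add: face_prime_eq ring_ideal_monomial_ideal)
  fix t :: "('x, 'k) mpoly" assume "t \<notin> face_prime {}"
  then have "Poly_Mapping.lookup t 0 \<noteq> 0" by (auto simp: face_prime_def in_keys_iff)
  then have "Poly_Mapping.lookup (const (inverse (Poly_Mapping.lookup t 0)) * t - 1) 0 = 0"
    by (simp add: lookup_minus lookup_const_mult)
  then show "\<exists>s. s * t - 1 \<in> face_prime {}"
    by (intro exI[of _ "const (inverse (Poly_Mapping.lookup t 0))"])
      (auto simp: face_prime_def in_keys_iff)
qed (simp add: face_prime_def)

text \<open>Dropping the vertices of F one at a time; each variable dropped separates two
  consecutive primes. This bounds the height of the origin from below.\<close>

lemma face_prime_chain: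
  assumes "finite F"
  obtains Q where "\<And>i. i \<le> card F \<Longrightarrow> prime_set (Q i) \<and> (face_prime F :: ('x, 'k::field) mpoly set) \<subseteq> Q i"
    "\<And>i. i < card F \<Longrightarrow> Q i \<subset> Q (Suc i)" "Q (card F) = face_prime {}"
proof -
  obtain vs where vs: "set vs = F" "distinct vs" using finite_distinct_list[OF assms] by blast
  then have len: "length vs = card F" using distinct_card by fastforce
  define Q :: "nat \<Rightarrow> ('x, 'k) mpoly set" where "Q i = face_prime (set (drop i vs))" for i
  have "prime_set (Q i) \<and> face_prime F \<subseteq> Q i" for i
    using prime_set_face_prime[of "set (drop i vs)"] set_drop_subset[of i vs] vs
    by (fastforce simp: Q_def face_prime_def)
  moreover have "Q i \<subset> Q (Suc i)" if "i < card F" for i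
  proof -
    have i: "i < length vs" using that len by simp
    have drop: "drop i vs = vs ! i # drop (Suc i) vs" using Cons_nth_drop_Suc[OF i] by simp
    have "vs ! i \<notin> set (drop (Suc i) vs)"
      using distinct_drop[OF vs(2), of i] drop by simp
    then have "poly_var (vs ! i) \<in> Q (Suc i) - Q i"
      by (auto simp: Q_def face_prime_def poly_var_def drop)
    moreover have "Q i \<subseteq> Q (Suc i)"
      by (auto simp: Q_def face_prime_def drop)
    ultimately show ?thesis by blast
  qed
  moreover have "Q (card F) = face_prime {}"
    by (simp add: Q_def len)
  ultimately show thesis using that by blast
qed

text \<open>A facet \<open>F\<close> bounds the depth: the monomial of \<open>F\<close> spans a submodule isomorphic to
  \<open>R/face_prime F\<close>, so the boundary relation of \<open>card F + 1\<close> elements kills it; applied to high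
  powers of a regular sequence, this forces a monomial of low degree into a high power of the
  maximal ideal.\<close>

lemma not_weakly_regular_facet:
  fixes fs :: "('x, 'k::field) mpoly list"
  assumes F: "finite F" and face: "\<And>G. G \<in> \<G> \<Longrightarrow> \<not> G \<subseteq> F"
    and facet: "\<And>v. v \<notin> F \<Longrightarrow> \<exists>G\<in>\<G>. G \<subseteq> insert v F"
    and fs: "set fs \<subseteq> face_prime {}" "card F < length fs"
  shows "\<not> weakly_regular (monomial_ideal \<G>) fs"
proof
  let ?J = "monomial_ideal \<G> :: ('x, 'k) mpoly set"
  assume reg: "weakly_regular ?J fs"
  have J: "ring_ideal ?J" by (rule ring_ideal_monomial_ideal)
  \<comment> \<open>The k-th power of an element of the origin's ideal has only monomials of degree
    at least k = card F + 1, one more than the degree of the monomial of F.\<close>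
  define k where "k = Suc (card F)"
  define gs where "gs = map (\<lambda>f. f ^ k) (take k fs)"
  have reg': "weakly_regular ?J gs"
    unfolding gs_def by (intro weakly_regular_powers[OF J] weakly_regular_take[OF reg])
  have "length gs = Suc (card F)" using fs(2) by (simp add: gs_def k_def)
  then obtain s where s: "s \<in> boundary_set gs" "s \<in> face_prime F"
    using boundary_set_meets_face_prime[OF F] by blast
  obtain m where m: "Poly_Mapping.keys m = F" "total_degree m = card F"
    using exists_squarefree_monomial[OF F] by blast
  define z where "z = Poly_Mapping.single m (1::'k)"
  have "z * s \<in> ?J"
    unfolding monomial_ideal_def
  proof (intro CollectI ballI)
    fix n assume "n \<in> Poly_Mapping.keys (z * s)"
    then obtain a where a: "n = m + a" "a \<in> Poly_Mapping.keys s"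
      using keys_mult[of z s] by (auto simp: z_def)
    then obtain v where v: "v \<in> Poly_Mapping.keys a" "v \<notin> F" using s(2) by (auto simp: face_prime_def)
    then obtain G where "G \<in> \<G>" "G \<subseteq> insert v F" using facet by blast
    then show "\<exists>G\<in>\<G>. G \<subseteq> Poly_Mapping.keys n"
      using v a m by (intro bexI[of _ G]) (auto simp: keys_add_nat)
  qed
  then have z: "z \<in> ideal_adjoins ?J gs"
    using boundary_weakly_regular[OF J reg' s(1)] by blast
  \<comment> \<open>The sum of the monomial ideal and the k-th power of the origin's ideal. The
    monomial of F is not in it: its degree is k - 1 and F contains no generator.\<close>
  define K :: "('x, 'k) mpoly set" where
    "K = {p. \<forall>n\<in>Poly_Mapping.keys p. k \<le> total_degree n \<or> (\<exists>G\<in>\<G>. G \<subseteq> Poly_Mapping.keys n)}"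
  have "ideal_adjoins ?J gs \<subseteq> K"
  proof (rule ideal_adjoins_subset)
    show "ring_ideal K"
    proof (rule ring_idealI)
      fix p q :: "('x, 'k) mpoly"
      show "p \<in> K \<Longrightarrow> q \<in> K \<Longrightarrow> p + q \<in> K"
        using Poly_Mapping.keys_add[of p q] by (auto simp: K_def)
      assume p: "p \<in> K"
      show "q * p \<in> K"
        unfolding K_def
      proof (intro CollectI ballI)
        fix n assume "n \<in> Poly_Mapping.keys (q * p)"
        then obtain a b where n: "n = a + b" "b \<in> Poly_Mapping.keys p"
          using keys_mult[of q p] by blast
        then have "k \<le> total_degree b \<or> (\<exists>G\<in>\<G>. G \<subseteq> Poly_Mapping.keys b)"
          using p by (auto simp: K_def)
        then show "k \<le> total_degree n \<or> (\<exists>G\<in>\<G>. G \<subseteq> Poly_Mapping.keys n)"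
          unfolding n(1) total_degree_add keys_add_nat by (elim disjE) (simp, blast)
      qed
    qed (simp add: K_def)
    show "?J \<subseteq> K" by (auto simp: K_def monomial_ideal_def)
    show "set gs \<subseteq> K"
      using fs(1) set_take_subset[of k fs] min_degree_power[of _ _ k]
      by (fastforce simp: gs_def K_def)
  qed
  then show False
    using z face m by (auto simp: K_def z_def k_def)
qed

section \<open>Koszul obstructions for the edge ideals of the 4-cycle and the 7-cycle\<close>

lemma exists_var_combination:
  fixes f :: "('x, 'k::field) mpoly"
  assumes V: "finite V" and f: "f \<in> polys_in V" "f \<in> face_prime {}"
  shows "\<exists>a. f = (\<Sum>v\<in>V. a v * poly_var v)"
proof -
  let ?K = "{p :: ('x, 'k) mpoly. \<exists>a. p = (\<Sum>v\<in>V. a v * poly_var v)}"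
  have "ring_ideal ?K"
  proof (rule ring_idealI)
    show "0 \<in> ?K" by (auto intro: exI[of _ "\<lambda>_. 0"])
    fix p q assume "p \<in> ?K"
    then obtain a where a: "p = (\<Sum>v\<in>V. a v * poly_var v)" by blast
    show "p + q \<in> ?K" if "q \<in> ?K"
    proof -
      obtain b where "q = (\<Sum>v\<in>V. b v * poly_var v)" using \<open>q \<in> ?K\<close> by blast
      then show ?thesis
        using a by (auto intro!: exI[of _ "\<lambda>v. a v + b v"] simp: sum.distrib distrib_right)
    qed
    show "q * p \<in> ?K"
      unfolding a by (auto intro!: exI[of _ "\<lambda>v. q * a v"] simp: sum_distrib_left mult.assoc)
  qed
  then have "f \<in> ?K"
  proof (rule ring_ideal_in_if_single)
    fix m assume m: "m \<in> Poly_Mapping.keys f"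
    then have "Poly_Mapping.keys m \<noteq> {}" "Poly_Mapping.keys m \<subseteq> V"
      using f by (auto simp: polys_in_def face_prime_def)
    then obtain v where v: "v \<in> Poly_Mapping.keys m" "v \<in> V" by blast
    let ?a = "\<lambda>w. if w = v then Poly_Mapping.single (m - Poly_Mapping.single v 1) (Poly_Mapping.lookup f m) else 0"
    have "(\<Sum>w\<in>V. ?a w * poly_var w) = (\<Sum>w\<in>V. if w = v then ?a v * poly_var v else 0)"
      by (intro sum.cong) auto
    also have "\<dots> = ?a v * poly_var v"
      using V v by simp
    also have "\<dots> = Poly_Mapping.single m (Poly_Mapping.lookup f m)"
      using minus_single_add[OF v(1)] by (simp add: poly_var_def mult_single add.commute)
    finally show "Poly_Mapping.single m (Poly_Mapping.lookup f m) \<in> ?K"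
      by (intro CollectI exI[of _ ?a]) (rule sym)
  qed
  then show ?thesis by blast
qed

lemma finite_vars: "\<exists>V. finite V \<and> p \<in> polys_in V"
  by (intro exI[of _ "\<Union>m\<in>Poly_Mapping.keys p. Poly_Mapping.keys m"]) (auto simp: polys_in_def)

lemma finite_vars_list:
  assumes "finite V0"
  shows "\<exists>V. finite V \<and> V0 \<subseteq> V \<and> set fs \<subseteq> polys_in V"
proof (induction fs)
  case (Cons f fs)
  then obtain V W where "finite V" "V0 \<subseteq> V" "set fs \<subseteq> polys_in V" "finite W" "f \<in> polys_in W"
    using finite_vars by metis
  then show ?case
    using polys_in_mono[of V "V \<union> W"] polys_in_mono[of W "V \<union> W"]
    by (intro exI[of _ "V \<union> W"]) auto
qed (use assms in auto)

lemma lookup_poly_var_mult: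
  fixes p :: "('x, 'k::field) mpoly"
  shows "Poly_Mapping.lookup (poly_var v * p) (Poly_Mapping.single v 1 + m) = Poly_Mapping.lookup p m"
  by (simp add: poly_var_def lookup_single_mult)

text \<open>Generators of the edge ideal of the n-cycle with vertices
  \<open>e 0, ..., e (n - 1)\<close>; the singletons kill all other variables.\<close>

definition cycle_edges :: "nat \<Rightarrow> (nat \<Rightarrow> 'x) \<Rightarrow> 'x set set" where
  "cycle_edges n e = {{e i, e (Suc i mod n)} | i. i < n} \<union> {{v} | v. v \<notin> e ` {..<n}}"

lemma poly_var_mult_mem:
  "{v, w} \<in> \<G> \<Longrightarrow> poly_var v * poly_var w \<in> (monomial_ideal \<G> :: ('x, 'k::field) mpoly set)"
  by (auto simp: monomial_ideal_def poly_var_def mult_single keys_add_nat intro!: bexI[of _ "{v, w}"])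

lemma cycle_edges_mult_mem:
  assumes "i < n" "j < n" "j = Suc i mod n \<or> i = Suc j mod n"
  shows "poly_var (e i) * poly_var (e j) \<in> (monomial_ideal (cycle_edges n e) :: ('x, 'k::field) mpoly set)"
proof (rule poly_var_mult_mem)
  show "{e i, e j} \<in> cycle_edges n e"
    using assms by (auto simp: cycle_edges_def insert_commute)
qed

lemma cycle_edges_outside_mem:
  "v \<notin> e ` {..<n} \<Longrightarrow> poly_var v \<in> (monomial_ideal (cycle_edges n e) :: ('x, 'k::field) mpoly set)"
  by (auto simp: monomial_ideal_def cycle_edges_def poly_var_def intro!: bexI[of _ "{v}"])

lemma notin_monomial_idealD:
  assumes "p \<in> monomial_ideal \<G>" "\<And>G. G \<in> \<G> \<Longrightarrow> \<not> G \<subseteq> Poly_Mapping.keys m"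
  shows "Poly_Mapping.lookup p m = 0"
proof (rule ccontr)
  assume "Poly_Mapping.lookup p m \<noteq> 0"
  then have "m \<in> Poly_Mapping.keys p" by (simp add: in_keys_iff)
  then obtain G where "G \<in> \<G>" "G \<subseteq> Poly_Mapping.keys m"
    using assms(1) unfolding monomial_ideal_def by blast
  then show False using assms(2) by blast
qed

text \<open>The independence complex of the 4-cycle consists of the disjoint edges {0, 2} and {1,
  3}. The indicator of one component is locally constant but not constant, a nontrivial reduced
  class in degree 0.\<close>

lemma two_mod_four_not_regular:
  fixes e :: "nat \<Rightarrow> 'x"
  assumes inj: "inj_on e {..<4}" and f: "f \<in> face_prime {}" "g \<in> face_prime {}"
  shows "\<not> weakly_regular (monomial_ideal (cycle_edges 4 e) :: ('x, 'k::field) mpoly set) [f, g]"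
proof
  let ?\<G> = "cycle_edges 4 e" and ?J = "monomial_ideal (cycle_edges 4 e) :: ('x, 'k) mpoly set"
  let ?y = "poly_var :: 'x \<Rightarrow> ('x, 'k) mpoly"
  assume reg: "weakly_regular ?J [f, g]"
  have J: "ring_ideal ?J" by (rule ring_ideal_monomial_ideal)
  obtain V where V: "finite V" "e ` {..<4} \<subseteq> V" "f \<in> polys_in V" "g \<in> polys_in V"
    using finite_vars_list[of "e ` {..<4}" "[f, g]"] by auto
  obtain a a' where a: "f = (\<Sum>v\<in>V. a v * ?y v)" "g = (\<Sum>v\<in>V. a' v * ?y v)"
    using exists_var_combination[OF V(1,3) f(1)] exists_var_combination[OF V(1,4) f(2)] by blast
  have ne: "e i = e j \<longleftrightarrow> i = j" if "i < 4" "j < 4" for i j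
    using inj that by (auto simp: inj_on_def)
  have outside: "?y v \<in> ?J" if "v \<notin> e ` {..<4}" for v
    using that by (rule cycle_edges_outside_mem)
  have edge: "?y (e i) * ?y (e j) \<in> ?J" if "i < 4" "j < 4" "j = Suc i mod 4 \<or> i = Suc j mod 4" for i j
    using that by (rule cycle_edges_mult_mem)
  \<comment> \<open>The indicator of the component {0, 2} as a Koszul 1-cochain: each value is
    multiplied by the variable of its vertex. Products of variables from different components lie in
    the ideal, whence the cocycle condition.\<close>
  define b where "b v = (if v = e 0 \<or> v = e 2 then ?y v else 0)" for v
  have prod: "?y v * ?y w \<in> ?J" if "v = e 0 \<or> v = e 2" "w \<noteq> e 0" "w \<noteq> e 2" for v w
  proof (cases "w \<in> e ` {..<4}")
    case True
    then obtain i where "w = e i" "i < 4" by blast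
    then have "w = e 1 \<or> w = e 3"
      using that ne by (auto simp: less_Suc_eq numeral_eq_Suc)
    then show ?thesis
      using that(1) edge[of 0 1] edge[of 0 3] edge[of 2 1] edge[of 2 3] by auto
  next
    case False
    then show ?thesis using ring_ideal_mult_left[OF J outside] by blast
  qed
  have "\<exists>u. \<forall>j\<in>V. b j - ?y j * u \<in> ?J"
  proof (rule koszul_cocycle_1[OF J reg a])
    fix i j
    consider "b i = ?y i" "b j = ?y j" | "b i = 0" "b j = 0"
      | "b i = ?y i" "b j = 0" "?y i * ?y j \<in> ?J" | "b i = 0" "b j = ?y j" "?y j * ?y i \<in> ?J"
      using prod[of i j] prod[of j i] unfolding b_def by argo
    then show "?y i * b j - ?y j * b i \<in> ?J"
    proof cases
      case 3
      then show ?thesis using ring_ideal_uminus[OF J] by (simp add: mult.commute[of "?y j"])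
    next
      case 4
      then show ?thesis by (simp add: mult.commute[of "?y i"])
    qed (simp_all add: ring_ideal_zero[OF J] mult.commute[of "?y j"])
  qed
  then obtain u where u: "\<And>j. j \<in> V \<Longrightarrow> b j - ?y j * u \<in> ?J" by blast
  \<comment> \<open>No generator is supported on a single cycle vertex, so linear coefficients can
    be compared: the constant term of u would equal the indicator at every vertex.\<close>
  have coeff: "Poly_Mapping.lookup (b (e i)) (Poly_Mapping.single (e i) 1) = Poly_Mapping.lookup u 0"
    if i: "i < 4" for i
  proof -
    have "Poly_Mapping.lookup (b (e i) - ?y (e i) * u) (Poly_Mapping.single (e i) 1) = 0"
    proof (rule notin_monomial_idealD[OF u])
      fix G assume "G \<in> ?\<G>"
      then consider j where "j < 4" "G = {e j, e (Suc j mod 4)}" | v where "G = {v}" "v \<notin> e ` {..<4}"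
        unfolding cycle_edges_def by blast
      then show "\<not> G \<subseteq> Poly_Mapping.keys (Poly_Mapping.single (e i) (1::nat))"
      proof cases
        case 1
        then show ?thesis using i ne[of j i] ne[of "Suc j mod 4" i] by (auto simp: mod_Suc split: if_splits)
      qed (use i in auto)
    qed (use V i in auto)
    moreover have "Poly_Mapping.lookup (?y (e i) * u) (Poly_Mapping.single (e i) 1) = Poly_Mapping.lookup u 0"
      using lookup_poly_var_mult[of "e i" u 0] by simp
    ultimately show ?thesis by (simp add: lookup_minus)
  qed
  have "b (e 0) = ?y (e 0)" "b (e 1) = 0"
    using ne[of 1 0] ne[of 1 2] by (simp_all add: b_def)
  then have "Poly_Mapping.lookup u 0 = 1" "Poly_Mapping.lookup u 0 = 0"
    using coeff[of 0] coeff[of 1] by (simp_all add: poly_var_def)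
  then show False by simp
qed

text \<open>A simplicial 1-cocycle on the independence complex of the 7-cycle with vertices \<open>0, \<dots>, 6\<close>;
  it is not a coboundary, as it has sum 1 along the closed path \<open>0, 2, 4, 6, 1, 3, 5, 0\<close>.\<close>

definition heptagon_cocycle :: "nat \<Rightarrow> nat \<Rightarrow> int" where
  "heptagon_cocycle i j =
     (if (i, j) \<in> {(0, 2), (0, 4), (5, 2)} then 1
      else if (i, j) \<in> {(2, 0), (4, 0), (2, 5)} then - 1 else 0)"

lemma heptagon_cocycle_closed:
  assumes "i < 7" "j < 7" "l < 7"
    and "\<And>a b. (a, b) \<in> {(i, j), (j, i), (j, l), (l, j), (i, l), (l, i)} \<Longrightarrow> b \<noteq> Suc a mod 7"
  shows "heptagon_cocycle j l - heptagon_cocycle i l + heptagon_cocycle i j = 0"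
proof -
  have "\<forall>i\<in>set [0..<7]. \<forall>j\<in>set [0..<7]. \<forall>l\<in>set [0..<7].
      j \<noteq> Suc i mod 7 \<and> i \<noteq> Suc j mod 7 \<and> l \<noteq> Suc j mod 7 \<and> j \<noteq> Suc l mod 7 \<and>
      l \<noteq> Suc i mod 7 \<and> i \<noteq> Suc l mod 7 \<longrightarrow>
      heptagon_cocycle j l - heptagon_cocycle i l + heptagon_cocycle i j = 0"
    unfolding heptagon_cocycle_def by code_simp
  then show ?thesis using assms by simp
qed

lemma three_mod_seven_not_regular:
  fixes e :: "nat \<Rightarrow> 'x"
  assumes inj: "inj_on e {..<7}"
    and f: "f \<in> face_prime {}" "g \<in> face_prime {}" "h \<in> face_prime {}"
  shows "\<not> weakly_regular (monomial_ideal (cycle_edges 7 e) :: ('x, 'k::field) mpoly set) [f, g, h]"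
proof
  let ?\<G> = "cycle_edges 7 e" and ?J = "monomial_ideal (cycle_edges 7 e) :: ('x, 'k) mpoly set"
  let ?y = "poly_var :: 'x \<Rightarrow> ('x, 'k) mpoly"
  assume reg: "weakly_regular ?J [f, g, h]"
  have J: "ring_ideal ?J" by (rule ring_ideal_monomial_ideal)
  obtain V where V: "finite V" "e ` {..<7} \<subseteq> V" "f \<in> polys_in V" "g \<in> polys_in V" "h \<in> polys_in V"
    using finite_vars_list[of "e ` {..<7}" "[f, g, h]"] by auto
  obtain a a' a'' where a: "f = (\<Sum>v\<in>V. a v * ?y v)" "g = (\<Sum>v\<in>V. a' v * ?y v)"
      "h = (\<Sum>v\<in>V. a'' v * ?y v)"
    using exists_var_combination[OF V(1,3) f(1)] exists_var_combination[OF V(1,4) f(2)]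
      exists_var_combination[OF V(1,5) f(3)] by blast
  have ne: "e i = e j \<longleftrightarrow> i = j" if "i < 7" "j < 7" for i j
    using inj that by (auto simp: inj_on_def)
  have outside: "?y v \<in> ?J" if "v \<notin> e ` {..<7}" for v
    using that by (rule cycle_edges_outside_mem)
  have edge: "?y (e i) * ?y (e j) \<in> ?J" if "i < 7" "j < 7" "j = Suc i mod 7 \<or> i = Suc j mod 7" for i j
    using that by (rule cycle_edges_mult_mem)
  define idx where "idx = the_inv_into {..<7} e"
  have idx: "idx (e i) = i" if "i < 7" for i
    using the_inv_into_f_f[OF inj] that by (simp add: idx_def)
  \<comment> \<open>\<open>C\<close> is the simplicial cocycle carried to the variables and extended
    by zero; \<open>c\<close> is the corresponding Koszul 2-cochain, each value multiplied by the
    monomial of its edge.\<close>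
  define C where "C v w = (if v \<in> e ` {..<7} \<and> w \<in> e ` {..<7} then heptagon_cocycle (idx v) (idx w) else 0)" for v w
  define c where "c v w = of_int (C v w) * ?y v * ?y w" for v w
  have "\<exists>b. \<forall>j\<in>V. \<forall>l\<in>V. c j l - (?y j * b l - ?y l * b j) \<in> ?J"
  proof (rule koszul_cocycle_2[OF J reg a])
    fix u v w
    have eq: "?y u * c v w - ?y v * c u w + ?y w * c u v =
        of_int (C v w - C u w + C u v) * (?y u * ?y v * ?y w)"
      by (simp add: c_def algebra_simps)
    show "?y u * c v w - ?y v * c u w + ?y w * c u v \<in> ?J"
    proof (cases "?y u * ?y v * ?y w \<in> ?J")
      case True
      then show ?thesis unfolding eq by (rule ring_ideal_mult_left[OF J])
    next
      case False
      \<comment> \<open>A product outside the ideal comes from pairwise nonadjacent cycle vertices;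
        there the simplicial cocycle identity makes the coefficient vanish.\<close>
      have "?y u \<notin> ?J" "?y v \<notin> ?J" "?y w \<notin> ?J"
        using False ring_ideal_mult_left[OF J, of "?y w" "?y u * ?y v"]
          ring_ideal_mult_right[OF J, of "?y u" "?y v * ?y w"]
          ring_ideal_mult_right[OF J, of "?y v" "?y u * ?y w"]
        by (auto simp: mult.assoc mult.left_commute[of "?y v"])
      then have "u \<in> e ` {..<7}" "v \<in> e ` {..<7}" "w \<in> e ` {..<7}"
        using outside by blast+
      then obtain i j l where ijl: "u = e i" "v = e j" "w = e l" "i < 7" "j < 7" "l < 7" by blast
      have "?y u * ?y v \<notin> ?J" "?y v * ?y w \<notin> ?J" "?y u * ?y w \<notin> ?J"
        using False ring_ideal_mult_right[OF J, of "?y u * ?y v" "?y w"]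
          ring_ideal_mult_left[OF J, of "?y v * ?y w" "?y u"]
          ring_ideal_mult_left[OF J, of "?y u * ?y w" "?y v"]
        by (auto simp: mult.assoc mult.left_commute[of "?y v"])
      then have "b \<noteq> Suc a mod 7" if "(a, b) \<in> {(i, j), (j, i), (j, l), (l, j), (i, l), (l, i)}" for a b
        using that ijl edge[of i j] edge[of j l] edge[of i l] by auto
      from heptagon_cocycle_closed[OF ijl(4-6) this]
      have "C v w - C u w + C u v = 0"
        using ijl idx by (simp add: C_def)
      then show ?thesis unfolding eq by (simp add: ring_ideal_zero[OF J])
    qed
  qed
  then obtain b where b: "\<And>j l. j \<in> V \<Longrightarrow> l \<in> V \<Longrightarrow> c j l - (?y j * b l - ?y l * b j) \<in> ?J" by blast
  \<comment> \<open>The coefficient of x_i in \<open>b (e i)\<close>. Comparing coefficients at x_i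
    x_j turns the Koszul coboundary into a simplicial one with this potential.\<close>
  define \<beta> where "\<beta> i = Poly_Mapping.lookup (b (e i)) (Poly_Mapping.single (e i) 1)" for i
  have coboundary: "of_int (heptagon_cocycle i j) = \<beta> j - \<beta> i"
    if ij: "i < 7" "j < 7" "i \<noteq> j" "j \<noteq> Suc i mod 7" "i \<noteq> Suc j mod 7" for i j
  proof -
    let ?m = "Poly_Mapping.single (e i) (1::nat) + Poly_Mapping.single (e j) 1"
    have m': "?m = Poly_Mapping.single (e j) 1 + Poly_Mapping.single (e i) 1" by (rule add.commute)
    have "Poly_Mapping.lookup (c (e i) (e j) - (?y (e i) * b (e j) - ?y (e j) * b (e i))) ?m = 0"
    proof (rule notin_monomial_idealD[OF b])
      fix G assume "G \<in> ?\<G>"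
      then consider l where "l < 7" "G = {e l, e (Suc l mod 7)}" | v where "G = {v}" "v \<notin> e ` {..<7}"
        unfolding cycle_edges_def by blast
      then show "\<not> G \<subseteq> Poly_Mapping.keys ?m"
      proof cases
        case 1
        then show ?thesis
          using ij ne[of l i] ne[of l j] ne[of "Suc l mod 7" i] ne[of "Suc l mod 7" j]
          by (auto simp: keys_add_nat mod_Suc split: if_splits)
      qed (use ij in \<open>auto simp: keys_add_nat\<close>)
    qed (use V ij in auto)
    moreover have "Poly_Mapping.lookup (?y (e i) * b (e j)) ?m = \<beta> j"
      unfolding \<beta>_def by (rule lookup_poly_var_mult)
    moreover have "Poly_Mapping.lookup (?y (e j) * b (e i)) ?m = \<beta> i"
      unfolding \<beta>_def m' by (rule lookup_poly_var_mult)
    moreover have "Poly_Mapping.lookup (c (e i) (e j)) ?m = of_int (heptagon_cocycle i j)"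
    proof -
      have "c (e i) (e j) = Poly_Mapping.single ?m (of_int (heptagon_cocycle i j))"
        using ij by (simp add: c_def C_def idx poly_var_def mult_single single_of_int[symmetric] del: single_of_int)
      then show ?thesis by simp
    qed
    ultimately show ?thesis by (simp add: lookup_minus)
  qed
  have "\<beta> 2 - \<beta> 0 = 1" "\<beta> 4 - \<beta> 2 = 0" "\<beta> 6 - \<beta> 4 = 0" "\<beta> 1 - \<beta> 6 = 0" "\<beta> 3 - \<beta> 1 = 0"
    "\<beta> 5 - \<beta> 3 = 0" "\<beta> 0 - \<beta> 5 = 0"
    using coboundary[of 0 2] coboundary[of 2 4] coboundary[of 4 6] coboundary[of 6 1]
      coboundary[of 1 3] coboundary[of 3 5] coboundary[of 5 0]
    by (simp_all add: heptagon_cocycle_def)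
  then show False by simp
qed

section \<open>Noetherianity\<close>

text \<open>Elements whose v-coordinate is at least N are handled by a finite basis
  \<open>B0\<close> for the other coordinates, where N bounds the v-coordinates of
  \<open>B0\<close>. Each of the finitely many smaller values has a finite basis \<open>B n\<close>
  of its own.\<close>

lemma dickson:
  fixes L :: "'m \<Rightarrow> 'x \<Rightarrow> nat"
  assumes "finite V"
  shows "\<exists>B\<subseteq>S. finite B \<and> (\<forall>m\<in>S. \<exists>b\<in>B. \<forall>w\<in>V. L b w \<le> L m w)"
  using assms
proof (induction V arbitrary: S rule: finite_induct)
  case empty
  show ?case
  proof (cases "S = {}")
    case False
    then obtain s where "s \<in> S" by blast
    then show ?thesis by (intro exI[of _ "{s}"]) auto
  qed auto
next
  case (insert v V)
  obtain B0 where B0: "B0 \<subseteq> S" "finite B0" "\<forall>m\<in>S. \<exists>b\<in>B0. \<forall>w\<in>V. L b w \<le> L m w"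
    using insert.IH by blast
  obtain N where N: "\<forall>b\<in>B0. L b v \<le> N"
    using B0(2) by (meson finite_imageI finite_nat_set_iff_bounded_le image_eqI)
  have "\<exists>B\<subseteq>{m \<in> S. L m v = n}. finite B \<and> (\<forall>m\<in>{m \<in> S. L m v = n}. \<exists>b\<in>B. \<forall>w\<in>V. L b w \<le> L m w)" for n
    by (rule insert.IH)
  then have "\<forall>n. \<exists>B. B \<subseteq> {m \<in> S. L m v = n} \<and> finite B \<and>
      (\<forall>m\<in>{m \<in> S. L m v = n}. \<exists>b\<in>B. \<forall>w\<in>V. L b w \<le> L m w)"
    by blast
  from choice[OF this] obtain B where B': "\<forall>n. B n \<subseteq> {m \<in> S. L m v = n} \<and> finite (B n) \<and>
      (\<forall>m\<in>{m \<in> S. L m v = n}. \<exists>b\<in>B n. \<forall>w\<in>V. L b w \<le> L m w)"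
    by blast
  then have B: "\<And>n. B n \<subseteq> {m \<in> S. L m v = n}" "\<And>n. finite (B n)"
      "\<And>n m. m \<in> S \<Longrightarrow> L m v = n \<Longrightarrow> \<exists>b\<in>B n. \<forall>w\<in>V. L b w \<le> L m w"
    by auto
  show ?case
  proof (intro exI[of _ "B0 \<union> (\<Union>n<N. B n)"] conjI ballI)
    show "B0 \<union> (\<Union>n<N. B n) \<subseteq> S" using B0 B(1) by blast
    show "finite (B0 \<union> (\<Union>n<N. B n))" using B0 B(2) by simp
    fix m assume m: "m \<in> S"
    show "\<exists>b\<in>B0 \<union> (\<Union>n<N. B n). \<forall>w\<in>insert v V. L b w \<le> L m w"
    proof (cases "L m v < N")
      case True
      obtain b where b: "b \<in> B (L m v)" "\<forall>w\<in>V. L b w \<le> L m w" using B(3)[OF m] by blast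
      moreover have "L b v = L m v" using b(1) B(1) by blast
      ultimately show ?thesis using True by (intro bexI[of _ b]) auto
    next
      case False
      obtain b where "b \<in> B0" "\<forall>w\<in>V. L b w \<le> L m w" using B0(3) m by blast
      then show ?thesis using N False by (intro bexI[of _ b]) (auto intro: order_trans)
    qed
  qed
qed

lemma diff_restrict_in_face_prime: "p - restrict_vars V p \<in> face_prime V"
  for p :: "('x, 'k::comm_ring_1) mpoly"
  by (auto simp: face_prime_def in_keys_iff lookup_minus restrict_vars_def lookup_select)

lemma leading_diff_cancel:
  fixes p q :: "('x, 'k::comm_ring_1) mpoly"
  assumes "leading vs p m" "leading vs q m" "Poly_Mapping.lookup p m = Poly_Mapping.lookup q m"
    and "leading vs (p - q) n"
  shows "lex_less vs n m"
proof -
  have "n \<in> Poly_Mapping.keys (p - q)" using assms(4) by (simp add: leading_def)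
  moreover from this have "n \<noteq> m" using assms(3) by (auto simp: in_keys_iff lookup_minus)
  moreover have "n \<in> Poly_Mapping.keys p \<or> n \<in> Poly_Mapping.keys q"
    using calculation(1) by (auto simp: in_keys_iff lookup_minus)
  ultimately show ?thesis
    using assms(1,2) unfolding leading_def by blast
qed

text \<open>Hilbert's basis theorem by Groebner division. As the variable type may be infinite,
  generation is relative to an ideal J that kills all variables outside the finite set V.\<close>

lemma ideal_finitely_generated_over:
  fixes K :: "('x, 'k::field) mpoly set"
  assumes V: "finite V" and K: "ring_ideal K" and J: "ring_ideal J" "face_prime V \<subseteq> J" "J \<subseteq> K"
  shows "\<exists>fs. K = ideal_adjoins J fs"
proof -
  obtain vs where vs: "set vs = V" using finite_list[OF V] by blast
  define S where "S = {m. \<exists>p\<in>K \<inter> polys_in V. leading vs p m}"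
  obtain B where B: "B \<subseteq> S" "finite B"
      "\<forall>m\<in>S. \<exists>b\<in>B. \<forall>w\<in>V. Poly_Mapping.lookup b w \<le> Poly_Mapping.lookup m w"
    using dickson[OF V, of S Poly_Mapping.lookup] by blast
  have "\<forall>b\<in>B. \<exists>p\<in>K \<inter> polys_in V. leading vs p b" using B(1) by (auto simp: S_def)
  then obtain f where f: "\<And>b. b \<in> B \<Longrightarrow> f b \<in> K \<inter> polys_in V \<and> leading vs (f b) b" by metis
  obtain bs where bs: "set bs = B" using finite_list[OF B(2)] by blast
  let ?K = "ideal_adjoins J (map f bs)"
  have K': "ring_ideal ?K" by (rule ring_ideal_adjoins[OF J(1)])
  have keys_V: "Poly_Mapping.keys m \<subseteq> V" if "leading vs p m" "p \<in> polys_in V" for p :: "('x, 'k) mpoly" and m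
    using that by (auto simp: leading_def polys_in_def)
  \<comment> \<open>Division algorithm: subtracting a suitable multiple of \<open>f b\<close>
    cancels the leading term and leaves a smaller one, so well-foundedness of the lexicographic
    order ends the process.\<close>
  have main: "p \<in> ?K" if "p \<in> K \<inter> polys_in V" "leading vs p m" for p m
    using that
  proof (induction m arbitrary: p rule: wf_induct_rule[OF wf_lex_less[of vs]])
    case (1 m)
    have "m \<in> S" using "1.prems" by (auto simp: S_def)
    then obtain b where b: "b \<in> B" "\<forall>w\<in>V. Poly_Mapping.lookup b w \<le> Poly_Mapping.lookup m w"
      using B(3) by blast
    have fb: "f b \<in> K" "f b \<in> polys_in V" "leading vs (f b) b" using f[OF b(1)] by auto
    have "Poly_Mapping.lookup b w \<le> Poly_Mapping.lookup m w" for w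
    proof (cases "w \<in> Poly_Mapping.keys b")
      case True
      then show ?thesis using b(2) keys_V[OF fb(3,2)] by blast
    qed (simp add: in_keys_iff)
    then have m: "m = (m - b) + b"
      by (intro poly_mapping_eqI) (simp add: lookup_add lookup_minus)
    define c where "c = Poly_Mapping.lookup p m / Poly_Mapping.lookup (f b) b"
    define h where "h = Poly_Mapping.single (m - b) c"
    have nz: "Poly_Mapping.lookup p m \<noteq> 0" "Poly_Mapping.lookup (f b) b \<noteq> 0"
      using "1.prems" fb by (auto simp: leading_def in_keys_iff)
    then have "leading vs h (m - b)" "Poly_Mapping.lookup h (m - b) = c"
      by (auto simp: h_def leading_def c_def)
    then have hf: "leading vs (h * f b) m" "Poly_Mapping.lookup (h * f b) m = Poly_Mapping.lookup p m"
      using leading_mult[of vs h "m - b" "f b" b] fb m nz by (auto simp: c_def)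
    have "Poly_Mapping.keys (m - b) \<subseteq> V"
      using keys_V[OF "1.prems"(2)] "1.prems"(1) by (auto simp: in_keys_iff lookup_minus)
    then have "h * f b \<in> polys_in V"
      unfolding h_def by (intro polys_in_mult polys_in_single fb)
    then have q: "p - h * f b \<in> K \<inter> polys_in V"
      using "1.prems" fb K by (auto intro: polys_in_diff ring_ideal_diff ring_ideal_mult_left)
    have hK: "h * f b \<in> ?K"
      using set_subset_ideal_adjoins[OF J(1), of "map f bs"] b bs
      by (intro ring_ideal_mult_left[OF K']) auto
    have "p - h * f b \<in> ?K"
    proof (cases "p - h * f b = 0")
      case True
      then show ?thesis by (simp add: ring_ideal_zero[OF K'])
    next
      case False
      then obtain n where n: "leading vs (p - h * f b) n"
        using exists_leading[of "p - h * f b" vs] q vs by auto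
      then have "lex_less vs n m"
        using leading_diff_cancel[OF "1.prems"(2) hf(1) hf(2)[symmetric]] by blast
      then show ?thesis using "1.IH"[of n] q n by blast
    qed
    then show ?case using ring_ideal_add[OF K' _ hK] by fastforce
  qed
  have "K \<subseteq> ?K"
  proof
    fix p assume p: "p \<in> K"
    have d: "p - restrict_vars V p \<in> J" using diff_restrict_in_face_prime J(2) by blast
    then have "restrict_vars V p \<in> K \<inter> polys_in V"
      using p J(3) K restrict_in ring_ideal_diff_cancel[OF K, of p "restrict_vars V p"] by blast
    then have "restrict_vars V p \<in> ?K"
      using main exists_leading[of "restrict_vars V p" vs] vs ring_ideal_zero[OF K'] by (metis IntE)
    then show "p \<in> ?K"
      using ring_ideal_diff_cancel[OF K', of p "restrict_vars V p"] d subset_ideal_adjoins[of J "map f bs"]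
      by blast
  qed
  moreover have "?K \<subseteq> K"
    by (rule ideal_adjoins_subset) (use K J f bs in auto)
  ultimately show ?thesis by blast
qed

section \<open>Expansion of a polynomial in powers of one variable\<close>

definition coeff_in :: "'x \<Rightarrow> nat \<Rightarrow> ('x, 'k::zero) mpoly \<Rightarrow> ('x, 'k) mpoly" where
  "coeff_in v n p = select (\<lambda>m. Poly_Mapping.lookup m v = 0)
     (Poly_Mapping.map_key (\<lambda>m. m + Poly_Mapping.single v n) p)"

lemma lookup_coeff_in:
  "Poly_Mapping.lookup (coeff_in v n p) m =
     (if Poly_Mapping.lookup m v = 0 then Poly_Mapping.lookup p (m + Poly_Mapping.single v n) else 0)"
proof -
  have "inj (\<lambda>m. m + Poly_Mapping.single v n)" by (simp add: inj_on_def)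
  then show ?thesis by (simp add: coeff_in_def lookup_select map_key.rep_eq)
qed

lemma coeff_in_add: "coeff_in v n (p + q) = coeff_in v n p + coeff_in v n q"
  by (rule poly_mapping_eqI) (simp add: lookup_coeff_in lookup_add)

lemma coeff_in_zero [simp]: "coeff_in v n 0 = 0"
  by (rule poly_mapping_eqI) (simp add: lookup_coeff_in)

lemma coeff_in_sum: "coeff_in v n (sum f A) = (\<Sum>i\<in>A. coeff_in v n (f i))"
  by (induction A rule: infinite_finite_induct) (auto simp: coeff_in_add)

lemma coeff_in_single:
  "coeff_in v n (Poly_Mapping.single m c) =
     (if Poly_Mapping.lookup m v = n then Poly_Mapping.single (m - Poly_Mapping.single v n) c else 0)"
proof (rule poly_mapping_eqI)
  fix k
  have "m = k + Poly_Mapping.single v n \<longleftrightarrow>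
      Poly_Mapping.lookup m v = n \<and> m - Poly_Mapping.single v n = k" if "Poly_Mapping.lookup k v = 0"
  proof
    assume "Poly_Mapping.lookup m v = n \<and> m - Poly_Mapping.single v n = k"
    then show "m = k + Poly_Mapping.single v n"
      by (auto intro!: poly_mapping_eqI simp: lookup_add lookup_minus lookup_single when_def)
  qed (use that in \<open>auto simp: lookup_add\<close>)
  moreover have "Poly_Mapping.lookup m v = n \<Longrightarrow> Poly_Mapping.lookup (m - Poly_Mapping.single v n) v = 0"
    by (simp add: lookup_minus)
  ultimately show "Poly_Mapping.lookup (coeff_in v n (Poly_Mapping.single m c)) k =
    Poly_Mapping.lookup (if Poly_Mapping.lookup m v = n
      then Poly_Mapping.single (m - Poly_Mapping.single v n) c else 0) k"
    by (auto simp: lookup_coeff_in lookup_single when_def)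
qed

lemma coeff_in_mult:
  fixes p q :: "('x, 'k::comm_ring_1) mpoly"
  shows "coeff_in v n (p * q) = (\<Sum>i\<le>n. coeff_in v i p * coeff_in v (n - i) q)"
proof -
  have single: "coeff_in v n (Poly_Mapping.single (a + b) (c * d)) =
      (\<Sum>i\<le>n. coeff_in v i (Poly_Mapping.single a c) * coeff_in v (n - i) (Poly_Mapping.single b d))"
    for a b and c d :: 'k
  proof -
    have "(\<Sum>i\<le>n. coeff_in v i (Poly_Mapping.single a c) * coeff_in v (n - i) (Poly_Mapping.single b d)) =
        (\<Sum>i\<le>n. if i = Poly_Mapping.lookup a v then coeff_in v n (Poly_Mapping.single (a + b) (c * d)) else 0)"
    proof (intro sum.cong refl)
      fix i assume i: "i \<in> {..n}"
      have "a - Poly_Mapping.single v i + (b - Poly_Mapping.single v (n - i)) =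
          a + b - Poly_Mapping.single v n"
        if "Poly_Mapping.lookup a v = i" "Poly_Mapping.lookup b v = n - i"
        using that i by (intro poly_mapping_eqI) (auto simp: lookup_add lookup_minus lookup_single when_def)
      then show "coeff_in v i (Poly_Mapping.single a c) * coeff_in v (n - i) (Poly_Mapping.single b d) =
          (if i = Poly_Mapping.lookup a v then coeff_in v n (Poly_Mapping.single (a + b) (c * d)) else 0)"
        using i by (auto simp: coeff_in_single mult_single lookup_add)
    qed
    also have "\<dots> = coeff_in v n (Poly_Mapping.single (a + b) (c * d))"
      by (auto simp: coeff_in_single lookup_add)
    finally show ?thesis by simp
  qed
  let ?s = "\<lambda>p m. Poly_Mapping.single m (Poly_Mapping.lookup p m)"
  have expand: "coeff_in v i p = (\<Sum>m\<in>Poly_Mapping.keys p. coeff_in v i (?s p m))" for i and p :: "('x, 'k) mpoly"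
    unfolding coeff_in_sum[symmetric] by (simp add: poly_mapping_sum_single)
  have "coeff_in v n (p * q) = (\<Sum>a\<in>Poly_Mapping.keys p. \<Sum>b\<in>Poly_Mapping.keys q.
      \<Sum>i\<le>n. coeff_in v i (?s p a) * coeff_in v (n - i) (?s q b))"
    unfolding poly_mapping_mult_sum[of p q] coeff_in_sum single ..
  also have "\<dots> = (\<Sum>a\<in>Poly_Mapping.keys p. \<Sum>i\<le>n. \<Sum>b\<in>Poly_Mapping.keys q.
      coeff_in v i (?s p a) * coeff_in v (n - i) (?s q b))"
    by (intro sum.cong refl sum.swap)
  also have "\<dots> = (\<Sum>i\<le>n. \<Sum>a\<in>Poly_Mapping.keys p. \<Sum>b\<in>Poly_Mapping.keys q.
      coeff_in v i (?s p a) * coeff_in v (n - i) (?s q b))"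
    by (rule sum.swap)
  also have "\<dots> = (\<Sum>i\<le>n. coeff_in v i p * coeff_in v (n - i) q)"
    unfolding sum_product[symmetric] expand[symmetric] ..
  finally show ?thesis .
qed

lemma coeff_in_polys_in: "p \<in> polys_in V \<Longrightarrow> coeff_in v n p \<in> polys_in (V - {v})"
proof -
  assume p: "p \<in> polys_in V"
  have "Poly_Mapping.keys m \<subseteq> V - {v}" if "m \<in> Poly_Mapping.keys (coeff_in v n p)" for m
  proof -
    have "Poly_Mapping.lookup m v = 0" "m + Poly_Mapping.single v n \<in> Poly_Mapping.keys p"
      using that by (auto simp: in_keys_iff lookup_coeff_in split: if_splits)
    then have "v \<notin> Poly_Mapping.keys m" "Poly_Mapping.keys (m + Poly_Mapping.single v n) \<subseteq> V"
      using p by (auto simp: polys_in_def in_keys_iff)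
    then show ?thesis unfolding keys_add_nat by blast
  qed
  then show ?thesis by (simp add: polys_in_def)
qed

lemma coeff_in_eq_0: "exponents_le k p \<Longrightarrow> k < n \<Longrightarrow> coeff_in v n p = 0"
proof (rule poly_mapping_eqI)
  fix m assume "exponents_le k p" "k < n"
  then have "m + Poly_Mapping.single v n \<notin> Poly_Mapping.keys p"
    by (auto simp: exponents_le_def lookup_add dest!: bspec[of _ _ "m + Poly_Mapping.single v n"] spec[of _ v])
  then show "Poly_Mapping.lookup (coeff_in v n p) m = Poly_Mapping.lookup 0 m"
    by (simp add: lookup_coeff_in in_keys_iff)
qed

lemma poly_var_power: "poly_var v ^ n = Poly_Mapping.single (Poly_Mapping.single v n) (1 :: 'k::field)"
proof (induction n)
  case (Suc n)
  then show ?case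
    by (simp add: poly_var_def mult_single single_add[symmetric])
qed simp

lemma poly_eq_sum_coeff_in:
  fixes p :: "('x, 'k::field) mpoly"
  assumes "exponents_le k p"
  shows "p = (\<Sum>n\<le>k. poly_var v ^ n * coeff_in v n p)"
proof (rule poly_mapping_eqI)
  fix m
  have "Poly_Mapping.lookup (poly_var v ^ n * coeff_in v n p) m =
      (if n = Poly_Mapping.lookup m v then Poly_Mapping.lookup p m else 0)" for n
  proof -
    have "Poly_Mapping.keys (poly_var v ^ n * coeff_in v n p) \<subseteq> {m. Poly_Mapping.lookup m v = n}"
      using keys_mult[of "poly_var v ^ n" "coeff_in v n p"]
      by (fastforce simp: poly_var_power lookup_add in_keys_iff lookup_coeff_in split: if_splits)
    moreover have "Poly_Mapping.lookup (poly_var v ^ n * coeff_in v n p) m = Poly_Mapping.lookup p m"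
      if "Poly_Mapping.lookup m v = n"
    proof -
      have m: "m = Poly_Mapping.single v n + (m - Poly_Mapping.single v n)"
        using that by (intro poly_mapping_eqI) (auto simp: lookup_add lookup_minus lookup_single when_def)
      have "Poly_Mapping.lookup (poly_var v ^ n * coeff_in v n p) m =
          Poly_Mapping.lookup (coeff_in v n p) (m - Poly_Mapping.single v n)"
        by (subst m) (simp add: poly_var_power lookup_single_mult)
      also have "\<dots> = Poly_Mapping.lookup p (m - Poly_Mapping.single v n + Poly_Mapping.single v n)"
        using that by (simp add: lookup_coeff_in lookup_minus)
      also have "m - Poly_Mapping.single v n + Poly_Mapping.single v n = m"
        using m by (simp add: add.commute)
      finally show ?thesis .
    qed
    ultimately show ?thesis by (auto simp: in_keys_iff)
  qed
  then have "Poly_Mapping.lookup (\<Sum>n\<le>k. poly_var v ^ n * coeff_in v n p) m =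
      (if Poly_Mapping.lookup m v \<le> k then Poly_Mapping.lookup p m else 0)"
    by (simp add: lookup_sum)
  also have "\<dots> = Poly_Mapping.lookup p m"
    using assms by (auto simp: exponents_le_def in_keys_iff)
  finally show "Poly_Mapping.lookup p m = Poly_Mapping.lookup (\<Sum>n\<le>k. poly_var v ^ n * coeff_in v n p) m" ..
qed

lemma exists_top_coeff_in:
  fixes p :: "('x, 'k::field) mpoly"
  assumes "p \<noteq> 0"
  obtains e where "coeff_in v e p \<noteq> 0" "\<And>n. e < n \<Longrightarrow> coeff_in v n p = 0"
    "p = (\<Sum>n\<le>e. poly_var v ^ n * coeff_in v n p)"
proof -
  obtain k where k: "exponents_le k p" using exists_exponents_le by blast
  let ?A = "{n. coeff_in v n p \<noteq> 0}"
  have "?A \<subseteq> {..k}" using coeff_in_eq_0[OF k] by (auto simp: not_less[symmetric])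
  then have fin: "finite ?A" using finite_subset by blast
  have ne: "?A \<noteq> {}"
  proof
    assume "?A = {}"
    then have "(\<Sum>n\<le>k. poly_var v ^ n * coeff_in v n p) = 0" by simp
    then show False using poly_eq_sum_coeff_in[OF k, of v] assms by simp
  qed
  define e where "e = Max ?A"
  have e: "coeff_in v e p \<noteq> 0" using Max_in[OF fin ne] by (simp add: e_def)
  have above: "coeff_in v n p = 0" if "e < n" for n
    using that Max_ge[OF fin, of n] by (auto simp: e_def)
  have "e \<le> k" using e coeff_in_eq_0[OF k] by (meson not_less)
  then have "(\<Sum>n\<le>k. poly_var v ^ n * coeff_in v n p) = (\<Sum>n\<le>e. poly_var v ^ n * coeff_in v n p)"
    using above by (intro sum.mono_neutral_right) auto
  then have "p = (\<Sum>n\<le>e. poly_var v ^ n * coeff_in v n p)"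
    using poly_eq_sum_coeff_in[OF k, of v] by simp
  with e above show thesis by (rule that)
qed

section \<open>The Nullstellensatz for maximal ideals\<close>

text \<open>For finite W, the preimage of the D-submodule of R/N generated by W.\<close>

definition span_mod :: "'a::comm_ring_1 set \<Rightarrow> 'a set \<Rightarrow> 'a set \<Rightarrow> 'a set" where
  "span_mod N D W = {p. \<exists>d. (\<forall>w\<in>W. d w \<in> D) \<and> p - (\<Sum>w\<in>W. d w * w) \<in> N}"

text \<open>As D contains N, it is the full preimage of a subring of the field R/N.\<close>

locale coefficient_ring_mod =
  fixes N D :: "'a::comm_ring_1 set"
  assumes N: "maximal_set N"
    and N_subset: "N \<subseteq> D" and one: "1 \<in> D"
    and add: "a \<in> D \<Longrightarrow> b \<in> D \<Longrightarrow> a + b \<in> D"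
    and uminus: "a \<in> D \<Longrightarrow> - a \<in> D"
    and mult: "a \<in> D \<Longrightarrow> b \<in> D \<Longrightarrow> a * b \<in> D"
begin

lemma ideal_N: "ring_ideal N"
  using N by (simp add: maximal_set_def)

lemma zero: "0 \<in> D"
  using N_subset ring_ideal_zero[OF ideal_N] by blast

lemma span_mod_N: "n \<in> N \<Longrightarrow> n \<in> span_mod N D W"
  unfolding span_mod_def by (auto intro!: exI[of _ "\<lambda>_. 0"] simp: zero)

lemma span_mod_add:
  assumes "p \<in> span_mod N D W" "q \<in> span_mod N D W" shows "p + q \<in> span_mod N D W"
proof -
  obtain d d' where "\<forall>w\<in>W. d w \<in> D" "p - (\<Sum>w\<in>W. d w * w) \<in> N"
      "\<forall>w\<in>W. d' w \<in> D" "q - (\<Sum>w\<in>W. d' w * w) \<in> N"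
    using assms by (auto simp: span_mod_def)
  moreover from this have "(p - (\<Sum>w\<in>W. d w * w)) + (q - (\<Sum>w\<in>W. d' w * w)) \<in> N"
    by (intro ring_ideal_add[OF ideal_N])
  ultimately show ?thesis
    unfolding span_mod_def
    by (intro CollectI exI[of _ "\<lambda>w. d w + d' w"])
      (auto simp: add distrib_right sum.distrib algebra_simps)
qed

lemma span_mod_mult:
  assumes "a \<in> D" "p \<in> span_mod N D W" shows "a * p \<in> span_mod N D W"
proof -
  obtain d where d: "\<forall>w\<in>W. d w \<in> D" "p - (\<Sum>w\<in>W. d w * w) \<in> N"
    using assms by (auto simp: span_mod_def)
  have "a * (p - (\<Sum>w\<in>W. d w * w)) \<in> N"
    by (intro ring_ideal_mult_left[OF ideal_N] d)
  then show ?thesis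
    using d(1) assms(1) unfolding span_mod_def
    by (intro CollectI exI[of _ "\<lambda>w. a * d w"])
      (auto simp: mult right_diff_distrib sum_distrib_left mult.assoc)
qed

lemma span_mod_base:
  assumes "finite W" "w \<in> W" shows "w \<in> span_mod N D W"
proof -
  have "(\<Sum>x\<in>W. (if x = w then 1 else 0) * x) = (\<Sum>x\<in>W. if x = w then w else 0)"
    by (intro sum.cong) auto
  also have "\<dots> = w" using assms by simp
  finally show ?thesis
    unfolding span_mod_def
    by (intro CollectI exI[of _ "\<lambda>x. if x = w then 1 else 0"])
      (auto simp: zero one ring_ideal_zero[OF ideal_N])
qed

lemma span_mod_sum:
  "(\<And>i. i \<in> A \<Longrightarrow> f i \<in> span_mod N D W) \<Longrightarrow> sum f A \<in> span_mod N D W"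
  by (induction A rule: infinite_finite_induct)
    (auto intro: span_mod_add span_mod_N ring_ideal_zero[OF ideal_N])

lemma span_mod_cong: "p - q \<in> N \<Longrightarrow> q \<in> span_mod N D W \<Longrightarrow> p \<in> span_mod N D W"
  using span_mod_add[OF span_mod_N[of "p - q"]] by fastforce

lemma span_mod_transfer:
  assumes "p \<in> span_mod N D W" "\<And>w. w \<in> W \<Longrightarrow> x * w \<in> span_mod N D W'"
  shows "x * p \<in> span_mod N D W'"
proof -
  obtain d where d: "\<forall>w\<in>W. d w \<in> D" "p - (\<Sum>w\<in>W. d w * w) \<in> N"
    using assms by (auto simp: span_mod_def)
  have "(\<Sum>w\<in>W. d w * (x * w)) \<in> span_mod N D W'"
    by (rule span_mod_sum, rule span_mod_mult) (use d assms(2) in auto)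
  moreover have "x * (p - (\<Sum>w\<in>W. d w * w)) \<in> N"
    by (intro ring_ideal_mult_left[OF ideal_N] d)
  then have "x * p - (\<Sum>w\<in>W. d w * (x * w)) \<in> N"
    by (simp add: right_diff_distrib sum_distrib_left mult.left_commute)
  ultimately show ?thesis by (rule span_mod_cong[rotated])
qed

text \<open>If the field \<open>R/N\<close> is a finite module over the image of \<open>D\<close>, then that image is a field:
  take a spanning set of minimal size.\<close>

lemma exists_inverse_in_D:
  assumes W: "finite W" "span_mod N D W = UNIV" and u: "u \<in> D" "u \<notin> N"
  shows "\<exists>d\<in>D. u * d - 1 \<in> N"
  using W
proof (induction "card W" arbitrary: W rule: less_induct)
  case less
  have "1 \<notin> span_mod N D {}"
    using N by (simp add: span_mod_def maximal_set_def)
  then obtain w0 where w0: "w0 \<in> W" using less.prems by fastforce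
  obtain v where v: "v * u - 1 \<in> N" using N u by (auto simp: maximal_set_def)
  have "v * w0 \<in> span_mod N D W" using less.prems by simp
  then obtain d where d: "\<forall>w\<in>W. d w \<in> D" "v * w0 - (\<Sum>w\<in>W. d w * w) \<in> N"
    by (auto simp: span_mod_def)
  \<comment> \<open>Multiplying the expression for w0 / u by u puts this multiple of w0 into the
    span of the other elements. If it is zero modulo N, then \<open>d w0\<close> inverts u.
    Otherwise it is invertible in R/N, every element is a multiple of it, and
    \<open>W - {w0}\<close> already spans.\<close>
  define \<kappa> where "\<kappa> = 1 - u * d w0"
  show ?case
  proof (cases "\<kappa> \<in> N")
    case True
    then have "u * d w0 - 1 \<in> N" using ring_ideal_uminus[OF ideal_N True] by (simp add: \<kappa>_def)
    then show ?thesis using d w0 by blast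
  next
    case False
    then obtain s where s: "s * \<kappa> - 1 \<in> N" using N by (auto simp: maximal_set_def)
    have "\<kappa> * w0 \<in> span_mod N D (W - {w0})"
    proof (rule span_mod_cong)
      have split: "(\<Sum>w\<in>W. d w * w) = d w0 * w0 + (\<Sum>w\<in>W - {w0}. d w * w)"
        using less.prems(1) w0 by (rule sum.remove)
      have "\<kappa> * w0 - u * (\<Sum>w\<in>W - {w0}. d w * w) =
          u * (v * w0 - (\<Sum>w\<in>W. d w * w)) - w0 * (v * u - 1)"
        unfolding \<kappa>_def split by (simp add: algebra_simps)
      also have "\<dots> \<in> N"
        by (intro ring_ideal_diff[OF ideal_N] ring_ideal_mult_left[OF ideal_N] d v)
      finally show "\<kappa> * w0 - u * (\<Sum>w\<in>W - {w0}. d w * w) \<in> N" .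
      show "u * (\<Sum>w\<in>W - {w0}. d w * w) \<in> span_mod N D (W - {w0})"
        using less.prems(1) d(1) by (intro span_mod_mult u span_mod_sum span_mod_base) auto
    qed
    moreover have "\<kappa> \<in> D"
      using add[OF one uminus[OF mult[OF u(1)]]] d(1) w0 by (simp add: \<kappa>_def)
    ultimately have gen: "\<kappa> * w \<in> span_mod N D (W - {w0})" if "w \<in> W" for w
      using that less.prems(1) by (cases "w = w0") (auto intro: span_mod_mult span_mod_base)
    have "p \<in> span_mod N D (W - {w0})" for p
    proof (rule span_mod_cong)
      show "\<kappa> * (s * p) \<in> span_mod N D (W - {w0})"
        by (rule span_mod_transfer[OF _ gen, of _ W]) (use less.prems in auto)
      have "p - \<kappa> * (s * p) = - (p * (s * \<kappa> - 1))"
        by (simp add: algebra_simps)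
      also have "\<dots> \<in> N"
        by (intro ring_ideal_uminus[OF ideal_N] ring_ideal_mult_left[OF ideal_N] s)
      finally show "p - \<kappa> * (s * p) \<in> N" .
    qed
    then have "span_mod N D (W - {w0}) = UNIV" by blast
    moreover have "card (W - {w0}) < card W"
      using less.prems(1) w0 by (rule card_Diff1_less)
    ultimately show ?thesis
      using less.hyps[of "W - {w0}"] less.prems(1) by blast
  qed
qed

end

lemma keys_poly_var_mult_nonzero:
  fixes g :: "('x, 'k::field) mpoly"
  shows "m \<in> Poly_Mapping.keys (poly_var v * g) \<Longrightarrow> m \<noteq> 0"
  by (auto simp: keys_poly_var_mult plus_poly_mapping.rep_eq dest: arg_cong[of _ _ Poly_Mapping.keys]
      simp: keys_add_nat)

text \<open>Leading monomials add up, so a unit would have leading monomial 0; but the product of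
  the variable with g contributes a nonzero monomial, which is never below 0.\<close>

lemma one_plus_var_mult_not_unit:
  fixes g c :: "('x, 'k::field) mpoly"
  assumes V: "finite V" "v \<in> V" and g: "g \<in> polys_in V" "g \<noteq> 0"
  shows "(1 + poly_var v * g) * c \<noteq> 1"
proof
  let ?u = "1 + poly_var v * g"
  assume "?u * c = 1"
  moreover have u: "?u \<in> polys_in V"
    using V g by (intro polys_in_add polys_in_one polys_in_mult polys_in_poly_var)
  moreover have "restrict_vars V (1 :: ('x, 'k) mpoly) = 1" by (rule restrict_id) simp
  ultimately have uc: "?u * restrict_vars V c = 1"
    using restrict_mult[of V ?u c] restrict_id[OF u] by simp
  obtain k where k: "k \<in> Poly_Mapping.keys g" using g(2) by (metis all_not_in_conv keys_eq_empty)
  let ?k = "Poly_Mapping.single v 1 + k"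
  have "?k \<in> Poly_Mapping.keys (poly_var v * g)" using k by (simp add: keys_poly_var_mult)
  moreover from this have "?k \<noteq> 0" by (rule keys_poly_var_mult_nonzero)
  ultimately have ku: "?k \<in> Poly_Mapping.keys ?u"
    by (simp add: in_keys_iff lookup_add lookup_one)
  obtain vs where vs: "set vs = V" using finite_list[OF V(1)] by blast
  have "?u \<noteq> 0" "restrict_vars V c \<noteq> 0" using uc by auto
  then obtain m n where mn: "leading vs ?u m" "leading vs (restrict_vars V c) n"
    using exists_leading u restrict_in vs by metis
  have "m + n = 0" using leading_mult(1)[OF mn] uc by (simp add: leading_def)
  then have "m = 0" using keys_add_nat[of m n] by auto
  moreover have "\<not> lex_less vs ?k 0" by (induction vs) auto
  ultimately show False using mn(1) ku \<open>?k \<noteq> 0\<close> by (auto simp: leading_def)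
qed

text \<open>Zariski's lemma. For a maximal set B of variables independent modulo N, the field R/N is
  finite over a localisation k[B][1/G], which is then a field itself. For y in B the element 1 + y G
  is not invertible there, so B is empty and every single variable satisfies a relation.\<close>

lemma exists_univariate_in_maximal:
  fixes N :: "('x, 'k::field) mpoly set"
  assumes V: "finite V" and maxN: "maximal_set N" "face_prime V \<subseteq> N" and "v0 \<in> V"
  shows "\<exists>q\<in>polys_in {v0} \<inter> N. q \<noteq> 0"
proof -
  have idN: "ring_ideal N" and one_N: "1 \<notin> N" using maxN(1) by (auto simp: maximal_set_def)
  have primeN: "a \<in> N \<or> b \<in> N" if "a * b \<in> N" for a b
    using maximal_set_imp_prime_set[OF maxN(1)] that by (auto simp: prime_set_def)
  \<comment> \<open>Sets of variables that stay algebraically independent modulo N.\<close>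
  define ind where "ind B \<longleftrightarrow> B \<subseteq> V \<and> polys_in B \<inter> N = {0}" for B
  have "ind {}"
  proof -
    have "p = 0" if "p \<in> polys_in {}" "p \<in> N" for p
    proof (rule ccontr)
      assume "p \<noteq> 0"
      have p: "p = const (Poly_Mapping.lookup p 0)"
        using that(1) by (intro poly_mapping_eqI) (auto simp: polys_in_def lookup_single when_def in_keys_iff)
      then have "Poly_Mapping.lookup p 0 \<noteq> 0" using \<open>p \<noteq> 0\<close> by auto
      then have "const (inverse (Poly_Mapping.lookup p 0)) * p = 1"
        by (subst p) (simp add: mult_single)
      then show False using ring_ideal_mult_left[OF idN that(2)] one_N by metis
    qed
    then show ?thesis using ring_ideal_zero[OF idN] by (auto simp: ind_def)
  qed
  moreover have "finite {B. ind B}"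
    by (rule finite_subset[of _ "Pow V"]) (use V in \<open>auto simp: ind_def\<close>)
  ultimately obtain B where B: "ind B" "\<And>B'. ind B' \<Longrightarrow> B \<subseteq> B' \<Longrightarrow> B' = B"
    using finite_has_maximal2[of "{B. ind B}" "{}"] by auto
  have BV: "B \<subseteq> V" and BN: "\<And>p. p \<in> polys_in B \<Longrightarrow> p \<in> N \<Longrightarrow> p = 0"
    using B(1) by (auto simp: ind_def)
  have dep: "\<exists>r\<in>polys_in (insert v B) \<inter> N. r \<noteq> 0" if "v \<in> V - B" for v
  proof (rule ccontr)
    assume "\<not> ?thesis"
    then have "ind (insert v B)"
      using that BV ring_ideal_zero[OF idN] by (auto simp: ind_def)
    then show False using B(2) that by blast
  qed
  have "B = {}"
  proof (rule ccontr)
    assume "B \<noteq> {}"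
    then obtain y where y: "y \<in> B" by blast
    have "\<exists>r e. r \<in> N \<and> coeff_in v e r \<noteq> 0 \<and> (\<forall>n. coeff_in v n r \<in> polys_in B) \<and>
        r = (\<Sum>n\<le>e. poly_var v ^ n * coeff_in v n r)" if v: "v \<in> V - B" for v
    proof -
      obtain r where r: "r \<in> polys_in (insert v B)" "r \<in> N" "r \<noteq> 0" using dep[OF v] by blast
      have "insert v B - {v} = B" using v by blast
      then have "coeff_in v n r \<in> polys_in B" for n
        using coeff_in_polys_in[OF r(1), of v n] by simp
      moreover obtain e where "coeff_in v e r \<noteq> 0" "r = (\<Sum>n\<le>e. poly_var v ^ n * coeff_in v n r)"
        using exists_top_coeff_in[OF r(3), of v] by metis
      ultimately show ?thesis using r(2) by blast
    qed
    then have "\<forall>v\<in>V - B. \<exists>r. \<exists>e. r \<in> N \<and> coeff_in v e r \<noteq> 0 \<and> (\<forall>n. coeff_in v n r \<in> polys_in B) \<and>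
        r = (\<Sum>n\<le>e. poly_var v ^ n * coeff_in v n r)" by blast
    from bchoice[OF this] obtain r where "\<forall>v\<in>V - B. \<exists>e. r v \<in> N \<and> coeff_in v e (r v) \<noteq> 0 \<and>
        (\<forall>n. coeff_in v n (r v) \<in> polys_in B) \<and> r v = (\<Sum>n\<le>e. poly_var v ^ n * coeff_in v n (r v))"
      by blast
    from bchoice[OF this] obtain e where *: "\<forall>v\<in>V - B. r v \<in> N \<and> coeff_in v (e v) (r v) \<noteq> 0 \<and>
        (\<forall>n. coeff_in v n (r v) \<in> polys_in B) \<and> r v = (\<Sum>n\<le>e v. poly_var v ^ n * coeff_in v n (r v))"
      by blast
    have r: "\<And>v. v \<in> V - B \<Longrightarrow> r v \<in> N"
      "\<And>v. v \<in> V - B \<Longrightarrow> coeff_in v (e v) (r v) \<noteq> 0"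
      "\<And>v n. v \<in> V - B \<Longrightarrow> coeff_in v n (r v) \<in> polys_in B"
      "\<And>v. v \<in> V - B \<Longrightarrow> r v = (\<Sum>n\<le>e v. poly_var v ^ n * coeff_in v n (r v))"
      using * by blast+
    define g where "g v = coeff_in v (e v) (r v)" for v
    \<comment> \<open>Product of the leading coefficients of the relations: inverting it makes all
      remaining variables integral over k[B] modulo N.\<close>
    define G where "G = (\<Prod>v\<in>V - B. g v)"
    have gB: "g v \<in> polys_in B" "g v \<notin> N" if "v \<in> V - B" for v
      using r(2,3)[OF that] BN by (auto simp: g_def)
    have GB: "G \<in> polys_in B" unfolding G_def by (intro polys_in_prod gB)
    have "(\<Prod>v\<in>U. g v) \<notin> N" if "U \<subseteq> V - B" "finite U" for U
      using that(2,1) by (induction U rule: finite_induct) (use one_N primeN gB in auto)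
    then have GN: "G \<notin> N" using V by (simp add: G_def)
    then obtain t where t: "t * G - 1 \<in> N" using maxN(1) by (auto simp: maximal_set_def)
    \<comment> \<open>The preimage of k[B][1/G] under R -> R/N.\<close>
    define D where "D = {p. \<exists>n. \<exists>b\<in>polys_in B. G ^ n * p - b \<in> N}"
    have D_I: "p \<in> D" if "b \<in> polys_in B" "G ^ n * p - b \<in> N" for p b n
      using that by (auto simp: D_def)
    have D_B: "p \<in> D" if "p \<in> polys_in B" for p
      by (rule D_I[OF that, of 0]) (simp add: ring_ideal_zero[OF idN])
    interpret coefficient_ring_mod N D
    proof
      show "maximal_set N" by (rule maxN)
      show "N \<subseteq> D"
        using D_I[of 0 0] by auto
      show "1 \<in> D" by (rule D_B) simp
      fix a b assume "a \<in> D" "b \<in> D"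
      then obtain m n a' b' where ab: "a' \<in> polys_in B" "G ^ m * a - a' \<in> N"
        "b' \<in> polys_in B" "G ^ n * b - b' \<in> N" by (auto simp: D_def)
      show "- a \<in> D"
        by (rule D_I[OF polys_in_uminus[OF ab(1)], of m])
          (use ring_ideal_uminus[OF idN ab(2)] in simp)
      have "G ^ (m + n) * (a + b) - (G ^ n * a' + G ^ m * b') =
          G ^ n * (G ^ m * a - a') + G ^ m * (G ^ n * b - b')"
        by (simp add: power_add algebra_simps)
      also have "\<dots> \<in> N" by (intro ring_ideal_add[OF idN] ring_ideal_mult_left[OF idN] ab)
      finally show "a + b \<in> D"
        by (rule D_I[rotated]) (intro polys_in_add polys_in_mult polys_in_power GB ab)
      have "G ^ (m + n) * (a * b) - a' * b' =
          (G ^ n * b) * (G ^ m * a - a') + a' * (G ^ n * b - b')"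
        by (simp add: power_add algebra_simps)
      also have "\<dots> \<in> N" by (intro ring_ideal_add[OF idN] ring_ideal_mult_left[OF idN] ab)
      finally show "a * b \<in> D"
        by (rule D_I[rotated]) (intro polys_in_mult ab)
    qed
    have tD: "t \<in> D" by (rule D_I[of 1 1]) (use t in \<open>simp_all add: mult.commute\<close>)
    have inv: "\<exists>h\<in>D. h * g v - 1 \<in> N" if v: "v \<in> V - B" for v
    proof (rule bexI)
      have "G = g v * (\<Prod>w\<in>V - B - {v}. g w)"
        unfolding G_def using V v by (intro prod.remove) auto
      then show "t * (\<Prod>w\<in>V - B - {v}. g w) * g v - 1 \<in> N"
        using t by (simp add: mult_ac)
      show "t * (\<Prod>w\<in>V - B - {v}. g w) \<in> D"
        by (intro mult tD D_B polys_in_prod gB) auto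
    qed
    \<comment> \<open>Variables are adjoined one at a time. Once its leading coefficient is
      inverted, the relation of v reduces x^(e v), so the powers below \<open>e v\<close> times the
      old generators suffice.\<close>
    have "\<exists>W. finite W \<and> polys_in (B \<union> U) \<subseteq> span_mod N D W" if "finite U" "U \<subseteq> V - B" for U
      using that
    proof (induction U rule: finite_induct)
      case empty
      have "p \<in> span_mod N D {1}" if "p \<in> polys_in B" for p
        using span_mod_mult[OF D_B[OF that], of 1 "{1}"] span_mod_base[of "{1}" 1] by simp
      then show ?case by (intro exI[of _ "{1}"]) auto
    next
      case (insert v U)
      then have v: "v \<in> V - B" by auto
      obtain W where W: "finite W" "polys_in (B \<union> U) \<subseteq> span_mod N D W" using insert by auto
      define x :: "('x, 'k) mpoly" where "x = poly_var v"
      define W' where "W' = (\<lambda>(j, w). x ^ j * w) ` ({..<e v} \<times> W)"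
      have W': "finite W'" using W by (simp add: W'_def)
      have base: "x ^ j * w \<in> span_mod N D W'" if "j < e v" "w \<in> W" for j w
        using W' that by (intro span_mod_base) (auto simp: W'_def)
      have rv: "(\<Sum>n<e v. x ^ n * coeff_in v n (r v)) + x ^ e v * g v \<in> N"
        using r(1)[OF v] r(4)[OF v] by (simp add: x_def g_def lessThan_Suc_atMost[symmetric])
      have "e v \<noteq> 0"
        using rv gB(2)[OF v] by (intro notI) simp
      obtain h where h: "h \<in> D" "h * g v - 1 \<in> N" using inv[OF v] by blast
      have top: "x ^ e v * w \<in> span_mod N D W'" if w: "w \<in> W" for w
      proof (rule span_mod_cong)
        define q where "q = (\<Sum>n<e v. x ^ n * coeff_in v n (r v))"
        have "x ^ e v * w - (- h * (q * w)) =
            (h * w) * (q + x ^ e v * g v) - (x ^ e v * w) * (h * g v - 1)"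
          by (simp add: algebra_simps)
        also have "\<dots> \<in> N"
          using rv by (intro ring_ideal_diff[OF idN] ring_ideal_mult_left[OF idN] h) (simp add: q_def)
        finally show "x ^ e v * w - (- h * (q * w)) \<in> N" .
        have "q * w = (\<Sum>n<e v. coeff_in v n (r v) * (x ^ n * w))"
          unfolding q_def sum_distrib_right by (intro sum.cong) (simp_all add: mult_ac)
        also have "\<dots> \<in> span_mod N D W'"
          using r(3)[OF v] w by (intro span_mod_sum span_mod_mult D_B base) auto
        finally show "- h * (q * w) \<in> span_mod N D W'"
          by (rule span_mod_mult[OF uminus[OF h(1)]])
      qed
      have step: "x * p \<in> span_mod N D W'" if "p \<in> span_mod N D W'" for p
        using that
      proof (rule span_mod_transfer)
        fix w' assume "w' \<in> W'"
        then obtain j w where jw: "j < e v" "w \<in> W" "w' = x ^ j * w" by (auto simp: W'_def)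
        then have eq: "x * w' = x ^ Suc j * w" by (simp add: mult.assoc)
        show "x * w' \<in> span_mod N D W'"
          unfolding eq using base[of "Suc j" w] top[of w] jw by (cases "Suc j = e v") auto
      qed
      have W_W': "p \<in> span_mod N D W'" if "p \<in> span_mod N D W" for p
        using span_mod_transfer[of p W 1 W'] that base[of 0] \<open>e v \<noteq> 0\<close> by auto
      have pow: "x ^ n * p \<in> span_mod N D W'" if "p \<in> span_mod N D W'" for n p
        by (induction n) (use that step in \<open>auto simp: mult.assoc\<close>)
      have "p \<in> span_mod N D W'" if p: "p \<in> polys_in (B \<union> insert v U)" for p
      proof -
        obtain k where k: "exponents_le k p" using exists_exponents_le by blast
        have sub: "B \<union> insert v U - {v} \<subseteq> B \<union> U" by blast
        have "coeff_in v n p \<in> span_mod N D W'" for n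
          using coeff_in_polys_in[OF p, of v n] polys_in_mono[OF sub] W(2) W_W' by blast
        then have "(\<Sum>n\<le>k. poly_var v ^ n * coeff_in v n p) \<in> span_mod N D W'"
          unfolding x_def[symmetric] by (intro span_mod_sum pow)
        then show ?thesis using poly_eq_sum_coeff_in[OF k, of v] by simp
      qed
      then show ?case using W' by blast
    qed
    from this[of "V - B"] obtain W where W: "finite W" "polys_in V \<subseteq> span_mod N D W"
      using V BV by (auto simp: Un_absorb1)
    have "span_mod N D W = UNIV"
    proof -
      have "p \<in> span_mod N D W" for p
      proof (rule span_mod_cong)
        show "p - restrict_vars V p \<in> N" using diff_restrict_in_face_prime maxN(2) by blast
        show "restrict_vars V p \<in> span_mod N D W" using restrict_in W(2) by blast
      qed
      then show ?thesis by blast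
    qed
    \<comment> \<open>Euclid's choice: u is a nonunit of k[B] that is congruent to 1 modulo G, so no
      power of G can be a multiple of u.\<close>
    define u where "u = 1 + poly_var y * G"
    have uB: "u \<in> polys_in B"
      unfolding u_def by (intro polys_in_add polys_in_one polys_in_mult polys_in_poly_var y GB)
    have fB: "finite B" using V BV finite_subset by blast
    have G0: "G \<noteq> 0" using GN ring_ideal_zero[OF idN] by auto
    have no_unit: "u * c \<noteq> 1" for c
      unfolding u_def by (rule one_plus_var_mult_not_unit[OF fB y GB G0])
    have "u \<notin> N"
    proof
      assume "u \<in> N"
      then have "u = 0" using BN uB by blast
      then have "Poly_Mapping.lookup (poly_var y * G) 0 \<noteq> 0"
        by (simp add: u_def add_eq_0_iff lookup_uminus)
      then show False using keys_poly_var_mult_nonzero[of 0 y G] by (auto simp: in_keys_iff)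
    qed
    then obtain d where d: "d \<in> D" "u * d - 1 \<in> N"
      using exists_inverse_in_D[OF W(1) \<open>span_mod N D W = UNIV\<close> D_B[OF uB]] by blast
    then obtain n b where b: "b \<in> polys_in B" "G ^ n * d - b \<in> N" by (auto simp: D_def)
    have "G ^ n - u * b = u * (G ^ n * d - b) - G ^ n * (u * d - 1)"
      by (simp add: algebra_simps)
    also have "\<dots> \<in> N" by (intro ring_ideal_diff[OF idN] ring_ideal_mult_left[OF idN] d b)
    finally have "G ^ n - u * b = 0"
      by (intro BN polys_in_diff polys_in_mult polys_in_power GB uB b)
    then have Gn: "G ^ n = u * b" by simp
    \<comment> \<open>Modulo u one has y G = -1. If u divides G^n, it therefore divides (1 - u)^n,
      and since it also divides 1 - (1 - u)^n it would be a unit.\<close>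
    have "\<exists>c. 1 - (1 - u) ^ n = u * c" for n
    proof (induction n)
      case (Suc n)
      then obtain c where "1 - (1 - u) ^ n = u * c" by blast
      then have "1 - (1 - u) ^ Suc n = u * (c + (1 - u) ^ n)"
        by (simp add: algebra_simps)
      then show ?case by blast
    qed (auto intro: exI[of _ 0])
    then obtain c where "1 - (1 - u) ^ n = u * c" by blast
    moreover have "(1 - u) ^ n = u * ((- poly_var y) ^ n * b)"
    proof -
      have "1 - u = - poly_var y * G" by (simp add: u_def)
      then have "(1 - u) ^ n = (- poly_var y) ^ n * G ^ n" by (simp only: power_mult_distrib)
      then show ?thesis unfolding Gn by (simp only: mult_ac)
    qed
    ultimately have "u * (c + (- poly_var y) ^ n * b) = 1"
      by (simp add: distrib_left diff_eq_eq)
    then show False using no_unit by blast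
  qed
  then show ?thesis using dep[of v0] assms(4) by auto
qed

section \<open>Regular sequences of complete homogeneous polynomials\<close>

lemma nonzerodivisor_mod_cong:
  assumes J: "ring_ideal J" and "f - f' \<in> J"
  shows "nonzerodivisor_mod J f \<longleftrightarrow> nonzerodivisor_mod J f'"
proof -
  have "f * b - f' * b \<in> J" for b
    using ring_ideal_mult_right[OF assms, of b] by (simp add: left_diff_distrib)
  then have "f * b \<in> J \<longleftrightarrow> f' * b \<in> J" for b by (rule ring_ideal_diff_cancel[OF J])
  then show ?thesis by (simp add: nonzerodivisor_mod_def)
qed

lemma ideal_adjoin_cong:
  assumes J: "ring_ideal J" and "f - f' \<in> J"
  shows "ideal_adjoin J f = ideal_adjoin J f'"
proof -
  have "ideal_adjoin J f \<subseteq> ideal_adjoin J f'" if "f - f' \<in> J" for f f'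
  proof (intro ideal_adjoin_subset ring_ideal_adjoin J subset_ideal_adjoin)
    show "f \<in> ideal_adjoin J f'" by (rule ideal_adjoinI[OF that, of _ _ 1]) simp
  qed
  moreover have "f' - f \<in> J" using ring_ideal_uminus[OF assms] by simp
  ultimately show ?thesis using assms(2) by blast
qed

lemma weakly_regular_cong:
  assumes "ring_ideal J" "list_all2 (\<lambda>f f'. f - f' \<in> J) fs fs'"
  shows "weakly_regular J fs \<longleftrightarrow> weakly_regular J fs'"
  using assms
proof (induction fs arbitrary: J fs')
  case (Cons f fs)
  then obtain f' gs where fs': "fs' = f' # gs" and f: "f - f' \<in> J"
    and gs: "list_all2 (\<lambda>f f'. f - f' \<in> J) fs gs"
    by (auto simp: list_all2_Cons1)
  have gs': "list_all2 (\<lambda>g g'. g - g' \<in> ideal_adjoin J f) fs gs"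
    using gs by (rule list_all2_mono) (use subset_ideal_adjoin in blast)
  have "weakly_regular (ideal_adjoin J f) fs \<longleftrightarrow> weakly_regular (ideal_adjoin J f) gs"
    by (intro Cons.IH ring_ideal_adjoin Cons.prems gs')
  then show ?case
    using nonzerodivisor_mod_cong[OF Cons.prems(1) f] ideal_adjoin_cong[OF Cons.prems(1) f]
    by (simp add: fs')
qed auto

text \<open>The sum of all monomials of degree n in the listed arguments, sorted by whether w
  occurs. The second summand keeps w as an argument, which the telescoping below exploits.\<close>

fun complete_homogeneous :: "nat \<Rightarrow> 'a::comm_ring_1 list \<Rightarrow> 'a" where
  "complete_homogeneous 0 ws = 1"
| "complete_homogeneous (Suc n) [] = 0"
| "complete_homogeneous (Suc n) (w # ws) =
     complete_homogeneous (Suc n) ws + w * complete_homogeneous n (w # ws)"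

lemma complete_homogeneous_mem:
  assumes "ring_ideal N" "set ws \<subseteq> N"
  shows "complete_homogeneous (Suc n) ws \<in> N"
  using assms(2)
proof (induction ws)
  case (Cons w ws)
  then show ?case
    by (auto intro!: ring_ideal_add[OF assms(1)] ring_ideal_mult_right[OF assms(1)])
qed (simp add: ring_ideal_zero[OF assms(1)])

text \<open>Setting arguments to zero leaves the complete homogeneous polynomial of the others; this
  is what makes one sequence serve all facets.\<close>

lemma complete_homogeneous_filter:
  assumes J: "ring_ideal J" and "\<And>v. v \<in> set vs \<Longrightarrow> \<not> P v \<Longrightarrow> Q v \<in> J"
  shows "complete_homogeneous n (map Q vs) - complete_homogeneous n (map Q (filter P vs)) \<in> J"
  using assms(2)
proof (induction vs arbitrary: n)
  case (Cons v vs)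
  show ?case
  proof (induction n)
    case (Suc n)
    have IH: "complete_homogeneous (Suc n) (map Q vs) -
        complete_homogeneous (Suc n) (map Q (filter P vs)) \<in> J"
      using Cons by simp
    show ?case
    proof (cases "P v")
      case True
      have "Q v * (complete_homogeneous n (map Q (v # vs)) -
          complete_homogeneous n (map Q (filter P (v # vs)))) \<in> J"
        by (rule ring_ideal_mult_left[OF J Suc])
      from ring_ideal_add[OF J IH this] show ?thesis
        using True by (simp add: algebra_simps)
    next
      case False
      then have "Q v * complete_homogeneous n (map Q (v # vs)) \<in> J"
        using Cons.prems by (intro ring_ideal_mult_right[OF J]) auto
      from ring_ideal_add[OF J IH this] show ?thesis
        using False by (simp add: algebra_simps)
    qed
  qed (simp add: ring_ideal_zero[OF J])
qed (simp add: ring_ideal_zero[OF J])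

lemma complete_homogeneous_in:
  fixes ws :: "('x, 'k::comm_ring_1) mpoly list"
  shows "set ws \<subseteq> polys_in V \<Longrightarrow> complete_homogeneous n ws \<in> polys_in V"
  by (induction n ws rule: complete_homogeneous.induct) (auto intro: polys_in_add polys_in_mult)

text \<open>Holds for the ideals generated by polynomials not involving \<open>v\<close>.\<close>

definition coeff_closed :: "'x \<Rightarrow> ('x, 'k::comm_ring_1) mpoly set \<Rightarrow> bool" where
  "coeff_closed v J \<longleftrightarrow> (\<forall>p\<in>J. \<forall>n. coeff_in v n p \<in> J)"

lemma coeff_closed_face_prime:
  assumes "v \<in> F" shows "coeff_closed v (face_prime F :: ('x, 'k::comm_ring_1) mpoly set)"
  unfolding coeff_closed_def face_prime_def
proof (intro ballI allI CollectI)
  fix p :: "('x, 'k) mpoly" and n m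
  assume p: "p \<in> {p. \<forall>m\<in>Poly_Mapping.keys p. \<not> Poly_Mapping.keys m \<subseteq> F}"
    and "m \<in> Poly_Mapping.keys (coeff_in v n p)"
  then have "m + Poly_Mapping.single v n \<in> Poly_Mapping.keys p"
    by (auto simp: in_keys_iff lookup_coeff_in split: if_splits)
  then have "\<not> Poly_Mapping.keys (m + Poly_Mapping.single v n) \<subseteq> F" using p by blast
  then show "\<not> Poly_Mapping.keys m \<subseteq> F"
    using assms unfolding keys_add_nat by (auto split: if_splits)
qed

lemma coeff_in_free:
  fixes f :: "('x, 'k::comm_ring_1) mpoly"
  assumes "f \<in> polys_in (- {v})"
  shows "coeff_in v n f = (if n = 0 then f else 0)"
proof (rule poly_mapping_eqI)
  fix m
  have free: "Poly_Mapping.lookup f k = 0" if "Poly_Mapping.lookup k v \<noteq> 0" for k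
  proof (rule ccontr)
    assume "Poly_Mapping.lookup f k \<noteq> 0"
    then have "v \<notin> Poly_Mapping.keys k" using assms by (auto simp: polys_in_def in_keys_iff)
    then show False using that by (simp add: in_keys_iff)
  qed
  show "Poly_Mapping.lookup (coeff_in v n f) m = Poly_Mapping.lookup (if n = 0 then f else 0) m"
    using free[of m] free[of "m + Poly_Mapping.single v n"]
    by (auto simp: lookup_coeff_in lookup_add)
qed

lemma coeff_in_free_mult:
  fixes f :: "('x, 'k::comm_ring_1) mpoly"
  assumes "f \<in> polys_in (- {v})"
  shows "coeff_in v n (f * p) = f * coeff_in v n p"
proof -
  have "coeff_in v n (f * p) = (\<Sum>i\<le>n. if i = 0 then f * coeff_in v n p else 0)"
    unfolding coeff_in_mult by (intro sum.cong) (auto simp: coeff_in_free[OF assms])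
  then show ?thesis by simp
qed

lemma coeff_closed_adjoin:
  assumes "coeff_closed v J" "f \<in> polys_in (- {v})"
  shows "coeff_closed v (ideal_adjoin J f)"
  unfolding coeff_closed_def
proof (intro ballI allI)
  fix p n assume "p \<in> ideal_adjoin J f"
  then obtain a b where "a \<in> J" "p = a + f * b" by (rule ideal_adjoinE)
  then show "coeff_in v n p \<in> ideal_adjoin J f"
    using assms by (intro ideal_adjoinI[of "coeff_in v n a" _ _ _ "coeff_in v n b"])
      (auto simp: coeff_closed_def coeff_in_add coeff_in_free_mult)
qed

lemma coeff_closed_adjoins:
  "coeff_closed v J \<Longrightarrow> set fs \<subseteq> polys_in (- {v}) \<Longrightarrow> coeff_closed v (ideal_adjoins J fs)"
  by (induction fs arbitrary: J) (auto intro: coeff_closed_adjoin)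

text \<open>If b p lies in J but p does not, let n be the largest exponent of v whose coefficient in
  p is outside J. The coefficient of b p at N + n is c times it, up to elements of J, which is
  impossible as c is invertible.\<close>

lemma nonzerodivisor_mod_monic:
  fixes b :: "('x, 'k::field) mpoly"
  assumes J: "ring_ideal J" "coeff_closed v J"
    and b: "coeff_in v N b = const c" "c \<noteq> 0" "\<And>n. N < n \<Longrightarrow> coeff_in v n b = 0"
  shows "nonzerodivisor_mod J b"
  unfolding nonzerodivisor_mod_def
proof (intro allI impI, rule ccontr)
  fix p assume bp: "b * p \<in> J" and p: "p \<notin> J"
  obtain k where k: "exponents_le k p" using exists_exponents_le by blast
  let ?A = "{n. coeff_in v n p \<notin> J}"
  have "?A \<subseteq> {..k}"
    using coeff_in_eq_0[OF k] ring_ideal_zero[OF J(1)] by (auto simp: not_less[symmetric])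
  then have fin: "finite ?A" using finite_subset by blast
  have ne: "?A \<noteq> {}"
  proof
    assume "?A = {}"
    then have "(\<Sum>n\<le>k. poly_var v ^ n * coeff_in v n p) \<in> J"
      by (intro ring_ideal_sum[OF J(1)] ring_ideal_mult_left[OF J(1)]) auto
    then show False using poly_eq_sum_coeff_in[OF k, of v] p by simp
  qed
  define n where "n = Max ?A"
  have n: "coeff_in v n p \<notin> J" using Max_in[OF fin ne] by (simp add: n_def)
  have above: "coeff_in v j p \<in> J" if "n < j" for j
    using that Max_ge[OF fin, of j] by (auto simp: n_def)
  have "coeff_in v (N + n) (b * p) =
      coeff_in v N b * coeff_in v n p + (\<Sum>i\<in>{..N + n} - {N}. coeff_in v i b * coeff_in v (N + n - i) p)"
    unfolding coeff_in_mult by (subst sum.remove[of _ N]) auto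
  moreover have "(\<Sum>i\<in>{..N + n} - {N}. coeff_in v i b * coeff_in v (N + n - i) p) \<in> J"
  proof (rule ring_ideal_sum[OF J(1)])
    fix i assume "i \<in> {..N + n} - {N}"
    then consider "i < N" | "N < i" by fastforce
    then show "coeff_in v i b * coeff_in v (N + n - i) p \<in> J"
      using above[of "N + n - i"] b(3)[of i] J(1)
      by cases (auto intro: ring_ideal_mult_left ring_ideal_zero)
  qed
  moreover have "coeff_in v (N + n) (b * p) \<in> J" using J(2) bp by (auto simp: coeff_closed_def)
  ultimately have "const c * coeff_in v n p \<in> J"
    using ring_ideal_diff[OF J(1), of "coeff_in v (N + n) (b * p)"
        "\<Sum>i\<in>{..N + n} - {N}. coeff_in v i b * coeff_in v (N + n - i) p"]
    unfolding b(1) by simp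
  then have "const (inverse c) * (const c * coeff_in v n p) \<in> J"
    by (rule ring_ideal_mult_left[OF J(1)])
  then show False using n b(2) by (simp add: mult.assoc[symmetric] const_mult[symmetric])
qed

definition monic_in :: "'x \<Rightarrow> nat \<Rightarrow> ('x, 'k::field) mpoly \<Rightarrow> bool" where
  "monic_in v N b \<longleftrightarrow> (\<exists>c. c \<noteq> 0 \<and> coeff_in v N b = const c) \<and> (\<forall>n>N. coeff_in v n b = 0)"

lemma monic_in_mult:
  assumes "monic_in v M p" "monic_in v N q" shows "monic_in v (M + N) (p * q)"
proof -
  obtain c d where cd: "c \<noteq> 0" "coeff_in v M p = const c" "d \<noteq> 0" "coeff_in v N q = const d"
    and above: "\<And>n. M < n \<Longrightarrow> coeff_in v n p = 0" "\<And>n. N < n \<Longrightarrow> coeff_in v n q = 0"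
    using assms by (auto simp: monic_in_def)
  have zero: "coeff_in v i p * coeff_in v (n - i) q = 0" if "M + N \<le> n" "i \<noteq> M \<or> n \<noteq> M + N" for i n
  proof (cases "M < i")
    case False
    then have "N < n - i" using that by auto
    then show ?thesis by (simp add: above(2))
  qed (simp add: above(1))
  have "coeff_in v (M + N) (p * q) = (\<Sum>i\<le>M + N. if i = M then const c * const d else 0)"
    unfolding coeff_in_mult using zero[of "M + N"] cd by (intro sum.cong) auto
  then have "coeff_in v (M + N) (p * q) = const (c * d)"
    by (simp add: const_mult)
  moreover have "coeff_in v n (p * q) = 0" if "M + N < n" for n
    unfolding coeff_in_mult using zero[of n] that by (intro sum.neutral) auto
  ultimately show ?thesis
    using cd unfolding monic_in_def by (intro conjI exI[of _ "c * d"]) auto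
qed

lemma monic_in_complete_homogeneous:
  fixes q :: "('x, 'k::field) mpoly"
  assumes Q: "monic_in v e q" "0 < e" and ws: "set ws \<subseteq> polys_in (- {v})"
  shows "monic_in v (n * e) (complete_homogeneous n (q # ws))"
proof (induction n)
  case 0
  have "(1 :: ('x, 'k) mpoly) \<in> polys_in (- {v})" by simp
  then show ?case
    by (auto simp: monic_in_def coeff_in_free intro!: exI[of _ 1])
next
  case (Suc n)
  \<comment> \<open>The part without q is constant in v, so it cannot reach the positive degree
    \<open>Suc n * e\<close>; the top coefficient comes from the product with q.\<close>
  have "complete_homogeneous (Suc n) ws \<in> polys_in (- {v})"
    by (rule complete_homogeneous_in[OF ws])
  then have "coeff_in v k (complete_homogeneous (Suc n) (q # ws)) =
      coeff_in v k (q * complete_homogeneous n (q # ws))" if "k > 0" for k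
    using that by (simp add: coeff_in_add coeff_in_free)
  then show ?case
    using monic_in_mult[OF Q(1) Suc] Q(2) by (auto simp: monic_in_def)
qed

lemma monic_in_univariate:
  fixes q :: "('x, 'k::field) mpoly"
  assumes "q \<in> polys_in {v}" "q \<noteq> 0" "q \<in> face_prime {}"
  shows "\<exists>e>0. monic_in v e q"
proof -
  obtain e where e: "coeff_in v e q \<noteq> 0" "\<And>n. e < n \<Longrightarrow> coeff_in v n q = 0"
      "q = (\<Sum>n\<le>e. poly_var v ^ n * coeff_in v n q)"
    using exists_top_coeff_in[OF assms(2)] by blast
  have const: "coeff_in v n q = const (Poly_Mapping.lookup (coeff_in v n q) 0)" for n
    using coeff_in_polys_in[OF assms(1), of v n]
    by (intro poly_mapping_eqI) (auto simp: polys_in_def lookup_single when_def in_keys_iff)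
  have "coeff_in v 0 q = 0"
    by (subst const) (use assms(3) in \<open>auto simp: lookup_coeff_in face_prime_def in_keys_iff\<close>)
  then have "e > 0" using e(1) by (cases e) auto
  moreover have "monic_in v e q"
    using const[of e] e(1,2) by (auto simp: monic_in_def) (metis single_zero)
  ultimately show ?thesis by blast
qed

text \<open>As \<open>b k\<close> lies in K, \<open>b (Suc k)\<close> and \<open>a (Suc k)\<close>
  agree modulo K. Adjoining either puts \<open>b (Suc k)\<close> into the ideal, and the argument
  repeats one index later.\<close>

lemma weakly_regular_telescope:
  assumes "ring_ideal K" "weakly_regular K (map a [Suc k..<l])" "b k \<in> K"
    and b: "\<And>i. b (Suc i) = a (Suc i) + r * b i"
  shows "weakly_regular K (map b [Suc k..<l])"
  using assms(1-3)
proof (induction "l - k" arbitrary: k K)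
  case (Suc m)
  note K = Suc.prems(1)
  show ?case
  proof (cases "Suc k < l")
    case True
    then have upt: "[Suc k..<l] = Suc k # [Suc (Suc k)..<l]" by (rule upt_conv_Cons)
    have cong: "a (Suc k) - b (Suc k) \<in> K"
      using ring_ideal_uminus[OF K ring_ideal_mult_left[OF K Suc.prems(3), of r]] by (simp add: b)
    have "weakly_regular (ideal_adjoin K (a (Suc k))) (map b [Suc (Suc k)..<l])"
    proof (rule Suc.hyps(1))
      show "m = l - Suc k" using Suc.hyps(2) by simp
      show "ring_ideal (ideal_adjoin K (a (Suc k)))" by (rule ring_ideal_adjoin[OF K])
      show "weakly_regular (ideal_adjoin K (a (Suc k))) (map a [Suc (Suc k)..<l])"
        using Suc.prems(2) unfolding upt by simp
      show "b (Suc k) \<in> ideal_adjoin K (a (Suc k))"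
        using in_ideal_adjoin[OF K, of "b (Suc k)"] ideal_adjoin_cong[OF K cong] by simp
    qed
    then show ?thesis
      using Suc.prems(2) nonzerodivisor_mod_cong[OF K cong] ideal_adjoin_cong[OF K cong]
      unfolding upt by simp
  qed simp
qed simp

text \<open>Consecutive complete homogeneous polynomials \<open>h\<^sub>j, \<dots>, h\<^sub>j\<^sub>+\<^sub>d\<^sub>-\<^sub>1\<close> in \<open>d\<close> variables form a regular
  sequence: modulo \<open>h\<^sub>j\<close>, which is monic in the first variable, the remaining ones may be replaced
  by the \<open>h\<^sub>i\<close> in the remaining variables.\<close>

lemma weakly_regular_complete_homogeneous:
  fixes Q :: "'x \<Rightarrow> ('x, 'k::field) mpoly"
  assumes "distinct vs" "set vs \<subseteq> F"
    and Q: "\<And>v. v \<in> F \<Longrightarrow> Q v \<in> polys_in {v} \<and> Q v \<noteq> 0 \<and> Q v \<in> face_prime {}"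
  shows "weakly_regular (face_prime F) (map (\<lambda>i. complete_homogeneous i (map Q vs)) [j..<j + length vs])"
  using assms(1,2)
proof (induction vs arbitrary: j)
  case (Cons v vs)
  let ?P = "face_prime F :: ('x, 'k) mpoly set"
  have P: "ring_ideal ?P" by (simp add: face_prime_eq ring_ideal_monomial_ideal)
  have v: "v \<in> F" "v \<notin> set vs" using Cons.prems by auto
  define ws where "ws = map Q vs"
  define b where "b i = complete_homogeneous i (Q v # ws)" for i
  define a where "a i = complete_homogeneous i ws" for i
  let ?fs = "map a [Suc j..<Suc j + length vs]"
  have ws: "set ws \<subseteq> polys_in (- {v})"
  proof
    fix p assume "p \<in> set ws"
    then obtain w where "p = Q w" "w \<in> set vs" by (auto simp: ws_def)
    then show "p \<in> polys_in (- {v})"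
      using Q[of w] Cons.prems polys_in_mono[of "{w}" "- {v}"] by auto
  qed
  then have fs: "set ?fs \<subseteq> polys_in (- {v})"
    by (auto simp: a_def complete_homogeneous_in)
  obtain e where "0 < e" "monic_in v e (Q v)"
    using monic_in_univariate[of "Q v" v] Q[OF v(1)] by blast
  then have monic: "monic_in v (j * e) (b j)"
    unfolding b_def using ws by (intro monic_in_complete_homogeneous)
  \<comment> \<open>The ideals of the polynomials without v are closed under taking coefficients in
    v, and modulo such an ideal the monic \<open>b j\<close> is a nonzerodivisor.\<close>
  have nz: "nonzerodivisor_mod (ideal_adjoins ?P (take i ?fs)) (b j)" for i
  proof -
    have "set (take i ?fs) \<subseteq> polys_in (- {v})" by (rule order_trans[OF set_take_subset fs])
    then have "coeff_closed v (ideal_adjoins ?P (take i ?fs))"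
      by (rule coeff_closed_adjoins[OF coeff_closed_face_prime[OF v(1)]])
    then show ?thesis
      using monic nonzerodivisor_mod_monic[OF ring_ideal_adjoins[OF P], of v "take i ?fs" "j * e" "b j"]
      unfolding monic_in_def by auto
  qed
  have "weakly_regular ?P ?fs"
    using Cons.IH[of "Suc j"] Cons.prems by (simp add: a_def[abs_def] ws_def del: upt_Suc)
  then have "weakly_regular (ideal_adjoin ?P (b j)) ?fs"
    using nz by (intro weakly_regular_adjoin P)
  then have "weakly_regular (ideal_adjoin ?P (b j)) (map b [Suc j..<Suc j + length vs])"
    by (rule weakly_regular_telescope[rotated, where r = "Q v"])
      (auto simp: a_def b_def ring_ideal_adjoin P in_ideal_adjoin)
  moreover have "nonzerodivisor_mod ?P (b j)" using nz[of 0] by simp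
  moreover have "[j..<j + length (v # vs)] = j # [Suc j..<Suc j + length vs]"
    using upt_conv_Cons[of j "j + length (v # vs)"] by (simp del: upt_Suc)
  ultimately show ?case by (simp add: b_def[abs_def] ws_def del: upt_Suc)
qed simp

text \<open>Each \<open>Q v\<close> is univariate without constant term, so modulo
  \<open>face_prime F\<close> only the arguments with v in F survive. Starting at degree 1 keeps the
  sequence inside every ideal that contains the arguments.\<close>

lemma weakly_regular_complete_homogeneous_face:
  fixes Q :: "'x \<Rightarrow> ('x, 'k::field) mpoly"
  assumes vs: "distinct vs" "F \<subseteq> set vs"
    and Q: "\<And>v. v \<in> set vs \<Longrightarrow> Q v \<in> polys_in {v} \<and> Q v \<noteq> 0 \<and> Q v \<in> face_prime {}"
  shows "weakly_regular (face_prime F) (map (\<lambda>i. complete_homogeneous i (map Q vs)) [1..<Suc (card F)])"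
proof -
  let ?P = "face_prime F :: ('x, 'k) mpoly set"
  have P: "ring_ideal ?P" by (simp add: face_prime_eq ring_ideal_monomial_ideal)
  define us where "us = filter (\<lambda>v. v \<in> F) vs"
  have us: "distinct us" "set us = F" using vs by (auto simp: us_def)
  then have "length us = card F" using distinct_card by fastforce
  then have reg: "weakly_regular ?P (map (\<lambda>i. complete_homogeneous i (map Q us)) [1..<Suc (card F)])"
    using weakly_regular_complete_homogeneous[of us F Q 1] us vs Q by (fastforce simp del: upt_Suc)
  have "complete_homogeneous i (map Q vs) - complete_homogeneous i (map Q us) \<in> ?P" for i
    unfolding us_def
  proof (rule complete_homogeneous_filter[OF P])
    fix v assume "v \<in> set vs" "v \<notin> F"
    have "\<not> Poly_Mapping.keys m \<subseteq> F" if "m \<in> Poly_Mapping.keys (Q v)" for m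
    proof -
      have "Poly_Mapping.keys m \<subseteq> {v}" "Poly_Mapping.keys m \<noteq> {}"
        using Q[OF \<open>v \<in> set vs\<close>] that by (auto simp: face_prime_def polys_in_def)
      then show ?thesis using \<open>v \<notin> F\<close> by blast
    qed
    then show "Q v \<in> ?P" by (simp add: face_prime_def)
  qed
  then show ?thesis
    using reg by (subst weakly_regular_cong[OF P]) (auto simp: list_all2_conv_all_nth)
qed

section \<open>Squarefree monomial ideals: criteria\<close>

text \<open>Restricts the variables to \<open>U\<close> by setting the others to zero, so that all ideals live in the one
  polynomial ring with all variables.\<close>

definition gens_over :: "'x set \<Rightarrow> 'x set set \<Rightarrow> 'x set set" where
  "gens_over U \<G> = \<G> \<union> {{v} | v. v \<notin> U}"

lemma face_prime_gens_over: "face_prime U = monomial_ideal (gens_over U {})"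
  by (simp add: face_prime_eq gens_over_def) (rule arg_cong[of _ _ monomial_ideal], blast)

lemma face_prime_subset_gens_over:
  "(face_prime U :: ('x, 'k::comm_ring_1) mpoly set) \<subseteq> monomial_ideal (gens_over U \<G>)"
  unfolding face_prime_gens_over by (intro monomial_ideal_mono) (auto simp: gens_over_def)

lemma monomial_ideal_cong:
  assumes "\<And>G. G \<in> \<G> \<Longrightarrow> \<exists>G'\<in>\<G>'. G' \<subseteq> G" "\<And>G. G \<in> \<G>' \<Longrightarrow> \<exists>G'\<in>\<G>. G' \<subseteq> G"
  shows "(monomial_ideal \<G> :: ('x, 'k::comm_ring_1) mpoly set) = monomial_ideal \<G>'"
  by (intro equalityI monomial_ideal_mono assms)

text \<open>The inductive step of vertex decomposability.\<close>

lemma weakly_regular_vertex: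
  fixes \<theta> :: "('x, 'k::field) mpoly list"
  assumes "v \<in> U"
    and "weakly_regular (monomial_ideal (gens_over (U - {v}) \<G>)) \<theta>"
    and "weakly_regular (monomial_ideal (gens_over U ((\<lambda>G. G - {v}) ` \<G>))) \<theta>"
  shows "weakly_regular (monomial_ideal (gens_over U \<G>)) \<theta>"
proof (rule weakly_regular_colon_adjoin[OF ring_ideal_monomial_ideal])
  have "insert {v} (gens_over U \<G>) = gens_over (U - {v}) \<G>"
    by (auto simp: gens_over_def)
  then show "weakly_regular (ideal_adjoin (monomial_ideal (gens_over U \<G>)) (poly_var v)) \<theta>"
    using assms(2) by (simp add: monomial_ideal_adjoin_var)
  have "(\<lambda>G. G - {v}) ` gens_over U \<G> = gens_over U ((\<lambda>G. G - {v}) ` \<G>)"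
  proof -
    have "(\<lambda>G. G - {v}) ` {{w} | w. w \<notin> U} = {{w} | w. w \<notin> U}"
    proof -
      have "{w} - {v} = {w}" if "w \<notin> U" for w using that assms(1) by auto
      then show ?thesis by (auto simp: image_iff)
    qed
    then show ?thesis unfolding gens_over_def image_Un by simp
  qed
  then show "weakly_regular {p. poly_var v * p \<in> monomial_ideal (gens_over U \<G>)} \<theta>"
    using assms(3) by (simp add: monomial_ideal_colon_var)
qed

section \<open>Vertex decompositions of the complexes that occur\<close>

context
  fixes \<theta> :: "('x, 'k::field) mpoly list" and d :: nat and H :: "'x set"
  assumes H: "finite H"
    and reg: "\<And>F. F \<subseteq> H \<Longrightarrow> card F = d \<Longrightarrow> weakly_regular (face_prime F) \<theta>"
begin

text \<open>Induction on G: deleting a vertex v of G leaves the full simplex on U - {v}, and its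
  link has the smaller generator G - {v}.\<close>

lemma weakly_regular_principal:
  assumes "U \<subseteq> H" "card U = Suc d" "G \<subseteq> U" "G \<noteq> {}"
  shows "weakly_regular (monomial_ideal (gens_over U {G})) \<theta>"
proof -
  have "finite G" by (rule finite_subset[OF order_trans[OF assms(3,1)] H])
  then show ?thesis
    using assms(4,3)
  proof (induction G rule: finite_ne_induct)
    case (singleton v)
    have "monomial_ideal (gens_over U {{v}}) = (face_prime (U - {v}) :: ('x, 'k) mpoly set)"
      unfolding face_prime_gens_over by (rule monomial_ideal_cong) (auto simp: gens_over_def)
    moreover have "card (U - {v}) = d" using singleton assms by simp
    ultimately show ?case using reg[of "U - {v}"] assms by auto
  next
    case (insert v G)
    show ?case
    proof (rule weakly_regular_vertex)
      show "v \<in> U" using insert by simp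
      have "monomial_ideal (gens_over (U - {v}) {insert v G}) = (face_prime (U - {v}) :: ('x, 'k) mpoly set)"
        unfolding face_prime_gens_over by (rule monomial_ideal_cong) (auto simp: gens_over_def)
      moreover have "card (U - {v}) = d" using insert assms by simp
      ultimately show "weakly_regular (monomial_ideal (gens_over (U - {v}) {insert v G})) \<theta>"
        using reg[of "U - {v}"] assms by auto
      have "insert v G - {v} = G" using insert by auto
      then show "weakly_regular (monomial_ideal (gens_over U ((\<lambda>G. G - {v}) ` {insert v G}))) \<theta>"
        using insert by simp
    qed
  qed
qed

text \<open>The generators of three vertices, the middle one being open. At a, the deletion leaves
  the single generator \<open>insert b B\<close>, while the link kills b and leaves A; both are
  principal with one variable fewer.\<close>

lemma weakly_regular_path:
  assumes U: "U \<subseteq> H" "card U = d + 2" and ab: "a \<in> U" "b \<in> U" "a \<noteq> b"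
    and A: "A \<subseteq> U - {a, b}" "A \<noteq> {}" and B: "B \<subseteq> U - {a, b}" "B \<noteq> {}"
  shows "weakly_regular (monomial_ideal (gens_over U {insert a A, {a, b}, insert b B})) \<theta>"
proof (rule weakly_regular_vertex[OF ab(1)])
  have fin: "finite U" using U H finite_subset by blast
  have "monomial_ideal (gens_over (U - {a}) {insert a A, {a, b}, insert b B}) =
      (monomial_ideal (gens_over (U - {a}) {insert b B}) :: ('x, 'k) mpoly set)"
    by (rule monomial_ideal_cong) (auto simp: gens_over_def)
  then show "weakly_regular (monomial_ideal (gens_over (U - {a}) {insert a A, {a, b}, insert b B})) \<theta>"
    using weakly_regular_principal[of "U - {a}" "insert b B"] U ab B by auto
  have del: "insert a A - {a} = A" "{a, b} - {a} = {b}" "insert b B - {a} = insert b B"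
    using A B ab by auto
  have "monomial_ideal (gens_over U {A, {b}, insert b B}) =
      (monomial_ideal (gens_over (U - {b}) {A}) :: ('x, 'k) mpoly set)"
    by (rule monomial_ideal_cong) (auto simp: gens_over_def)
  then show "weakly_regular (monomial_ideal (gens_over U ((\<lambda>G. G - {a}) `
      {insert a A, {a, b}, insert b B}))) \<theta>"
    using weakly_regular_principal[of "U - {b}" A] U ab A del by auto
qed

text \<open>The generators of the 5-cycle, with room in X and Y for the singletons of two
  nonadjacent closed vertices. At d', the deletion leaves the three generators of the preceding
  lemma, and the link kills c and e and leaves {a, b}.\<close>

lemma weakly_regular_pentagon:
  assumes U: "U \<subseteq> H" "card U = d + 3" and vars: "{a, b, c, d', e} \<subseteq> U" "distinct [a, b, c, d', e]"
    and X: "X \<subseteq> U - {a, b, c, d', e}" and Y: "Y \<subseteq> U - {a, b, c, d', e}"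
  shows "weakly_regular (monomial_ideal (gens_over U
    {insert a (insert e X), {a, b}, insert b (insert c Y), {c, d'}, {d', e}})) \<theta>"
proof (rule weakly_regular_vertex[of d'])
  let ?A = "insert e X" and ?B = "insert c Y"
  have fin: "finite U" using U H finite_subset by blast
  show "d' \<in> U" using vars by simp
  have "monomial_ideal (gens_over (U - {d'}) {insert a ?A, {a, b}, insert b ?B, {c, d'}, {d', e}}) =
      (monomial_ideal (gens_over (U - {d'}) {insert a ?A, {a, b}, insert b ?B}) :: ('x, 'k) mpoly set)"
    by (rule monomial_ideal_cong) (auto simp: gens_over_def)
  moreover have "weakly_regular (monomial_ideal (gens_over (U - {d'})
      {insert a ?A, {a, b}, insert b ?B})) \<theta>"
    by (rule weakly_regular_path) (use U vars X Y in auto)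
  ultimately show "weakly_regular (monomial_ideal (gens_over (U - {d'})
      {insert a ?A, {a, b}, insert b ?B, {c, d'}, {d', e}})) \<theta>" by simp
  have del: "(\<lambda>G. G - {d'}) ` {insert a ?A, {a, b}, insert b ?B, {c, d'}, {d', e}} =
      {insert a ?A, {a, b}, insert b ?B, {c}, {e}}"
  proof -
    have "insert a ?A - {d'} = insert a ?A" "{a, b} - {d'} = {a, b}"
      "insert b ?B - {d'} = insert b ?B" "{c, d'} - {d'} = {c}" "{d', e} - {d'} = {e}"
      using vars X Y by auto
    then show ?thesis by simp
  qed
  have "monomial_ideal (gens_over U {insert a ?A, {a, b}, insert b ?B, {c}, {e}}) =
      (monomial_ideal (gens_over (U - {c, e}) {{a, b}}) :: ('x, 'k) mpoly set)"
    by (rule monomial_ideal_cong) (auto simp: gens_over_def)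
  moreover have "card (U - {c, e}) = Suc d"
    using U vars fin by (subst card_Diff_subset) auto
  moreover have "U - {c, e} \<subseteq> H" "{a, b} \<subseteq> U - {c, e}" using U vars by auto
  ultimately show "weakly_regular (monomial_ideal (gens_over U ((\<lambda>G. G - {d'}) `
      {insert a ?A, {a, b}, insert b ?B, {c, d'}, {d', e}}))) \<theta>"
    unfolding del using weakly_regular_principal[of "U - {c, e}" "{a, b}"] by simp
qed

end

section \<open>The two criteria for quotients by squarefree monomial ideals\<close>

lemma prime_set_contains_var:
  fixes Q :: "('x, 'k::field) mpoly set"
  assumes Q: "prime_set Q" and "Poly_Mapping.single m c \<in> Q" "c \<noteq> 0"
  shows "\<exists>v\<in>Poly_Mapping.keys m. poly_var v \<in> Q"
  using assms(2)
proof (induction "total_degree m" arbitrary: m rule: less_induct)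
  case less
  have idQ: "ring_ideal Q" and oneQ: "1 \<notin> Q" using Q by (auto simp: prime_set_def)
  have "m \<noteq> 0"
  proof
    assume "m = 0"
    then have "const (inverse c) * const c \<in> Q" using ring_ideal_mult_left[OF idQ less.prems] by simp
    then show False using oneQ assms(3) by (simp add: mult_single)
  qed
  then obtain v where v: "v \<in> Poly_Mapping.keys m" by fastforce
  let ?n = "m - Poly_Mapping.single v (1::nat)"
  have m: "m = Poly_Mapping.single v 1 + ?n" using minus_single_add[OF v] by simp
  have "Poly_Mapping.single m c = poly_var v * Poly_Mapping.single ?n c"
    by (subst m) (simp add: poly_var_def mult_single)
  then consider "poly_var v \<in> Q" | "Poly_Mapping.single ?n c \<in> Q"
    using Q less.prems by (auto simp: prime_set_def)
  then show ?case
  proof cases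
    case 2
    have "total_degree m = total_degree (Poly_Mapping.single v (1::nat)) + total_degree ?n"
      by (subst m) (rule total_degree_add)
    then have "total_degree ?n < total_degree m"
      by (simp add: total_degree_def)
    moreover have "Poly_Mapping.keys ?n \<subseteq> Poly_Mapping.keys m" by (subst (2) m) (auto simp: keys_add_nat)
    ultimately show ?thesis using less.hyps[of ?n] 2 by blast
  qed (use v in blast)
qed

text \<open>The assumption \<open>shell\<close> speaks of any sequence that is regular on all
  d-element sets of variables. It thus separates the combinatorics of the complex from the choice of
  the sequence, which depends on the maximal ideal.\<close>

theorem squarefree_cohen_macaulay:
  fixes \<phi> :: "('x, 'k::field) mpoly \<Rightarrow> 'b" and A :: "('b, 'd) ring_scheme"
  assumes pres: "ring_presentation A \<phi>"
    and kern: "ring_presentation.kern A \<phi> = monomial_ideal (gens_over H \<G>)"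
    and H: "finite H" "d \<le> card H"
    and dim: "\<And>F. F \<subseteq> H \<Longrightarrow> (\<And>G. G \<in> \<G> \<Longrightarrow> \<not> G \<subseteq> F) \<Longrightarrow> card F \<le> d"
    and shell: "\<And>\<theta> :: ('x, 'k) mpoly list.
      (\<And>F. F \<subseteq> H \<Longrightarrow> card F = d \<Longrightarrow> weakly_regular (face_prime F) \<theta>) \<Longrightarrow>
      weakly_regular (monomial_ideal (gens_over H \<G>)) \<theta>"
  shows "cohen_macaulay_ring A"
proof -
  interpret ring_presentation A \<phi> by (rule pres)
  have sub: "face_prime H \<subseteq> kern" unfolding kern by (rule face_prime_subset_gens_over)
  show ?thesis
  proof (rule cohen_macaulay_ringI[of d])
    fix K assume "ring_ideal K" "kern \<subseteq> K"
    then show "\<exists>fs. K = ideal_adjoins kern fs"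
      using ideal_finitely_generated_over[OF H(1)] ring_ideal_kern sub by blast
  next
    fix xs :: "('x, 'k) mpoly list" and Q assume xs: "length xs = Suc d" and Q: "prime_set Q" "kern \<subseteq> Q"
    have idQ: "ring_ideal Q" using Q by (simp add: prime_set_def)
    \<comment> \<open>The variables outside a prime over the ideal form a face, and the prime
      contains the face prime of F.\<close>
    define F where "F = {v. poly_var v \<notin> Q}"
    have "F \<subseteq> H"
    proof
      fix v assume v: "v \<in> F"
      have "poly_var v \<in> (face_prime H :: ('x, 'k) mpoly set)" if "v \<notin> H"
        using that by (simp add: face_prime_def poly_var_def)
      then show "v \<in> H" using v sub Q(2) by (auto simp: F_def)
    qed
    moreover have "\<not> G \<subseteq> F" if G: "G \<in> \<G>" for G
    proof
      assume GF: "G \<subseteq> F"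
      then have "finite G" by (rule finite_subset[OF order_trans[OF _ \<open>F \<subseteq> H\<close>] H(1)])
      then obtain m :: "'x \<Rightarrow>\<^sub>0 nat" where m: "Poly_Mapping.keys m = G"
        using exists_squarefree_monomial[of G] by blast
      have "Poly_Mapping.single m (1::'k) \<in> kern"
        unfolding kern using m G by (auto simp: monomial_ideal_def gens_over_def)
      then obtain v where "v \<in> G" "poly_var v \<in> Q"
        using prime_set_contains_var[OF Q(1), of m 1] Q(2) m by auto
      then show False using GF by (auto simp: F_def)
    qed
    ultimately have "card F \<le> d" by (rule dim)
    \<comment> \<open>Padding F to exactly d elements, possibly beyond a face, only shrinks its
      prime and fits the dimension bound.\<close>
    obtain F' where F': "F \<subseteq> F'" "F' \<subseteq> H" "card F' = d"
      using exists_subset_between[OF \<open>card F \<le> d\<close> H(2) \<open>F \<subseteq> H\<close> H(1)] by blast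
    have "finite F'" using F' H(1) finite_subset by blast
    then obtain s where s: "s \<in> boundary_set xs" "s \<in> face_prime F'"
      using boundary_set_meets_face_prime[of F' xs] xs F'(3) by auto
    have "face_prime F' \<subseteq> Q"
    proof
      fix p :: "('x, 'k) mpoly" assume p: "p \<in> face_prime F'"
      show "p \<in> Q"
      proof (rule ring_ideal_in_if_single[OF idQ])
        fix m assume "m \<in> Poly_Mapping.keys p"
        then obtain v where v: "v \<in> Poly_Mapping.keys m" "v \<notin> F" using p F'(1) by (auto simp: face_prime_def)
        have "Poly_Mapping.single m (Poly_Mapping.lookup p m) =
            Poly_Mapping.single (m - Poly_Mapping.single v 1) (Poly_Mapping.lookup p m) * poly_var v"
          using minus_single_add[OF v(1)] by (simp add: poly_var_def mult_single add.commute)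
        then show "Poly_Mapping.single m (Poly_Mapping.lookup p m) \<in> Q"
          using v(2) ring_ideal_mult_left[OF idQ] by (simp add: F_def)
      qed
    qed
    then show "boundary_set xs \<inter> Q \<noteq> {}" using s by blast
  next
    fix N assume N: "maximal_set N" "kern \<subseteq> N"
    then have idN: "ring_ideal N" by (simp add: maximal_set_def)
    have "\<forall>v\<in>H. \<exists>q. q \<in> polys_in {v} \<inter> N \<and> q \<noteq> 0"
      using exists_univariate_in_maximal[OF H(1) N(1)] sub N(2) by blast
    from bchoice[OF this] obtain q where q: "\<And>v. v \<in> H \<Longrightarrow> q v \<in> polys_in {v}"
      "\<And>v. v \<in> H \<Longrightarrow> q v \<in> N" "\<And>v. v \<in> H \<Longrightarrow> q v \<noteq> 0" by blast
    \<comment> \<open>The factor v removes the constant term, so that \<open>Q v\<close> vanishes on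
      every face that avoids v, and keeps it in N.\<close>
    define Q where "Q v = poly_var v * q v" for v
    have Q: "Q v \<in> polys_in {v} \<and> Q v \<noteq> 0 \<and> Q v \<in> face_prime {}" if v: "v \<in> H" for v
    proof (intro conjI)
      show "Q v \<in> polys_in {v}"
        unfolding Q_def by (intro polys_in_mult polys_in_poly_var q v) simp
      show "Q v \<noteq> 0"
        using q(3)[OF v] unfolding Q_def keys_eq_empty[symmetric] keys_poly_var_mult by simp
      show "Q v \<in> face_prime {}"
        using keys_poly_var_mult_nonzero[of _ v "q v"] by (auto simp: face_prime_def Q_def)
    qed
    obtain vs where vs: "set vs = H" "distinct vs" using finite_distinct_list[OF H(1)] by blast
    define \<theta> where "\<theta> = map (\<lambda>i. complete_homogeneous i (map Q vs)) [1..<Suc d]"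
    have "weakly_regular (face_prime F) \<theta>" if "F \<subseteq> H" "card F = d" for F
      unfolding \<theta>_def that(2)[symmetric]
      by (rule weakly_regular_complete_homogeneous_face) (use vs Q that in auto)
    then have "weakly_regular kern \<theta>" unfolding kern by (rule shell)
    moreover have "set \<theta> \<subseteq> N"
    proof -
      have "set (map Q vs) \<subseteq> N" using vs q(2) ring_ideal_mult_left[OF idN] by (auto simp: Q_def)
      then have "complete_homogeneous i (map Q vs) \<in> N" if "0 < i" for i
        using complete_homogeneous_mem[OF idN, of "map Q vs" "i - 1"] that by simp
      then show ?thesis by (auto simp: \<theta>_def simp del: upt_Suc)
    qed
    moreover have "length \<theta> = d" by (simp add: \<theta>_def del: upt_Suc)
    ultimately show "\<exists>fs. set fs \<subseteq> N \<and> length fs = d \<and> weakly_regular kern fs" by blast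
  qed
qed

text \<open>A face F gives the origin height at least card F, so it suffices that no sequence of
  this length is regular there.\<close>

lemma squarefree_not_cohen_macaulay:
  fixes \<phi> :: "('x, 'k::field) mpoly \<Rightarrow> 'b" and A :: "('b, 'd) ring_scheme"
  assumes pres: "ring_presentation A \<phi>"
    and kern: "ring_presentation.kern A \<phi> = monomial_ideal \<G>"
    and F: "finite F" "\<And>G. G \<in> \<G> \<Longrightarrow> \<not> G \<subseteq> F"
    and irreg: "\<And>fs. set fs \<subseteq> face_prime {} \<Longrightarrow> length fs = card F \<Longrightarrow>
      \<not> weakly_regular (monomial_ideal \<G> :: ('x, 'k) mpoly set) fs"
  shows "\<not> cohen_macaulay_ring A"
proof -
  interpret ring_presentation A \<phi> by (rule pres)
  obtain Q where Q: "\<And>i. i \<le> card F \<Longrightarrow> prime_set (Q i) \<and> (face_prime F :: ('x, 'k) mpoly set) \<subseteq> Q i"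
    "\<And>i. i < card F \<Longrightarrow> Q i \<subset> Q (Suc i)" "Q (card F) = face_prime {}"
    using face_prime_chain[OF F(1)] by blast
  have sub: "kern \<subseteq> face_prime F"
    unfolding kern monomial_ideal_subset_face_prime_iff using F(2) by blast
  show ?thesis
  proof (rule not_cohen_macaulay_ringI[OF maximal_set_origin, of "card F" Q])
    show "kern \<subseteq> face_prime {}" using sub Q(1)[of "card F"] Q(3) by auto
    show "prime_set (Q i) \<and> kern \<subseteq> Q i" if "i \<le> card F" for i using Q(1)[OF that] sub by auto
  qed (use Q irreg kern in auto)
qed

section \<open>Hypergraph ideals\<close>

text \<open>The support of the generator of the vertex i.\<close>

definition star :: "nat set set \<Rightarrow> nat \<Rightarrow> nat set set" where
  "star H i = {F \<in> H. i \<in> F}"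

lemma hypergraph_finite: "hypergraph \<mu> H \<Longrightarrow> finite H"
  by (rule finite_subset[of _ "Pow {1..\<mu>}"]) (auto simp: hypergraph_def)

lemma a_inv_poly_ring:
  fixes p :: "('x, 'k::field) mpoly"
  assumes "p \<in> carrier (poly_ring X)"
  shows "a_inv (poly_ring X) p = - p"
proof -
  interpret cring "poly_ring X :: ('x, 'k) mpoly ring" by (rule cring_poly_ring)
  show ?thesis
    by (rule minus_equality) (use assms in auto)
qed

lemma hypergraph_gen_eq_single:
  assumes "finite H"
  shows "(hypergraph_gen H i :: (nat set, 'k::field) mpoly) =
    Poly_Mapping.single (\<Sum>F\<in>star H i. Poly_Mapping.single F 1) 1"
proof -
  have "finite (star H i)" using assms by (simp add: star_def)
  then have "(\<Prod>F\<in>star H i. poly_var F :: (nat set, 'k) mpoly) =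
      Poly_Mapping.single (\<Sum>F\<in>star H i. Poly_Mapping.single F 1) 1"
    by (induction rule: finite_induct) (simp_all add: poly_var_def mult_single)
  then show ?thesis by (simp add: hypergraph_gen_def star_def)
qed

lemma keys_sum_single:
  "finite S \<Longrightarrow> Poly_Mapping.keys (\<Sum>F\<in>S. Poly_Mapping.single F (1::nat)) = S"
  by (induction rule: finite_induct) (auto simp: keys_add_nat)

lemma hypergraph_ideal_eq:
  assumes "hypergraph \<mu> H"
  shows "(hypergraph_ideal \<mu> H :: (nat set, 'k::field) mpoly set) =
    polys_in H \<inter> monomial_ideal (star H ` {1..\<mu>})"
proof -
  let ?R = "poly_ring H :: (nat set, 'k) mpoly ring"
  let ?g = "hypergraph_gen H :: nat \<Rightarrow> (nat set, 'k) mpoly"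
  let ?K = "polys_in H \<inter> monomial_ideal (star H ` {1..\<mu>}) :: (nat set, 'k) mpoly set"
  interpret cring ?R by (rule cring_poly_ring)
  have finH: "finite H" using assms by (rule hypergraph_finite)
  have fin: "finite (star H i)" for i using finH by (simp add: star_def)
  have carrier: "p \<in> carrier ?R \<longleftrightarrow> p \<in> polys_in H" for p by (simp add: polys_in_def)
  have K: "ring_ideal (monomial_ideal (star H ` {1..\<mu>}) :: (nat set, 'k) mpoly set)"
    by (rule ring_ideal_monomial_ideal)
  have gen: "?g i \<in> ?K" if "i \<in> {1..\<mu>}" for i
    using that by (auto simp: hypergraph_gen_eq_single[OF finH] polys_in_def monomial_ideal_def
        keys_sum_single[OF fin, simplified]) (auto simp: star_def)
  have idK: "ideal ?K ?R"
  proof (rule idealI[OF ring_axioms])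
    show "subgroup ?K (add_monoid ?R)"
    proof (rule add.subgroupI)
      show "?K \<noteq> {}" using ring_ideal_zero[OF K] polys_in_zero by blast
    qed (use K in \<open>auto simp: carrier a_inv_poly_ring simp del: poly_ring_simps(1)
        intro: polys_in_uminus polys_in_add ring_ideal_uminus ring_ideal_add\<close>)
  qed (use K in \<open>auto simp: carrier simp del: poly_ring_simps(1)
        intro: polys_in_mult ring_ideal_mult_left ring_ideal_mult_right\<close>)
  have gens: "?g ` {1..\<mu>} \<subseteq> carrier ?R" using gen carrier by blast
  have "ideal (hypergraph_ideal \<mu> H) ?R"
    unfolding hypergraph_ideal_def by (rule genideal_ideal[OF gens])
  then interpret I: ideal "hypergraph_ideal \<mu> H" ?R .
  show ?thesis
  proof
    show "hypergraph_ideal \<mu> H \<subseteq> ?K"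
      unfolding hypergraph_ideal_def by (rule genideal_minimal[OF idK]) (use gen in blast)
    show "?K \<subseteq> hypergraph_ideal \<mu> H"
    proof
      fix p :: "(nat set, 'k) mpoly" assume p: "p \<in> ?K"
      have single: "Poly_Mapping.single m (Poly_Mapping.lookup p m) \<in> hypergraph_ideal \<mu> H"
        if m: "m \<in> Poly_Mapping.keys p" for m
      proof -
        obtain i where i: "i \<in> {1..\<mu>}" "star H i \<subseteq> Poly_Mapping.keys m"
          using p m by (auto simp: monomial_ideal_def)
        have mH: "Poly_Mapping.keys m \<subseteq> H" using p m by (auto simp: polys_in_def)
        define s where "s = (\<Sum>F\<in>star H i. Poly_Mapping.single F (1::nat))"
        have "Poly_Mapping.lookup s F \<le> Poly_Mapping.lookup m F" for F
        proof -
          have "Poly_Mapping.lookup s F = (if F \<in> star H i then 1 else 0)"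
            unfolding s_def lookup_sum using fin[of i] by (simp add: lookup_single when_def)
          then show ?thesis using i(2) by (auto simp: in_keys_iff Suc_le_eq)
        qed
        then have "m = (m - s) + s"
          by (intro poly_mapping_eqI) (simp add: lookup_add lookup_minus)
        then have "Poly_Mapping.single m (Poly_Mapping.lookup p m) =
            Poly_Mapping.single (m - s) (Poly_Mapping.lookup p m) * ?g i"
          unfolding hypergraph_gen_eq_single[OF finH, of i, folded s_def] by (simp add: mult_single)
        moreover have "?g i \<in> hypergraph_ideal \<mu> H"
          unfolding hypergraph_ideal_def using genideal_self[OF gens] i(1) by blast
        moreover have "Poly_Mapping.single (m - s) (Poly_Mapping.lookup p m) \<in> carrier ?R"
          unfolding carrier using mH by (intro polys_in_single) (auto simp: in_keys_iff lookup_minus)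
        ultimately show ?thesis using I.I_l_closed by simp
      qed
      have "(\<Sum>m\<in>A. Poly_Mapping.single m (Poly_Mapping.lookup p m)) \<in> hypergraph_ideal \<mu> H"
        if "finite A" "A \<subseteq> Poly_Mapping.keys p" for A
        using that
      proof (induction A rule: finite_induct)
        case empty
        then show ?case using I.zero_closed by simp
      next
        case (insert m A)
        then show ?case using I.a_closed[OF single[of m]] by simp
      qed
      from this[of "Poly_Mapping.keys p"] show "p \<in> hypergraph_ideal \<mu> H"
        by (simp add: poly_mapping_sum_single)
    qed
  qed
qed

text \<open>The quotient is presented over the polynomial ring in all variables by sending the variables
  outside \<open>H\<close> to zero.\<close>

lemma hypergraph_presentation:
  assumes "hypergraph \<mu> H"
  fixes \<phi> :: "(nat set, 'k::field) mpoly \<Rightarrow> (nat set, 'k) mpoly set"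
  defines "\<phi> \<equiv> \<lambda>p. a_r_coset (poly_ring H) (hypergraph_ideal \<mu> H) (restrict_vars H p)"
  shows "ring_presentation (poly_ring H Quot hypergraph_ideal \<mu> H) \<phi>"
    and "ring_presentation.kern (poly_ring H Quot hypergraph_ideal \<mu> H) \<phi> =
      monomial_ideal (gens_over H (star H ` {1..\<mu>}))"
proof -
  let ?R = "poly_ring H :: (nat set, 'k) mpoly ring"
  let ?I = "hypergraph_ideal \<mu> H :: (nat set, 'k) mpoly set"
  let ?A = "?R Quot ?I"
  interpret R: cring ?R by (rule cring_poly_ring)
  have carrier: "p \<in> carrier ?R \<longleftrightarrow> p \<in> polys_in H" for p by (simp add: polys_in_def)
  have "ideal ?I ?R"
    unfolding hypergraph_ideal_def
  proof (rule R.genideal_ideal, intro image_subsetI)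
    fix i assume "i \<in> {1..\<mu>}"
    show "hypergraph_gen H i \<in> carrier ?R"
      unfolding carrier hypergraph_gen_def by (intro polys_in_prod polys_in_poly_var) auto
  qed
  then interpret I: ideal ?I ?R .
  have hom: "a_r_coset ?R ?I \<in> ring_hom ?R ?A" by (rule I.rcos_ring_hom)
  interpret A: cring ?A by (rule I.quotient_is_cring[OF R.is_cring])
  have res: "restrict_vars H p \<in> carrier ?R" for p :: "(nat set, 'k) mpoly"
    unfolding carrier by (rule restrict_in)
  show pres: "ring_presentation ?A \<phi>"
  proof
    fix x y
    show "\<phi> (x + y) = \<phi> x \<oplus>\<^bsub>?A\<^esub> \<phi> y"
      using ring_hom_add[OF hom res res] by (simp add: \<phi>_def restrict_add)
    show "\<phi> (x * y) = \<phi> x \<otimes>\<^bsub>?A\<^esub> \<phi> y"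
      using ring_hom_mult[OF hom res res] by (simp add: \<phi>_def restrict_mult)
    show "\<phi> 1 = \<one>\<^bsub>?A\<^esub>"
      using ring_hom_one[OF hom] by (simp add: \<phi>_def restrict_id)
    show "range \<phi> = carrier ?A"
    proof
      show "range \<phi> \<subseteq> carrier ?A" using ring_hom_closed[OF hom res] by (auto simp: \<phi>_def)
      show "carrier ?A \<subseteq> range \<phi>"
      proof
        fix X assume "X \<in> carrier ?A"
        then obtain p where "p \<in> carrier ?R" "X = a_r_coset ?R ?I p"
          by (auto simp: FactRing_def A_RCOSETS_def')
        then show "X \<in> range \<phi>" using restrict_id[of p H] carrier unfolding \<phi>_def by (metis rangeI)
      qed
    qed
  qed
  then interpret P: ring_presentation ?A \<phi> .
  show "P.kern = monomial_ideal (gens_over H (star H ` {1..\<mu>}))"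
  proof (rule Set.set_eqI)
    fix p :: "(nat set, 'k) mpoly"
    have zero: "\<zero>\<^bsub>?A\<^esub> = ?I" by (simp add: FactRing_def)
    have "p \<in> P.kern \<longleftrightarrow> a_r_coset ?R ?I (restrict_vars H p) = ?I"
      unfolding P.kern_def mem_Collect_eq zero by (simp only: \<phi>_def)
    also have "\<dots> \<longleftrightarrow> restrict_vars H p \<in> ?I"
      using I.a_rcos_const[of "restrict_vars H p"] I.a_rcos_self[OF res, of p] by auto
    also have "\<dots> \<longleftrightarrow> restrict_vars H p \<in> monomial_ideal (star H ` {1..\<mu>})"
      unfolding hypergraph_ideal_eq[OF assms(1)] by (simp add: restrict_in)
    also have "\<dots> \<longleftrightarrow> p \<in> monomial_ideal (gens_over H (star H ` {1..\<mu>}))"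
    proof -
      have "(\<exists>G\<in>gens_over H \<G>. G \<subseteq> K) \<longleftrightarrow> (K \<subseteq> H \<longrightarrow> (\<exists>G\<in>\<G>. G \<subseteq> K))" for \<G> and K :: "nat set set"
        unfolding gens_over_def by auto
      then show ?thesis by (auto simp: monomial_ideal_def keys_restrict)
    qed
    finally show "p \<in> P.kern \<longleftrightarrow> p \<in> monomial_ideal (gens_over H (star H ` {1..\<mu>}))" .
  qed
qed

lemma gens_over_not_subset:
  assumes "F \<subseteq> H" "\<And>i. i \<in> {1..\<mu>} \<Longrightarrow> \<not> star H i \<subseteq> F" "G \<in> gens_over H (star H ` {1..\<mu>})"
  shows "\<not> G \<subseteq> F"
  using assms by (auto simp: gens_over_def)

text \<open>The private vertices \<open>s \<in> S\<close> make the cover \<open>f ` S\<close> minimal, so that its complement is a facet;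
  the complement of the smaller cover \<open>X\<close> is a larger face.\<close>

lemma not_cohen_macaulay_covers:
  assumes hyp: "hypergraph \<mu> H"
    and X: "X \<subseteq> H" "{1..\<mu>} \<subseteq> \<Union>X"
    and S: "S \<subseteq> {1..\<mu>}" "f ` S \<subseteq> H" "{1..\<mu>} \<subseteq> \<Union>(f ` S)" "card X < card S"
    and own: "\<And>s t. s \<in> S \<Longrightarrow> t \<in> S \<Longrightarrow> s \<in> f t \<longleftrightarrow> s = t"
  shows "\<not> cohen_macaulay_ideal (poly_ring H) (hypergraph_ideal \<mu> H :: (nat set, 'k::field) mpoly set)"
  unfolding cohen_macaulay_ideal_def
proof (rule squarefree_not_cohen_macaulay[OF hypergraph_presentation[OF hyp], of "H - X"])
  have finH: "finite H" using hyp by (rule hypergraph_finite)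
  show "finite (H - X)" using finH by simp
  let ?\<G> = "gens_over H (star H ` {1..\<mu>})"
  have face: "\<not> G \<subseteq> H - Y" if G: "G \<in> ?\<G>" and Y: "Y \<subseteq> H" "{1..\<mu>} \<subseteq> \<Union>Y" for G Y
  proof (rule gens_over_not_subset[OF _ _ G])
    fix i assume "i \<in> {1..\<mu>}"
    then obtain F where "F \<in> Y" "i \<in> F" using Y(2) by blast
    then show "\<not> star H i \<subseteq> H - Y" using Y(1) by (auto simp: star_def)
  qed auto
  show "\<not> G \<subseteq> H - X" if "G \<in> ?\<G>" for G by (rule face[OF that X])
  fix fs :: "(nat set, 'k) mpoly list"
  assume fs: "set fs \<subseteq> face_prime {}" "length fs = card (H - X)"
  have inj: "inj_on f S" using own by (metis inj_onI)
  have "card X < card (f ` S)" using S(4) card_image[OF inj] by simp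
  moreover have "card (f ` S) \<le> card H" using S(2) finH by (rule card_mono[rotated])
  ultimately have "card (H - f ` S) < card (H - X)"
    using X(1) S(2) finH by (simp add: card_Diff_subset finite_subset)
  then have lt: "card (H - f ` S) < length fs" using fs(2) by simp
  show "\<not> weakly_regular (monomial_ideal ?\<G>) fs"
  proof (rule not_weakly_regular_facet[OF _ _ _ fs(1) lt])
    show "finite (H - f ` S)" using finH by simp
    show "\<not> G \<subseteq> H - f ` S" if "G \<in> ?\<G>" for G by (rule face[OF that S(2,3)])
    fix F assume F: "F \<notin> H - f ` S"
    show "\<exists>G\<in>?\<G>. G \<subseteq> insert F (H - f ` S)"
    proof (cases "F \<in> H")
      case True
      then obtain s where s: "s \<in> S" "F = f s" using F by blast
      have "star H s \<subseteq> insert F (H - f ` S)"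
      proof
        fix G assume G: "G \<in> star H s"
        have "G = F" if "G \<in> f ` S"
        proof -
          obtain t where "t \<in> S" "G = f t" using \<open>G \<in> f ` S\<close> by blast
          then show ?thesis using own[of s t] s G by (simp add: star_def)
        qed
        then show "G \<in> insert F (H - f ` S)" using G by (auto simp: star_def)
      qed
      moreover have "star H s \<in> ?\<G>" using s(1) S(1) by (simp add: gens_over_def subset_iff)
      ultimately show ?thesis by blast
    next
      case False
      then have "{F} \<in> ?\<G>" by (simp add: gens_over_def)
      then show ?thesis by (rule bexI[rotated]) simp
    qed
  qed
qed

text \<open>The hypergraph faces outside a face of the complex cover all vertices. Each covers at
  most two, so at least half of \<open>\<mu>\<close>, rounded up, are needed; this bounds the
  dimension and explains d.\<close>

lemma cohen_macaulay_shellable: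
  fixes H :: "nat set set"
  assumes hyp: "hypergraph \<mu> H" and small: "\<And>F. F \<in> H \<Longrightarrow> card F \<le> 2"
    and d: "d = card H - (\<mu> + 1) div 2"
    and shell: "\<And>\<theta> :: (nat set, 'k::field) mpoly list.
      (\<And>F. F \<subseteq> H \<Longrightarrow> card F = d \<Longrightarrow> weakly_regular (face_prime F) \<theta>) \<Longrightarrow>
      weakly_regular (monomial_ideal (gens_over H (star H ` {1..\<mu>}))) \<theta>"
  shows "cohen_macaulay_ideal (poly_ring H) (hypergraph_ideal \<mu> H :: (nat set, 'k) mpoly set)"
  unfolding cohen_macaulay_ideal_def
proof (rule squarefree_cohen_macaulay[OF hypergraph_presentation[OF hyp], where d = d])
  show finH: "finite H" using hyp by (rule hypergraph_finite)
  show "d \<le> card H" by (simp add: d)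
  fix F assume F: "F \<subseteq> H" "\<And>G. G \<in> star H ` {1..\<mu>} \<Longrightarrow> \<not> G \<subseteq> F"
  have "{1..\<mu>} \<subseteq> \<Union>(H - F)"
  proof
    fix i assume "i \<in> {1..\<mu>}"
    then have "\<not> star H i \<subseteq> F" using F(2) by blast
    then show "i \<in> \<Union>(H - F)" by (auto simp: star_def)
  qed
  then have "card {1..\<mu>} \<le> card (\<Union>(H - F))"
    using hyp by (intro card_mono finite_subset[of "\<Union>(H - F)" "{1..\<mu>}"]) (auto simp: hypergraph_def)
  also have "\<dots> \<le> (\<Sum>F\<in>H - F. card F)" by (rule card_Union_le_sum_card)
  also have "\<dots> \<le> (\<Sum>F\<in>H - F. 2)" using small by (intro sum_mono) auto
  finally have "\<mu> \<le> 2 * (card H - card F)"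
    using F(1) finH by (simp add: card_Diff_subset finite_subset)
  moreover have "card F \<le> card H" using F(1) finH by (rule card_mono[rotated])
  ultimately show "card F \<le> d" unfolding d by linarith
qed (rule shell)

section \<open>Cycles and strings that are not Cohen-Macaulay\<close>

lemma exists_small_cover:
  assumes "2 \<le> \<mu>" and edge: "\<And>i. 1 \<le> i \<Longrightarrow> i < \<mu> \<Longrightarrow> {i, i + 1} \<in> H"
  obtains X where "X \<subseteq> H" "{1..\<mu>} \<subseteq> \<Union>X" "card X \<le> (\<mu> + 1) div 2"
proof
  \<comment> \<open>The edges {1, 2}, {3, 4}, ...; the minimum moves the last one back to end at
    \<open>\<mu>\<close> when \<open>\<mu>\<close> is odd.\<close>
  define k where "k j = min (2 * j - 1) (\<mu> - 1)" for j
  let ?X = "(\<lambda>j. {k j, k j + 1}) ` {1..(\<mu> + 1) div 2}"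
  have "1 \<le> k j \<and> k j < \<mu>" if "1 \<le> j" for j
    using that assms(1) by (auto simp: k_def)
  then show "?X \<subseteq> H" using edge by auto
  show "{1..\<mu>} \<subseteq> \<Union>?X"
  proof
    fix i assume i: "i \<in> {1..\<mu>}"
    let ?j = "(i + 1) div 2"
    have "i = k ?j \<or> i = k ?j + 1" using i assms(1) by (auto simp: k_def)
    moreover have "?j \<in> {1..(\<mu> + 1) div 2}" using i by auto
    ultimately show "i \<in> \<Union>?X" by blast
  qed
  show "card ?X \<le> (\<mu> + 1) div 2"
    using card_image_le[of "{1..(\<mu> + 1) div 2}" "\<lambda>j. {k j, k j + 1}"] by simp
qed

lemma not_cohen_macaulay_large_cover:
  assumes hyp: "hypergraph \<mu> H" "2 \<le> \<mu>" and edge: "\<And>i. 1 \<le> i \<Longrightarrow> i < \<mu> \<Longrightarrow> {i, i + 1} \<in> H"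
    and S: "S \<subseteq> {1..\<mu>}" "\<And>s. s \<in> S \<Longrightarrow> f s \<in> H" "(\<mu> + 1) div 2 < card S"
    and cover: "\<And>i. 1 \<le> i \<Longrightarrow> i \<le> \<mu> \<Longrightarrow> \<exists>s\<in>S. i \<in> f s"
    and own: "\<And>s t. s \<in> S \<Longrightarrow> t \<in> S \<Longrightarrow> s \<in> f t \<longleftrightarrow> s = t"
  shows "\<not> cohen_macaulay_ideal (poly_ring H) (hypergraph_ideal \<mu> H :: (nat set, 'k::field) mpoly set)"
proof -
  obtain X where X: "X \<subseteq> H" "{1..\<mu>} \<subseteq> \<Union>X" "card X \<le> (\<mu> + 1) div 2"
    using exists_small_cover[OF hyp(2) edge] by blast
  have cov: "{1..\<mu>} \<subseteq> \<Union>(f ` S)" using cover by fastforce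
  have img: "f ` S \<subseteq> H" using S(2) by blast
  have lt: "card X < card S" using X(3) S(3) by simp
  show ?thesis by (rule not_cohen_macaulay_covers[OF hyp(1) X(1,2) S(1) img cov lt own])
qed

lemma not_cohen_macaulay_string:
  assumes hyp: "hypergraph \<mu> H" "2 \<le> \<mu>" "\<mu> \<noteq> 3"
    and edge: "\<And>i. 1 \<le> i \<Longrightarrow> i < \<mu> \<Longrightarrow> {i, i + 1} \<in> H" and ends: "{1} \<in> H" "{\<mu>} \<in> H"
  shows "\<not> cohen_macaulay_ideal (poly_ring H) (hypergraph_ideal \<mu> H :: (nat set, 'k::field) mpoly set)"
proof (cases "even \<mu>")
  case True
  then obtain k where k: "\<mu> = 2 * k" "1 \<le> k" using hyp(2) by (auto elim!: evenE)
  \<comment> \<open>The cover {1}, {2, 3}, {4, 5}, ..., \<open>{\<mu>}\<close>, one face more than a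
    perfect matching; S picks a private vertex of each.\<close>
  define S where "S = insert 1 ((\<lambda>j. 2 * j) ` {1..k})"
  define f where "f s = (if s = 1 then {1} else if s = \<mu> then {\<mu>} else {s, s + 1})" for s :: nat
  have S_iff: "s \<in> S \<longleftrightarrow> s = 1 \<or> even s \<and> 1 \<le> s \<and> s \<le> \<mu>" for s
    by (auto simp: S_def k image_iff elim!: evenE)
  have "1 \<notin> (\<lambda>j. 2 * j) ` {1..k}" by auto
  then have "card S = Suc (card ((\<lambda>j. 2 * j) ` {1..k}))"
    unfolding S_def by (subst card_insert_disjoint) auto
  also have "card ((\<lambda>j. 2 * j) ` {1..k}) = k"
    by (subst card_image) (auto simp: inj_on_def)
  finally have card: "(\<mu> + 1) div 2 < card S" by (simp add: k)
  show ?thesis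
  proof (rule not_cohen_macaulay_large_cover[OF hyp(1,2) edge _ _ card, of f])
    show "S \<subseteq> {1..\<mu>}" using hyp(2) by (auto simp: S_iff)
    show "f s \<in> H" if "s \<in> S" for s
      using that edge[of s] ends by (auto simp: f_def S_iff)
    show "\<exists>s\<in>S. i \<in> f s" if i: "1 \<le> i" "i \<le> \<mu>" for i
    proof (cases "i = 1 \<or> even i")
      case True
      then have "i \<in> S" using that by (auto simp: S_iff)
      then show ?thesis by (auto simp: f_def)
    next
      case False
      then have "3 \<le> i" using that by presburger
      then have "i - 1 \<in> S" "i - 1 \<noteq> \<mu>" "i - 1 \<noteq> 1" using that False by (auto simp: S_iff)
      then show ?thesis using that by (intro bexI[of _ "i - 1"]) (auto simp: f_def)
    qed
    show "s \<in> f t \<longleftrightarrow> s = t" if "s \<in> S" "t \<in> S" for s t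
      using that by (auto simp: f_def S_iff)
  qed
next
  case False
  then obtain k where k: "\<mu> = 2 * k + 1" by (auto elim!: oddE)
  then have k2: "2 \<le> k" using hyp(2,3) by auto
  \<comment> \<open>The cover {1}, {2, 3}, {3, 4}, {5, 6}, ..., \<open>{\<mu>}\<close>: the two
    edges at 3 correct the parity. Their private vertices are 2 and 4.\<close>
  define S where "S = {1, 2, 4} \<union> (\<lambda>j. 2 * j + 1) ` {2..k}"
  define f where "f s = (if s = 1 then {1} else if s = \<mu> then {\<mu>} else if s = 4 then {3, 4} else {s, s + 1})" for s :: nat
  have S_iff: "s \<in> S \<longleftrightarrow> s = 1 \<or> s = 2 \<or> s = 4 \<or> odd s \<and> 5 \<le> s \<and> s \<le> \<mu>" for s
    by (auto simp: S_def k image_iff elim!: oddE)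
  have "card S = card {1, 2, 4 :: nat} + card ((\<lambda>j. 2 * j + 1) ` {2..k})"
    unfolding S_def
  proof (rule card_Un_disjoint)
    show "{1, 2, 4} \<inter> (\<lambda>j. 2 * j + 1) ` {2..k} = {}" by (auto, presburger)
  qed auto
  also have "card ((\<lambda>j. 2 * j + 1) ` {2..k}) = k - 1"
    by (subst card_image) (auto simp: inj_on_def)
  finally have card: "(\<mu> + 1) div 2 < card S" using k2 by (simp add: k)
  have \<mu>: "5 \<le> \<mu>" "\<mu> \<noteq> 2" "\<mu> \<noteq> 4" using k k2 by auto
  show ?thesis
  proof (rule not_cohen_macaulay_large_cover[OF hyp(1,2) edge _ _ card, of f])
    show "S \<subseteq> {1..\<mu>}" using \<mu> by (auto simp: S_iff)
    show "f s \<in> H" if "s \<in> S" for s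
      using that edge[of s] edge[of 3] ends \<mu> by (auto simp: f_def S_iff)
    show "\<exists>s\<in>S. i \<in> f s" if i: "1 \<le> i" "i \<le> \<mu>" for i
    proof -
      have "i \<in> S \<or> i = 3 \<or> even i \<and> 6 \<le> i"
        using i unfolding S_iff by presburger
      then consider "i \<in> S" | "i = 3" | "even i" "6 \<le> i" by blast
      then show ?thesis
      proof cases
        case 1
        then show ?thesis by (auto simp: f_def)
      next
        case 2
        then show ?thesis using \<mu> by (intro bexI[of _ 4]) (auto simp: f_def S_iff)
      next
        case 3
        then have "i - 1 \<in> S" "i - 1 \<noteq> \<mu>" "i - 1 \<noteq> 1" "i - 1 \<noteq> 4" using that by (auto simp: S_iff)
        then show ?thesis using that by (intro bexI[of _ "i - 1"]) (auto simp: f_def)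
      qed
    qed
    show "s \<in> f t \<longleftrightarrow> s = t" if "s \<in> S" "t \<in> S" for s t
      using that by (auto simp: f_def S_iff)
  qed
qed

text \<open>Two edges at a common vertex cover three vertices, half a face more than a matching
  would use. Two such stars gain one face when the length is even; an odd length needs three stars,
  hence at least nine vertices.\<close>

lemma not_cohen_macaulay_long_cycle:
  assumes hyp: "hypergraph \<mu> H" "6 \<le> \<mu>" "\<mu> \<noteq> 7"
    and edge: "\<And>i. 1 \<le> i \<Longrightarrow> i < \<mu> \<Longrightarrow> {i, i + 1} \<in> H"
  shows "\<not> cohen_macaulay_ideal (poly_ring H) (hypergraph_ideal \<mu> H :: (nat set, 'k::field) mpoly set)"
proof (cases "even \<mu>")
  case True
  then obtain k where k: "\<mu> = 2 * k" by (auto elim!: evenE)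
  have k3: "3 \<le> k" using hyp(2) k by simp
  have \<mu>: "2 \<le> \<mu>" using hyp(2) by simp
  \<comment> \<open>Stars at 2 and 5, then the edges {7, 8}, {9, 10}, ...; the private vertices of
    the stars are their ends 1, 3, 4, 6.\<close>
  define S where "S = {1, 3, 4, 6} \<union> (\<lambda>j. 2 * j + 1) ` {3..<k}"
  define f where "f s = (if s = 3 then {2, 3} else if s = 6 then {5, 6} else {s, s + 1})" for s :: nat
  have S_iff: "s \<in> S \<longleftrightarrow> s = 1 \<or> s = 3 \<or> s = 4 \<or> s = 6 \<or> odd s \<and> 7 \<le> s \<and> s \<le> \<mu>" for s
    by (auto simp: S_def k image_iff elim!: oddE)
  have "card S = card {1, 3, 4, 6 :: nat} + card ((\<lambda>j. 2 * j + 1) ` {3..<k})"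
    unfolding S_def
  proof (rule card_Un_disjoint)
    show "{1, 3, 4, 6} \<inter> (\<lambda>j. 2 * j + 1) ` {3..<k} = {}" by (auto, presburger)
  qed auto
  also have "card ((\<lambda>j. 2 * j + 1) ` {3..<k}) = k - 3"
    by (subst card_image) (auto simp: inj_on_def)
  finally have card: "(\<mu> + 1) div 2 < card S" using k3 by (simp add: k)
  show ?thesis
  proof (rule not_cohen_macaulay_large_cover[OF hyp(1) \<mu> edge _ _ card, of f])
    show "S \<subseteq> {1..\<mu>}" using hyp(2) by (auto simp: S_iff)
    show "f s \<in> H" if "s \<in> S" for s
    proof -
      have "s \<noteq> \<mu> \<or> s = 6" using that True hyp(2) by (auto simp: S_iff)
      then show ?thesis
        using that edge[of s] edge[of 2] edge[of 5] hyp(2) by (auto simp: f_def S_iff)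
    qed
    show "\<exists>s\<in>S. i \<in> f s" if i: "1 \<le> i" "i \<le> \<mu>" for i
    proof -
      have "i \<in> S \<or> i = 2 \<or> i = 5 \<or> even i \<and> 8 \<le> i"
        using i unfolding S_iff by presburger
      then consider "i \<in> S" | "i = 2" | "i = 5" | "even i" "8 \<le> i" by blast
      then show ?thesis
      proof cases
        case 1
        then show ?thesis by (auto simp: f_def)
      next
        case 2
        then show ?thesis by (intro bexI[of _ 3]) (auto simp: f_def S_iff)
      next
        case 3
        then show ?thesis by (intro bexI[of _ 6]) (auto simp: f_def S_iff)
      next
        case 4
        then have "i - 1 \<in> S" "i - 1 \<noteq> 3" "i - 1 \<noteq> 6" using that by (auto simp: S_iff)
        then show ?thesis using that by (intro bexI[of _ "i - 1"]) (auto simp: f_def)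
      qed
    qed
    show "s \<in> f t \<longleftrightarrow> s = t" if "s \<in> S" "t \<in> S" for s t
      using that by (auto simp: f_def S_iff)
  qed
next
  case False
  then obtain k where k: "\<mu> = 2 * k + 1" by (auto elim!: oddE)
  have k4: "4 \<le> k" using hyp(2,3) k by auto
  have \<mu>: "2 \<le> \<mu>" "9 \<le> \<mu>" using k4 k by auto
  \<comment> \<open>Stars at 2, 5 and 8, then the edges {10, 11}, {12, 13}, ....\<close>
  define S where "S = {1, 3, 4, 6, 7, 9} \<union> (\<lambda>j. 2 * j) ` {5..k}"
  define f where "f s = (if s = 3 then {2, 3} else if s = 6 then {5, 6} else if s = 9 then {8, 9} else {s, s + 1})" for s :: nat
  have S_iff: "s \<in> S \<longleftrightarrow> s = 1 \<or> s = 3 \<or> s = 4 \<or> s = 6 \<or> s = 7 \<or> s = 9 \<or> even s \<and> 10 \<le> s \<and> s \<le> \<mu>" for s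
    by (auto simp: S_def k image_iff elim!: evenE)
  have "card S = card {1, 3, 4, 6, 7, 9 :: nat} + card ((\<lambda>j. 2 * j) ` {5..k})"
    unfolding S_def
  proof (rule card_Un_disjoint)
    show "{1, 3, 4, 6, 7, 9} \<inter> (\<lambda>j. 2 * j) ` {5..k} = {}" by (auto, presburger)
  qed auto
  also have "card ((\<lambda>j. 2 * j) ` {5..k}) = k - 4"
    by (subst card_image) (auto simp: inj_on_def)
  finally have card: "(\<mu> + 1) div 2 < card S" using k4 by (simp add: k)
  show ?thesis
  proof (rule not_cohen_macaulay_large_cover[OF hyp(1) \<mu>(1) edge _ _ card, of f])
    show "S \<subseteq> {1..\<mu>}" using \<mu>(2) by (auto simp: S_iff)
    show "f s \<in> H" if "s \<in> S" for s
    proof -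
      have "s \<noteq> \<mu> \<or> s = 9" using that False \<mu>(2) by (auto simp: S_iff)
      then show ?thesis
        using that edge[of s] edge[of 2] edge[of 5] edge[of 8] \<mu>(2) by (auto simp: f_def S_iff)
    qed
    show "\<exists>s\<in>S. i \<in> f s" if i: "1 \<le> i" "i \<le> \<mu>" for i
    proof -
      have "i \<in> S \<or> i = 2 \<or> i = 5 \<or> i = 8 \<or> odd i \<and> 11 \<le> i"
        using i unfolding S_iff by presburger
      then consider "i \<in> S" | "i = 2" | "i = 5" | "i = 8" | "odd i" "11 \<le> i" by blast
      then show ?thesis
      proof cases
        case 1
        then show ?thesis by (auto simp: f_def)
      next
        case 2
        then show ?thesis by (intro bexI[of _ 3]) (auto simp: f_def S_iff)
      next
        case 3
        then show ?thesis by (intro bexI[of _ 6]) (auto simp: f_def S_iff)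
      next
        case 4
        then show ?thesis by (intro bexI[of _ 9]) (auto simp: f_def S_iff)
      next
        case 5
        then have "i - 1 \<in> S" "i - 1 \<noteq> 3" "i - 1 \<noteq> 6" "i - 1 \<noteq> 9" using that by (auto simp: S_iff)
        then show ?thesis using that by (intro bexI[of _ "i - 1"]) (auto simp: f_def)
      qed
    qed
    show "s \<in> f t \<longleftrightarrow> s = t" if "s \<in> S" "t \<in> S" for s t
      using that by (auto simp: f_def S_iff)
  qed
qed

context
  fixes H :: "nat set set" and \<mu> :: nat
  assumes hyp: "hypergraph \<mu> H" "3 \<le> \<mu>"
    and edge: "\<And>i. 1 \<le> i \<Longrightarrow> i < \<mu> \<Longrightarrow> {i, i + 1} \<in> H"
begin

lemma not_cohen_macaulay_saturated_triple:
  assumes "\<mu> = 3" "{1} \<in> H" "{2} \<in> H" "{3} \<in> H"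
  shows "\<not> cohen_macaulay_ideal (poly_ring H) (hypergraph_ideal \<mu> H :: (nat set, 'k::field) mpoly set)"
proof (rule not_cohen_macaulay_large_cover[OF hyp(1) _ edge, of "{1, 2, 3}" "\<lambda>s. {s}"])
  show "\<exists>s\<in>{1, 2, 3}. i \<in> {s}" if "1 \<le> i" "i \<le> \<mu>" for i using that assms(1) by auto
qed (use assms in auto)

text \<open>The closed vertex a and the two edges at c form a minimal cover: three faces against
  two.\<close>

lemma not_cohen_macaulay_four_cycle_closed:
  assumes V: "{1..\<mu>} = {a, b, c, d}" "distinct [a, b, c, d]"
    and faces: "{a} \<in> H" "{b, c} \<in> H" "{c, d} \<in> H"
  shows "\<not> cohen_macaulay_ideal (poly_ring H) (hypergraph_ideal \<mu> H :: (nat set, 'k::field) mpoly set)"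
proof -
  have \<mu>: "\<mu> = 4" using arg_cong[OF V(1), of card] V(2) by simp
  have mem: "i \<in> {a, b, c, d}" if "1 \<le> i" "i \<le> \<mu>" for i
    unfolding V(1)[symmetric] using that by simp
  show ?thesis
  proof (rule not_cohen_macaulay_large_cover[OF hyp(1) _ edge, of "{a, b, d}"
        "\<lambda>s. if s = a then {a} else if s = b then {b, c} else {c, d}"])
    show "{a, b, d} \<subseteq> {1..\<mu>}" unfolding V(1) by auto
    show "\<exists>s\<in>{a, b, d}. i \<in> (if s = a then {a} else if s = b then {b, c} else {c, d})"
      if "1 \<le> i" "i \<le> \<mu>" for i using mem[OF that] V(2) by auto
  qed (use \<mu> V(2) faces in auto)
qed

text \<open>The closed vertices a, b and the two edges at d: four faces against three.\<close>

lemma not_cohen_macaulay_five_cycle_closed: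
  assumes V: "{1..\<mu>} = {a, b, c, d, e}" "distinct [a, b, c, d, e]"
    and faces: "{a} \<in> H" "{b} \<in> H" "{c, d} \<in> H" "{d, e} \<in> H"
  shows "\<not> cohen_macaulay_ideal (poly_ring H) (hypergraph_ideal \<mu> H :: (nat set, 'k::field) mpoly set)"
proof -
  have \<mu>: "\<mu> = 5" using arg_cong[OF V(1), of card] V(2) by simp
  have mem: "i \<in> {a, b, c, d, e}" if "1 \<le> i" "i \<le> \<mu>" for i
    unfolding V(1)[symmetric] using that by simp
  show ?thesis
  proof (rule not_cohen_macaulay_large_cover[OF hyp(1) _ edge, of "{a, b, c, e}"
        "\<lambda>s. if s = a then {a} else if s = b then {b} else if s = c then {c, d} else {d, e}"])
    show "{a, b, c, e} \<subseteq> {1..\<mu>}" unfolding V(1) by auto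
    show "\<exists>s\<in>{a, b, c, e}. i \<in> (if s = a then {a} else if s = b then {b} else if s = c then {c, d} else {d, e})"
      if "1 \<le> i" "i \<le> \<mu>" for i using mem[OF that] V(2) by auto
  qed (use \<mu> V(2) faces in auto)
qed

text \<open>The closed vertex a, the two edges at c and the two at g: five faces against
  four.\<close>

lemma not_cohen_macaulay_seven_cycle_closed:
  assumes V: "{1..\<mu>} = {a, b, c, d, e, g, h}" "distinct [a, b, c, d, e, g, h]"
    and faces: "{a} \<in> H" "{b, c} \<in> H" "{c, d} \<in> H" "{e, g} \<in> H" "{g, h} \<in> H"
  shows "\<not> cohen_macaulay_ideal (poly_ring H) (hypergraph_ideal \<mu> H :: (nat set, 'k::field) mpoly set)"
proof -
  have \<mu>: "\<mu> = 7" using arg_cong[OF V(1), of card] V(2) by simp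
  have mem: "i \<in> {a, b, c, d, e, g, h}" if "1 \<le> i" "i \<le> \<mu>" for i
    unfolding V(1)[symmetric] using that by simp
  define f where "f s = (if s = a then {a} else if s = b then {b, c} else if s = d then {c, d}
    else if s = e then {e, g} else {g, h})" for s
  show ?thesis
  proof (rule not_cohen_macaulay_large_cover[OF hyp(1) _ edge, of "{a, b, d, e, h}" f])
    show "{a, b, d, e, h} \<subseteq> {1..\<mu>}" unfolding V(1) by auto
    show "\<exists>s\<in>{a, b, d, e, h}. i \<in> f s"
      if "1 \<le> i" "i \<le> \<mu>" for i using mem[OF that] V(2) by (auto simp: f_def)
    show "s \<in> f t \<longleftrightarrow> s = t" if "s \<in> {a, b, d, e, h}" "t \<in> {a, b, d, e, h}" for s t
      using that V(2) by (auto simp: f_def)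
  qed (use \<mu> V(2) faces in \<open>auto simp: f_def\<close>)
qed

end

section \<open>Open cycles with 4 and 7 vertices\<close>

definition cycle_edge :: "nat \<Rightarrow> nat \<Rightarrow> nat set" where
  "cycle_edge n i = {i + 1, Suc i mod n + 1}"

lemma inj_on_cycle_edge: "3 \<le> n \<Longrightarrow> inj_on (cycle_edge n) {..<n}"
  by (rule inj_onI) (auto simp: cycle_edge_def doubleton_eq_iff mod_Suc split: if_splits)

text \<open>In an open cycle each vertex lies in exactly two faces, which are consecutive edges. Its
  ideal is therefore the edge ideal of an n-cycle whose vertices are the edges, numbered from 0 to
  fit arithmetic modulo n.\<close>

lemma gens_over_open_cycle:
  assumes "3 \<le> n"
  shows "gens_over (cycle_edge n ` {..<n}) (star (cycle_edge n ` {..<n}) ` {1..n}) = cycle_edges n (cycle_edge n)"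
proof -
  let ?H = "cycle_edge n ` {..<n}"
  have "star ?H (Suc i mod n + 1) = {cycle_edge n i, cycle_edge n (Suc i mod n)}" if i: "i < n" for i
  proof -
    have "k = i \<or> k = Suc i mod n" if "k < n" "Suc i mod n + 1 \<in> cycle_edge n k" for k
      using that i by (auto simp: cycle_edge_def mod_Suc split: if_splits)
    moreover have "Suc i mod n < n" using i by simp
    ultimately show ?thesis
      using i by (auto simp: star_def cycle_edge_def)
  qed
  moreover have "{1..n} = (\<lambda>i. Suc i mod n + 1) ` {..<n}"
  proof
    show "{1..n} \<subseteq> (\<lambda>i. Suc i mod n + 1) ` {..<n}"
    proof
      fix j assume j: "j \<in> {1..n}"
      show "j \<in> (\<lambda>i. Suc i mod n + 1) ` {..<n}"
      proof (cases "j = 1")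
        case True
        then show ?thesis using assms by (intro image_eqI[of _ _ "n - 1"]) auto
      next
        case False
        then show ?thesis using j by (intro image_eqI[of _ _ "j - 2"]) auto
      qed
    qed
    show "(\<lambda>i. Suc i mod n + 1) ` {..<n} \<subseteq> {1..n}"
      using assms by (auto simp: Suc_le_eq)
  qed
  ultimately have "star ?H ` {1..n} = {{cycle_edge n i, cycle_edge n (Suc i mod n)} | i. i < n}"
    by (auto simp: image_image)
  then show ?thesis by (simp add: gens_over_def cycle_edges_def)
qed

text \<open>All minimal covers have the same size here, so covers give nothing. Edges 0 and 2 form a
  face, hence height at least 2, while no two elements are regular at the origin.\<close>

lemma not_cohen_macaulay_open_four_cycle:
  assumes "hypergraph 4 H" "H = cycle_edge 4 ` {..<4}"
  shows "\<not> cohen_macaulay_ideal (poly_ring H) (hypergraph_ideal 4 H :: (nat set, 'k::field) mpoly set)"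
  unfolding cohen_macaulay_ideal_def
proof (rule squarefree_not_cohen_macaulay[OF hypergraph_presentation[OF assms(1)], of "{cycle_edge 4 0, cycle_edge 4 2}"])
  let ?F = "{cycle_edge 4 0, cycle_edge 4 2}"
  have eq: "gens_over H (star H ` {1..4}) = cycle_edges 4 (cycle_edge 4)"
    unfolding assms(2) by (rule gens_over_open_cycle) simp
  have inj: "inj_on (cycle_edge 4) {..<4}" by (rule inj_on_cycle_edge) simp
  then have ne: "cycle_edge 4 i = cycle_edge 4 j \<longleftrightarrow> i = j" if "i < 4" "j < 4" for i j
    using that by (auto simp: inj_on_def)
  show "finite ?F" by simp
  show "\<not> G \<subseteq> ?F" if "G \<in> gens_over H (star H ` {1..4})" for G
  proof -
    have "G \<in> cycle_edges 4 (cycle_edge 4)" using that eq by simp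
    then consider i where "i < 4" "G = {cycle_edge 4 i, cycle_edge 4 (Suc i mod 4)}"
      | v where "G = {v}" "v \<notin> cycle_edge 4 ` {..<4}"
      unfolding cycle_edges_def by blast
    then show ?thesis
    proof cases
      case 1
      have mem: "j \<in> {0, 2}" if "cycle_edge 4 j \<in> ?F" "j < 4" for j
        using that ne[of j 0] ne[of j 2] by simp
      show ?thesis
      proof
        assume "G \<subseteq> ?F"
        then have "i \<in> {0, 2}" "Suc i mod 4 \<in> {0, 2}"
          using 1 by (intro mem; simp)+
        then show False by auto
      qed
    qed auto
  qed
  fix fs :: "(nat set, 'k) mpoly list"
  assume fs: "set fs \<subseteq> face_prime {}" "length fs = card ?F"
  have "length fs = 2" using fs(2) ne[of 0 2] by simp
  then obtain f g where "fs = [f, g]" by (auto simp: numeral_2_eq_2 length_Suc_conv)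
  then show "\<not> weakly_regular (monomial_ideal (gens_over H (star H ` {1..4}))) fs"
    unfolding eq using two_mod_four_not_regular[OF inj, of f g] fs(1) by simp
qed

text \<open>As for four vertices, with the three-element face formed by edges 0, 2 and 4.\<close>

lemma not_cohen_macaulay_open_seven_cycle:
  assumes "hypergraph 7 H" "H = cycle_edge 7 ` {..<7}"
  shows "\<not> cohen_macaulay_ideal (poly_ring H) (hypergraph_ideal 7 H :: (nat set, 'k::field) mpoly set)"
  unfolding cohen_macaulay_ideal_def
proof (rule squarefree_not_cohen_macaulay[OF hypergraph_presentation[OF assms(1)],
      of "{cycle_edge 7 0, cycle_edge 7 2, cycle_edge 7 4}"])
  let ?F = "{cycle_edge 7 0, cycle_edge 7 2, cycle_edge 7 4}"
  have eq: "gens_over H (star H ` {1..7}) = cycle_edges 7 (cycle_edge 7)"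
    unfolding assms(2) by (rule gens_over_open_cycle) simp
  have inj: "inj_on (cycle_edge 7) {..<7}" by (rule inj_on_cycle_edge) simp
  then have ne: "cycle_edge 7 i = cycle_edge 7 j \<longleftrightarrow> i = j" if "i < 7" "j < 7" for i j
    using that by (auto simp: inj_on_def)
  show "finite ?F" by simp
  show "\<not> G \<subseteq> ?F" if "G \<in> gens_over H (star H ` {1..7})" for G
  proof -
    have "G \<in> cycle_edges 7 (cycle_edge 7)" using that eq by simp
    then consider i where "i < 7" "G = {cycle_edge 7 i, cycle_edge 7 (Suc i mod 7)}"
      | v where "G = {v}" "v \<notin> cycle_edge 7 ` {..<7}"
      unfolding cycle_edges_def by blast
    then show ?thesis
    proof cases
      case 1
      have mem: "j \<in> {0, 2, 4}" if "cycle_edge 7 j \<in> ?F" "j < 7" for j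
        using that ne[of j 0] ne[of j 2] ne[of j 4] by simp
      show ?thesis
      proof
        assume "G \<subseteq> ?F"
        then have "i \<in> {0, 2, 4}" "Suc i mod 7 \<in> {0, 2, 4}"
          using 1 by (intro mem; simp)+
        then show False by auto
      qed
    qed auto
  qed
  fix fs :: "(nat set, 'k) mpoly list"
  assume fs: "set fs \<subseteq> face_prime {}" "length fs = card ?F"
  have "length fs = 3" using fs(2) ne[of 0 2] ne[of 0 4] ne[of 2 4] by simp
  then obtain f g h where "fs = [f, g, h]" by (auto simp: numeral_3_eq_3 length_Suc_conv)
  then show "\<not> weakly_regular (monomial_ideal (gens_over H (star H ` {1..7}))) fs"
    unfolding eq using three_mod_seven_not_regular[OF inj, of f g h] fs(1) by simp
qed

section \<open>Cohen-Macaulay strings and cycles\<close>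

text \<open>Common to strings and cycles: \<open>{a, b}\<close> is the star of an open vertex lying
  in exactly two faces.\<close>

lemma cohen_macaulay_triple:
  fixes H :: "nat set set"
  assumes hyp: "hypergraph 3 H" and small: "\<And>F. F \<in> H \<Longrightarrow> card F \<le> 2"
    and stars: "star H ` {1..3} = {insert a A, {a, b}, insert b B}"
    and ab: "a \<in> H" "b \<in> H" "a \<noteq> b"
    and A: "A \<subseteq> H - {a, b}" "A \<noteq> {}" and B: "B \<subseteq> H - {a, b}" "B \<noteq> {}"
  shows "cohen_macaulay_ideal (poly_ring H) (hypergraph_ideal 3 H :: (nat set, 'k::field) mpoly set)"
proof (rule cohen_macaulay_shellable[OF hyp small refl])
  fix \<theta> :: "(nat set, 'k) mpoly list"
  assume reg: "\<And>F. F \<subseteq> H \<Longrightarrow> card F = card H - (3 + 1) div 2 \<Longrightarrow> weakly_regular (face_prime F) \<theta>"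
  have finH: "finite H" using hyp by (rule hypergraph_finite)
  have "card {a, b} \<le> card H" using ab finH by (intro card_mono) auto
  then have "card H = (card H - (3 + 1) div 2) + 2" using ab(3) by simp
  then show "weakly_regular (monomial_ideal (gens_over H (star H ` {1..3}))) \<theta>"
    unfolding stars
    using weakly_regular_path[OF finH reg subset_refl _ ab A B] by blast
qed auto

lemma cohen_macaulay_open_triple_string:
  assumes hyp: "hypergraph 3 H" and H: "H = {{1, 2}, {2, 3}, {1}, {3}}"
  shows "cohen_macaulay_ideal (poly_ring H) (hypergraph_ideal 3 H :: (nat set, 'k::field) mpoly set)"
proof (rule cohen_macaulay_triple[OF hyp, of "{1, 2}" "{{1}}" "{2, 3}" "{{3}}"])
  have "{1..3} = {1, 2, 3 :: nat}" by auto
  moreover have "star H 1 = {{1, 2}, {1}}" "star H 2 = {{1, 2}, {2, 3}}" "star H 3 = {{2, 3}, {3}}"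
    unfolding H star_def by auto
  ultimately show "star H ` {1..3} = {insert {1, 2} {{1}}, {{1, 2}, {2, 3}}, insert {2, 3} {{3}}}"
    by simp
qed (auto simp: H doubleton_eq_iff card_insert_if)

text \<open>The labels are rotated so that a is open; possible singletons at b and c are absorbed
  into the side sets.\<close>

lemma cohen_macaulay_three_cycle:
  assumes hyp: "hypergraph 3 H" and V: "{1..3} = {a, b, c}" "distinct [a, b, c]"
    and H: "H = {{a, b}, {b, c}, {c, a}} \<union> {{i} | i. i \<in> S}" and a: "a \<notin> S"
  shows "cohen_macaulay_ideal (poly_ring H) (hypergraph_ideal 3 H :: (nat set, 'k::field) mpoly set)"
proof -
  define cl where "cl v = (if v \<in> S then {{v}} else {})" for v
  show ?thesis
  proof (rule cohen_macaulay_triple[OF hyp, of "{a, b}" "insert {b, c} (cl b)" "{c, a}" "insert {b, c} (cl c)"])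
    have "star H a = {{a, b}, {c, a}}" "star H b = insert {a, b} (insert {b, c} (cl b))"
      "star H c = insert {c, a} (insert {b, c} (cl c))"
      using V(2) a by (auto simp: H star_def cl_def)
    then show "star H ` {1..3} = {insert {a, b} (insert {b, c} (cl b)), {{a, b}, {c, a}},
        insert {c, a} (insert {b, c} (cl c))}"
      unfolding V(1) by auto
  qed (use V(2) in \<open>auto simp: H cl_def doubleton_eq_iff card_insert_if\<close>)
qed

text \<open>The labels are rotated so that only the nonadjacent vertices a and c may be closed;
  their singletons take the places X and Y of \<open>weakly_regular_pentagon\<close>.\<close>

lemma cohen_macaulay_five_cycle:
  assumes hyp: "hypergraph 5 H" and V: "{1..5} = {a, b, c, d, e}" "distinct [a, b, c, d, e]"
    and H: "H = {{a, b}, {b, c}, {c, d}, {d, e}, {e, a}} \<union> {{i} | i. i \<in> S}"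
    and S: "b \<notin> S" "d \<notin> S" "e \<notin> S"
  shows "cohen_macaulay_ideal (poly_ring H) (hypergraph_ideal 5 H :: (nat set, 'k::field) mpoly set)"
proof (rule cohen_macaulay_shellable[OF hyp _ refl])
  fix \<theta> :: "(nat set, 'k) mpoly list"
  assume reg: "\<And>F. F \<subseteq> H \<Longrightarrow> card F = card H - (5 + 1) div 2 \<Longrightarrow> weakly_regular (face_prime F) \<theta>"
  define cl where "cl v = (if v \<in> S then {{v}} else {})" for v
  have finH: "finite H" using hyp by (rule hypergraph_finite)
  have edges: "{{a, b}, {b, c}, {c, d}, {d, e}, {e, a}} \<subseteq> H"
    "distinct [{a, b}, {b, c}, {c, d}, {d, e}, {e, a}]"
    using V(2) by (auto simp: H doubleton_eq_iff)
  have "card (set [{a, b}, {b, c}, {c, d}, {d, e}, {e, a}]) \<le> card H"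
    using edges(1) finH by (intro card_mono) auto
  then have "card H = (card H - (5 + 1) div 2) + 3"
    using distinct_card[OF edges(2)] by simp
  moreover have "star H ` {1..5} = {insert {a, b} (insert {e, a} (cl a)), {{a, b}, {b, c}},
      insert {b, c} (insert {c, d} (cl c)), {{c, d}, {d, e}}, {{d, e}, {e, a}}}"
  proof -
    have "star H a = insert {a, b} (insert {e, a} (cl a))" "star H b = {{a, b}, {b, c}}"
      "star H c = insert {b, c} (insert {c, d} (cl c))" "star H d = {{c, d}, {d, e}}"
      "star H e = {{d, e}, {e, a}}"
      using V(2) S by (auto simp: H star_def cl_def)
    then show ?thesis unfolding V(1) by simp
  qed
  moreover have "cl a \<subseteq> H - {{a, b}, {b, c}, {c, d}, {d, e}, {e, a}}"
    "cl c \<subseteq> H - {{a, b}, {b, c}, {c, d}, {d, e}, {e, a}}"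
    using V(2) by (auto simp: cl_def H)
  ultimately show "weakly_regular (monomial_ideal (gens_over H (star H ` {1..5}))) \<theta>"
    using weakly_regular_pentagon[OF finH reg subset_refl _ edges] by simp
qed (use V(2) in \<open>auto simp: H card_insert_if\<close>)

text \<open>Separating 1 from 2 requires a face with 1 but not 2, and only the singleton qualifies;
  likewise at the other end.\<close>

lemma string_hypergraph_faces:
  assumes "string_hypergraph \<mu> H" "2 \<le> \<mu>"
  shows "\<And>i. 1 \<le> i \<Longrightarrow> i < \<mu> \<Longrightarrow> {i, i + 1} \<in> H" "{1} \<in> H" "{\<mu>} \<in> H"
proof -
  obtain S where H: "H = {{i, i + 1} | i. 1 \<le> i \<and> i < \<mu>} \<union> {{i} | i. i \<in> S}"
    and sep: "separated \<mu> H"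
    using assms(1) by (auto simp: string_hypergraph_def)
  show "{i, i + 1} \<in> H" if "1 \<le> i" "i < \<mu>" for i unfolding H using that by blast
  have "\<exists>F\<in>H. \<exists>G\<in>H. 1 \<in> F - G \<and> 2 \<in> G - F"
    using sep assms(2) by (auto simp: separated_def)
  then obtain F where "F \<in> H" "1 \<in> F" "2 \<notin> F" by blast
  then show "{1} \<in> H" unfolding H by auto
  have "\<exists>F\<in>H. \<exists>G\<in>H. \<mu> - 1 \<in> F - G \<and> \<mu> \<in> G - F"
    using sep assms(2) by (auto simp: separated_def)
  then obtain G where "G \<in> H" "\<mu> \<in> G" "\<mu> - 1 \<notin> G" by blast
  then show "{\<mu>} \<in> H" unfolding H by auto
qed

theorem string_cohen_macaulay_iff:
  fixes \<mu> :: nat and H :: "nat set set"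
  assumes "1 \<le> \<mu>" and str: "string_hypergraph \<mu> H"
  shows "cohen_macaulay_ideal (poly_ring H) (hypergraph_ideal \<mu> H :: (nat set, 'k::field) mpoly set) \<longleftrightarrow>
    \<mu> = 1 \<or> \<mu> = 3 \<and> \<not> saturated \<mu> H"
proof -
  have hyp: "hypergraph \<mu> H" using str by (simp add: string_hypergraph_def)
  obtain S where H: "H = {{i, i + 1} | i. 1 \<le> i \<and> i < \<mu>} \<union> {{i} | i. i \<in> S}" "S \<subseteq> {1..\<mu>}"
    using str by (auto simp: string_hypergraph_def)
  consider "\<mu> = 1" | "\<mu> = 3" | "2 \<le> \<mu>" "\<mu> \<noteq> 3" using assms(1) by linarith
  then show ?thesis
  proof cases
    case 1
    have H1: "H = {{1}}"
      using hyp H unfolding hypergraph_def 1 by auto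
    have star1: "star H ` {1..\<mu>} = {H}" by (auto simp: 1 H1 star_def)
    have "cohen_macaulay_ideal (poly_ring H) (hypergraph_ideal \<mu> H :: (nat set, 'k) mpoly set)"
    proof (rule cohen_macaulay_shellable[OF hyp _ refl])
      fix \<theta> :: "(nat set, 'k) mpoly list"
      assume reg: "\<And>F. F \<subseteq> H \<Longrightarrow> card F = card H - (\<mu> + 1) div 2 \<Longrightarrow> weakly_regular (face_prime F) \<theta>"
      show "weakly_regular (monomial_ideal (gens_over H (star H ` {1..\<mu>}))) \<theta>"
        unfolding star1
        by (rule weakly_regular_principal[where d = 0 and H = H])
          (use reg in \<open>auto simp: H1 1\<close>)
    qed (simp add: H1)
    then show ?thesis using 1 by simp
  next
    case 2
    have faces: "{1, 2} \<in> H" "{2, 3} \<in> H" "{1} \<in> H" "{3} \<in> H"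
      using string_hypergraph_faces[OF str] 2 by (force simp: numeral_eq_Suc)+
    have hyp3: "hypergraph 3 H" using hyp 2 by simp
    show ?thesis
    proof (cases "{2} \<in> H")
      case True
      have "saturated \<mu> H" using faces True by (auto simp: 2 saturated_def closed_vertex_def numeral_eq_Suc le_Suc_eq)
      moreover have "\<not> cohen_macaulay_ideal (poly_ring H) (hypergraph_ideal \<mu> H :: (nat set, 'k) mpoly set)"
        using 2 faces True string_hypergraph_faces[OF str]
        by (intro not_cohen_macaulay_saturated_triple[OF hyp]) auto
      ultimately show ?thesis using 2 by simp
    next
      case False
      have "H = {{1, 2}, {2, 3}, {1}, {3}}"
      proof
        have "S \<subseteq> {1, 3}"
        proof
          fix i assume "i \<in> S"
          then have "{i} \<in> H" "i \<in> {1..3}" using H 2 by auto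
          then show "i \<in> {1, 3}" using False by (cases "i = 2") auto
        qed
        then have "F \<in> {{1, 2}, {2, 3}, {1}, {3}}" if "F \<in> H" for F
        proof -
          consider i where "F = {i, i + 1}" "1 \<le> i" "i < \<mu>" | i where "F = {i}" "i \<in> S"
            using \<open>F \<in> H\<close> unfolding H(1) by blast
          then show ?thesis
          proof cases
            case (1 i)
            then have "i = 1 \<or> i = 2" using 2 by auto
            then show ?thesis using 1 by auto
          qed (use \<open>S \<subseteq> {1, 3}\<close> in auto)
        qed
        then show "H \<subseteq> {{1, 2}, {2, 3}, {1}, {3}}" by blast
      qed (use faces in simp)
      then have "cohen_macaulay_ideal (poly_ring H) (hypergraph_ideal 3 H :: (nat set, 'k) mpoly set)"
        by (rule cohen_macaulay_open_triple_string[OF hyp3])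
      moreover have "\<not> saturated \<mu> H" using False 2 by (auto simp: saturated_def closed_vertex_def)
      ultimately show ?thesis using 2 by simp
    qed
  next
    case 3
    then show ?thesis
      using not_cohen_macaulay_string[OF hyp 3] string_hypergraph_faces[OF str 3(1)] by auto
  qed
qed

section \<open>Case distinction for cycles\<close>

lemma cycle_edge_image:
  assumes "1 \<le> n"
  shows "cycle_edge n ` {..<n} = {{i, i + 1} | i. 1 \<le> i \<and> i < n} \<union> {{n, 1}}"
proof -
  obtain m where m: "n = Suc m" using assms by (cases n) auto
  have "cycle_edge n i = {Suc i, Suc i + 1}" if "i < m" for i
    using that by (simp add: cycle_edge_def m)
  then have "cycle_edge n ` {..<m} = {{i, i + 1} | i. 1 \<le> i \<and> i < n}"
    unfolding m by (auto simp: image_iff) (metis Suc_le_D Suc_less_eq lessThan_iff)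
  moreover have "cycle_edge n m = {n, 1}" by (simp add: cycle_edge_def m)
  ultimately show ?thesis by (simp add: m lessThan_Suc insert_commute)
qed

lemma cycle_cohen_macaulay_3_iff:
  assumes hyp: "hypergraph 3 H" and H: "H = {{1, 2}, {2, 3}, {3, 1}} \<union> {{i} | i. i \<in> S}" "S \<subseteq> {1..3}"
  shows "cohen_macaulay_ideal (poly_ring H) (hypergraph_ideal 3 H :: (nat set, 'k::field) mpoly set) \<longleftrightarrow>
    \<not> saturated 3 H"
proof -
  have edge: "{i, i + 1} \<in> H" if "1 \<le> i" "i < 3" for i
  proof -
    have "i = 1 \<or> i = 2" using that by auto
    then show ?thesis by (auto simp: H)
  qed
  have V: "{1..3} = {1, 2, 3 :: nat}" by auto
  have closed: "{v} \<in> H \<longleftrightarrow> v \<in> S" for v by (auto simp: H)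
  have sat: "saturated 3 H \<longleftrightarrow> 1 \<in> S \<and> 2 \<in> S \<and> 3 \<in> S"
    unfolding saturated_def closed_vertex_def V closed by simp
  show ?thesis
  proof
    show "\<not> saturated 3 H"
      if "cohen_macaulay_ideal (poly_ring H) (hypergraph_ideal 3 H :: (nat set, 'k) mpoly set)"
      using not_cohen_macaulay_saturated_triple[OF hyp _ edge] that unfolding sat by (auto simp: closed)
    assume "\<not> saturated 3 H"
    then consider "1 \<notin> S" | "2 \<notin> S" | "3 \<notin> S" unfolding sat by blast
    then show "cohen_macaulay_ideal (poly_ring H) (hypergraph_ideal 3 H :: (nat set, 'k) mpoly set)"
    proof cases
      case 1
      then show ?thesis by (intro cohen_macaulay_three_cycle[OF hyp, of 1 2 3 S]) (auto simp: V H)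
    next
      case 2
      then show ?thesis by (intro cohen_macaulay_three_cycle[OF hyp, of 2 3 1 S]) (auto simp: V H)
    next
      case 3
      then show ?thesis by (intro cohen_macaulay_three_cycle[OF hyp, of 3 1 2 S]) (auto simp: V H)
    qed
  qed
qed

lemma not_cohen_macaulay_four_cycle:
  assumes hyp: "hypergraph 4 H" and H: "H = cycle_edge 4 ` {..<4} \<union> {{i} | i. i \<in> S}" "S \<subseteq> {1..4}"
  shows "\<not> cohen_macaulay_ideal (poly_ring H) (hypergraph_ideal 4 H :: (nat set, 'k::field) mpoly set)"
proof (cases "S = {}")
  case True
  then show ?thesis by (intro not_cohen_macaulay_open_four_cycle[OF hyp]) (simp add: H)
next
  case False
  have edge: "{i, i + 1} \<in> H" if "1 \<le> i" "i < 4" for i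
    using that unfolding H cycle_edge_image[of 4, simplified] by auto
  have edges: "{1, 2} \<in> H" "{2, 3} \<in> H" "{3, 4} \<in> H" "{4, 1} \<in> H"
  proof -
    show "{4, 1} \<in> H" unfolding H cycle_edge_image[of 4, simplified] by simp
  qed (use edge[of 1] edge[of 2] edge[of 3] in \<open>simp_all add: eval_nat_numeral\<close>)
  have V: "{1..4} = {1, 2, 3, 4 :: nat}" by auto
  note lem = not_cohen_macaulay_four_cycle_closed[OF hyp _ edge]
  obtain v where v: "v \<in> S" using False by blast
  then have "{v} \<in> H" by (auto simp: H)
  moreover have "v \<in> {1, 2, 3, 4}" using v H(2) V by blast
  ultimately consider "{1} \<in> H" | "{2} \<in> H" | "{3} \<in> H" | "{4} \<in> H" by blast
  then show ?thesis
  proof cases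
    case 1
    then show ?thesis by (intro lem[of 1 2 3 4]) (use edges in \<open>auto simp: V insert_commute\<close>)
  next
    case 2
    then show ?thesis by (intro lem[of 2 3 4 1]) (use edges in \<open>auto simp: V insert_commute\<close>)
  next
    case 3
    then show ?thesis by (intro lem[of 3 4 1 2]) (use edges in \<open>auto simp: V insert_commute\<close>)
  next
    case 4
    then show ?thesis by (intro lem[of 4 1 2 3]) (use edges in \<open>auto simp: V insert_commute\<close>)
  qed
qed

lemma not_cohen_macaulay_seven_cycle:
  assumes hyp: "hypergraph 7 H" and H: "H = cycle_edge 7 ` {..<7} \<union> {{i} | i. i \<in> S}" "S \<subseteq> {1..7}"
  shows "\<not> cohen_macaulay_ideal (poly_ring H) (hypergraph_ideal 7 H :: (nat set, 'k::field) mpoly set)"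
proof (cases "S = {}")
  case True
  then show ?thesis by (intro not_cohen_macaulay_open_seven_cycle[OF hyp]) (simp add: H)
next
  case False
  have edge: "{i, i + 1} \<in> H" if "1 \<le> i" "i < 7" for i
    using that unfolding H cycle_edge_image[of 7, simplified] by auto
  have edges: "{1, 2} \<in> H" "{2, 3} \<in> H" "{3, 4} \<in> H" "{4, 5} \<in> H" "{5, 6} \<in> H" "{6, 7} \<in> H" "{7, 1} \<in> H"
  proof -
    show "{7, 1} \<in> H" unfolding H cycle_edge_image[of 7, simplified] by simp
  qed (use edge[of 1] edge[of 2] edge[of 3] edge[of 4] edge[of 5] edge[of 6]
      in \<open>simp_all add: eval_nat_numeral\<close>)
  have V: "{1..7} = {1, 2, 3, 4, 5, 6, 7 :: nat}" by auto
  note lem = not_cohen_macaulay_seven_cycle_closed[OF hyp _ edge]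
  obtain v where v: "v \<in> S" using False by blast
  then have "{v} \<in> H" by (auto simp: H)
  moreover have "v \<in> {1, 2, 3, 4, 5, 6, 7}" using v H(2) V by blast
  ultimately consider "{1} \<in> H" | "{2} \<in> H" | "{3} \<in> H" | "{4} \<in> H" | "{5} \<in> H" | "{6} \<in> H" | "{7} \<in> H" by blast
  then show ?thesis
  proof cases
    case 1
    then show ?thesis by (intro lem[of 1 2 3 4 5 6 7]) (use edges in \<open>auto simp: V insert_commute\<close>)
  next
    case 2
    then show ?thesis by (intro lem[of 2 3 4 5 6 7 1]) (use edges in \<open>auto simp: V insert_commute\<close>)
  next
    case 3
    then show ?thesis by (intro lem[of 3 4 5 6 7 1 2]) (use edges in \<open>auto simp: V insert_commute\<close>)
  next
    case 4
    then show ?thesis by (intro lem[of 4 5 6 7 1 2 3]) (use edges in \<open>auto simp: V insert_commute\<close>)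
  next
    case 5
    then show ?thesis by (intro lem[of 5 6 7 1 2 3 4]) (use edges in \<open>auto simp: V insert_commute\<close>)
  next
    case 6
    then show ?thesis by (intro lem[of 6 7 1 2 3 4 5]) (use edges in \<open>auto simp: V insert_commute\<close>)
  next
    case 7
    then show ?thesis by (intro lem[of 7 1 2 3 4 5 6]) (use edges in \<open>auto simp: V insert_commute\<close>)
  qed
qed

lemma cycle_cohen_macaulay_5_iff:
  assumes hyp: "hypergraph 5 H"
    and H: "H = {{1, 2}, {2, 3}, {3, 4}, {4, 5}, {5, 1}} \<union> {{i} | i. i \<in> S}" "S \<subseteq> {1..5}"
  shows "cohen_macaulay_ideal (poly_ring H) (hypergraph_ideal 5 H :: (nat set, 'k::field) mpoly set) \<longleftrightarrow>
    \<not> (\<exists>v\<in>{1..5}. \<exists>w\<in>{1..5}. adjacent H v w \<and> closed_vertex H v \<and> closed_vertex H w)"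
proof -
  have edges: "{1, 2} \<in> H" "{2, 3} \<in> H" "{3, 4} \<in> H" "{4, 5} \<in> H" "{5, 1} \<in> H"
    by (simp_all add: H)
  have edge: "{i, i + 1} \<in> H" if "1 \<le> i" "i < 5" for i
  proof -
    have "i = 1 \<or> i = 2 \<or> i = 3 \<or> i = 4" using that by auto
    then show ?thesis using edges by (auto simp: eval_nat_numeral)
  qed
  have V: "{1..5} = {1, 2, 3, 4, 5 :: nat}" by auto
  have closed: "{v} \<in> H \<longleftrightarrow> v \<in> S" for v by (auto simp: H)
  have adj: "adjacent H v w \<longleftrightarrow> {v, w} \<in> {{1, 2}, {2, 3}, {3, 4}, {4, 5}, {5, 1}}" for v w
    unfolding adjacent_def H by (auto simp: doubleton_eq_iff)
  have pair: "(\<exists>v\<in>{1..5}. \<exists>w\<in>{1..5}. adjacent H v w \<and> closed_vertex H v \<and> closed_vertex H w) \<longleftrightarrow>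
    1 \<in> S \<and> 2 \<in> S \<or> 2 \<in> S \<and> 3 \<in> S \<or> 3 \<in> S \<and> 4 \<in> S \<or> 4 \<in> S \<and> 5 \<in> S \<or> 5 \<in> S \<and> 1 \<in> S"
    unfolding adj closed_vertex_def closed V by (auto simp: doubleton_eq_iff)
  note not_cm = not_cohen_macaulay_five_cycle_closed[OF hyp _ edge]
  note cm = cohen_macaulay_five_cycle[OF hyp]
  show ?thesis
  proof (cases "\<exists>v\<in>{1..5}. \<exists>w\<in>{1..5}. adjacent H v w \<and> closed_vertex H v \<and> closed_vertex H w")
    case True
    then consider "1 \<in> S" "2 \<in> S" | "2 \<in> S" "3 \<in> S" | "3 \<in> S" "4 \<in> S" | "4 \<in> S" "5 \<in> S" | "5 \<in> S" "1 \<in> S" unfolding pair by blast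
    then have "\<not> cohen_macaulay_ideal (poly_ring H) (hypergraph_ideal 5 H :: (nat set, 'k) mpoly set)"
    proof cases
      case 1
      then show ?thesis by (intro not_cm[of 1 2 3 4 5]) (use edges in \<open>auto simp: V closed insert_commute\<close>)
    next
      case 2
      then show ?thesis by (intro not_cm[of 2 3 4 5 1]) (use edges in \<open>auto simp: V closed insert_commute\<close>)
    next
      case 3
      then show ?thesis by (intro not_cm[of 3 4 5 1 2]) (use edges in \<open>auto simp: V closed insert_commute\<close>)
    next
      case 4
      then show ?thesis by (intro not_cm[of 4 5 1 2 3]) (use edges in \<open>auto simp: V closed insert_commute\<close>)
    next
      case 5
      then show ?thesis by (intro not_cm[of 5 1 2 3 4]) (use edges in \<open>auto simp: V closed insert_commute\<close>)
    qed
    then show ?thesis using True by blast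
  next
    case False
    \<comment> \<open>The closed vertices form an independent set of the 5-cycle, hence lie in a
      pair at distance two; the five cases are the rotations of that pair.\<close>
    then consider "2 \<notin> S" "4 \<notin> S" "5 \<notin> S" | "3 \<notin> S" "5 \<notin> S" "1 \<notin> S" | "4 \<notin> S" "1 \<notin> S" "2 \<notin> S" | "5 \<notin> S" "2 \<notin> S" "3 \<notin> S" | "1 \<notin> S" "3 \<notin> S" "4 \<notin> S" unfolding pair by blast
    then have "cohen_macaulay_ideal (poly_ring H) (hypergraph_ideal 5 H :: (nat set, 'k) mpoly set)"
    proof cases
      case 1
      then show ?thesis by (intro cm[of 1 2 3 4 5 S]) (auto simp: V H)
    next
      case 2
      then show ?thesis by (intro cm[of 2 3 4 5 1 S]) (auto simp: V H)
    next
      case 3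
      then show ?thesis by (intro cm[of 3 4 5 1 2 S]) (auto simp: V H)
    next
      case 4
      then show ?thesis by (intro cm[of 4 5 1 2 3 S]) (auto simp: V H)
    next
      case 5
      then show ?thesis by (intro cm[of 5 1 2 3 4 S]) (auto simp: V H)
    qed
    then show ?thesis using False by blast
  qed
qed

theorem cycle_cohen_macaulay_iff:
  fixes \<mu> :: nat and H :: "nat set set"
  assumes cyc: "cycle_hypergraph \<mu> H"
  shows "cohen_macaulay_ideal (poly_ring H) (hypergraph_ideal \<mu> H :: (nat set, 'k::field) mpoly set) \<longleftrightarrow>
    \<mu> = 3 \<and> \<not> saturated \<mu> H \<or>
    \<mu> = 5 \<and> \<not> (\<exists>v\<in>{1..\<mu>}. \<exists>w\<in>{1..\<mu>}. adjacent H v w \<and> closed_vertex H v \<and> closed_vertex H w)"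
proof -
  have hyp: "hypergraph \<mu> H" and \<mu>: "3 \<le> \<mu>" using cyc by (auto simp: cycle_hypergraph_def)
  obtain S where H: "H = {{i, i + 1} | i. 1 \<le> i \<and> i < \<mu>} \<union> {{\<mu>, 1}} \<union> {{i} | i. i \<in> S}" "S \<subseteq> {1..\<mu>}"
    using cyc by (auto simp: cycle_hypergraph_def)
  have H': "H = cycle_edge \<mu> ` {..<\<mu>} \<union> {{i} | i. i \<in> S}"
    using H(1) cycle_edge_image[of \<mu>] \<mu> by simp
  have edge: "{i, i + 1} \<in> H" if "1 \<le> i" "i < \<mu>" for i using that unfolding H by blast
  consider "\<mu> = 3" | "\<mu> = 4" | "\<mu> = 5" | "\<mu> = 7" | "6 \<le> \<mu>" "\<mu> \<noteq> 7" using \<mu> by linarith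
  then show ?thesis
  proof cases
    case 1
    have "H = {{1, 2}, {2, 3}, {3, 1}} \<union> {{i} | i. i \<in> S}"
    proof -
      have "{..<3} = {0, 1, 2 :: nat}" by auto
      moreover have "cycle_edge 3 0 = {1, 2}" "cycle_edge 3 1 = {2, 3}" "cycle_edge 3 2 = {3, 1}"
        by (simp_all add: cycle_edge_def) (simp_all add: eval_nat_numeral)
      ultimately show ?thesis unfolding H' 1 by simp
    qed
    then show ?thesis
      using cycle_cohen_macaulay_3_iff[of H S] hyp H(2) 1 by simp
  next
    case 2
    then show ?thesis using not_cohen_macaulay_four_cycle[of H S] hyp H' H(2) by simp
  next
    case 3
    have "H = {{1, 2}, {2, 3}, {3, 4}, {4, 5}, {5, 1}} \<union> {{i} | i. i \<in> S}"
    proof -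
      have "{..<5} = {0, 1, 2, 3, 4 :: nat}" by auto
      moreover have "cycle_edge 5 0 = {1, 2}" "cycle_edge 5 1 = {2, 3}" "cycle_edge 5 2 = {3, 4}"
        "cycle_edge 5 3 = {4, 5}" "cycle_edge 5 4 = {5, 1}"
        by (simp_all add: cycle_edge_def) (simp_all add: eval_nat_numeral)
      ultimately show ?thesis unfolding H' 3 by simp
    qed
    then show ?thesis
      using cycle_cohen_macaulay_5_iff[of H S] hyp H(2) 3 by simp
  next
    case 4
    then show ?thesis using not_cohen_macaulay_seven_cycle[of H S] hyp H' H(2) by simp
  next
    case 5
    then show ?thesis using not_cohen_macaulay_long_cycle[OF hyp 5 edge] by simp
  qed
qed

section \<open>The classification\<close>

theorem theorem4p18:
  fixes \<mu> :: nat and H :: "nat set set"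
  assumes "1 \<le> \<mu>" and "hypergraph \<mu> H" and "separated \<mu> H"
  shows "(string_hypergraph \<mu> H \<longrightarrow>
            (cohen_macaulay_ideal (poly_ring H)
               (hypergraph_ideal \<mu> H :: ((nat set \<Rightarrow>\<^sub>0 nat) \<Rightarrow>\<^sub>0 'k::field) set) \<longleftrightarrow>
             \<mu> = 1 \<or> (\<mu> = 3 \<and> \<not> saturated \<mu> H)))
         \<and>
         (cycle_hypergraph \<mu> H \<longrightarrow>
            (cohen_macaulay_ideal (poly_ring H)
               (hypergraph_ideal \<mu> H :: ((nat set \<Rightarrow>\<^sub>0 nat) \<Rightarrow>\<^sub>0 'k::field) set) \<longleftrightarrow>
             (\<mu> = 3 \<and> \<not> saturated \<mu> H) \<or>
             (\<mu> = 5 \<and> \<not> (\<exists>v \<in> {1..\<mu>}. \<exists>w \<in> {1..\<mu>}.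
                            adjacent H v w \<and> closed_vertex H v \<and> closed_vertex H w))))"
  using string_cohen_macaulay_iff[OF assms(1), of H] cycle_cohen_macaulay_iff[of \<mu> H] by blast

end
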